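(* Let $d\ge1$ and $k\ge1$ be integers, let $\Omega\subset\mathbb R^d$ be a bounded Lipschitz domain, let $0<p,q\le\infty$, and set $s_0:=k+d/p$ (with $d/\infty=0$). Then for every $0<s<s_0$, $$B^s_{p,q}(\Omega)\not\hookrightarrow\mathcal L_1(\mathbb D).$$
   Context: All function spaces are real. Elements of the spaces below are identified as distributions in $\mathcal D'(\Omega)$. For (quasi-)normed spaces $Y,Z$ of distributions on $\Omega$, $Y\hookrightarrow Z$ means that $Y\subset Z$ and there is a constant $C$ with $\|f\|_Z\le C\|f\|_Y$ for all $f\in Y$; $Y\not\hookrightarrow Z$ means that this fails. Dictionary and variation space. $\sigma_k(t):=\max\{t,0\}^k$, $\mathbb S^{d-1}:=\{\omega\in\mathbb R^d:|\omega|=1\}$, and $c>0$ is a fixed number with $-c<\inf_{x\in\Omega,\,\omega\in\mathbb S^{d-1}}\omega\cdot x<\sup_{x\in\Omega,\,\omega\in\mathbb S^{d-1}}\omega\cdot x<c$. The dictionary is the set of functions on $\Omega$ given by $\mathbb D:=\{\sigma_k(\omega\cdot x-b):\omega\in\mathbb S^{d-1},\ b\in[-c,c]\}$. Let $\mathcal K(\mathbb D)$ be the closure in $L^2(\Omega)$ of $\{\sum_{i=1}^N a_iv_i: N\ge 1,\ v_i\in\mathbb D,\ a_i\in\mathbb R,\ \sum_{i=1}^N|a_i|\le 1\}$. Then $\|f\|_{\mathcal L_1(\mathbb D)}:=\inf\{t>0:f\in t\mathcal K(\mathbb D)\}$ and $\mathcal L_1(\mathbb D):=\{f\in L^2(\Omega):\|f\|_{\mathcal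 L_1(\mathbb D)}<\infty\}$. (Equivalently, $\|f\|_{\mathcal L_1(\mathbb D)}$ is the infimum of $\|\mu\|_{\mathrm{TV}}$ over finite signed Borel measures $\mu$ on $\mathbb S^{d-1}\times[-c,c]$ with $f(x)=\int\sigma_k(\omega\cdot x-b)\,\mathrm d\mu(\omega,b)$ on $\Omega$.) Besov spaces. Fix a radial, radially nonincreasing $\varphi_0\in C_c^\infty(\mathbb R^d)$ with $0\le\varphi_0\le1$, $\varphi_0(\xi)=1$ for $|\xi|\le1$, $\operatorname{supp}\varphi_0\subset\{|\xi|\le2\}$, and set $\varphi_j(\xi):=\varphi_0(2^{-j}\xi)-\varphi_0(2^{-j+1}\xi)$ for $j\ge1$. For $f\in\mathcal S'(\mathbb R^d)$ let $\Delta_jf:=(\varphi_j\widehat f)^\vee$. For $s>0$ and $0<p,q\le\infty$, $B^s_{p,q}(\mathbb R^d)$ consists of $f\in\mathcal S'(\mathbb R^d)$ with $\|f\|_{B^s_{p,q}(\mathbb R^d)}:=\big(\sum_{j\ge0}2^{jsq}\|\Delta_jf\|_{L^p(\mathbb R^d)}^q\big)^{1/q}<\infty$ (with $\sup_{j\ge0}2^{js}\|\Delta_jf\|_{L^p(\mathbb R^d)}$ if $q=\infty$). $B^s_{p,q}(\Omega)$ is the set of $f\in\mathcal D'(\Omega)$ with $f=f_e|_\Omega$ for some $f_e\in B^s_{p,q}(\mathbb R^d)$, with quasi-norm $\|f\|_{B^s_{p,q}(\Omega)}:=\inf\{\|f_e\|_{B^s_{p,q}(\mathbb R^d)}:f_e|_\Omega=f\}$.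 *)

theory Defs
  imports "HOL-Analysis.Analysis" "HOL-Probability.Essential_Supremum"
begin

section \<open>Lebesgue spaces\<close>

text \<open>Real powers on \<open>[0,\<infinity>]\<close>, meant for exponents \<open>r > 0\<close>.\<close>

definition ennpowr :: "ennreal \<Rightarrow> real \<Rightarrow> ennreal" where
  "ennpowr x r = (if x = \<infinity> then \<infinity> else ennreal (enn2real x powr r))"

definition Lp_norm :: "'a measure \<Rightarrow> ennreal \<Rightarrow> ('a \<Rightarrow> 'b::real_normed_vector) \<Rightarrow> ennreal" where
  "Lp_norm M p f =
     (if p = \<infinity> then esssup M (\<lambda>x. ennreal (norm (f x)))
      else ennpowr (\<integral>\<^sup>+x. ennreal (norm (f x) powr enn2real p) \<partial>M) (1 / enn2real p))"

definition Lp_space :: "'a measure \<Rightarrow> ennreal \<Rightarrow> ('a \<Rightarrow> 'b::real_normed_vector) set" where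
  "Lp_space M p = {f \<in> borel_measurable M. Lp_norm M p f < \<infinity>}"

section \<open>Smooth functions and test function spaces\<close>

fun iter_deriv ::
    "'a list \<Rightarrow> ('a::real_normed_vector \<Rightarrow> 'b::real_normed_vector) \<Rightarrow> 'a \<Rightarrow> 'b" where
  "iter_deriv [] f = f"
| "iter_deriv (v # vs) f = (\<lambda>x. frechet_derivative (iter_deriv vs f) (at x) v)"

text \<open>
  A partial derivative \<open>\<partial>\<^sup>\<alpha>\<close> is \<open>iter_deriv vs\<close> with \<open>vs\<close> a list of standard basis vectors, and
  \<open>\<bar>\<alpha>\<bar> = length vs\<close>. Requiring every iterated partial derivative to be differentiable
  makes all of them continuous, so this is the class \<open>C\<^sup>\<infinity>\<close>.
\<close>

definition smooth :: "('a::euclidean_space \<Rightarrow> 'b::real_normed_vector) \<Rightarrow> bool" where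
  "smooth f \<longleftrightarrow> (\<forall>vs. set vs \<subseteq> Basis \<longrightarrow> (\<forall>x. iter_deriv vs f differentiable (at x)))"

definition tsupport :: "('a::topological_space \<Rightarrow> 'b::zero) \<Rightarrow> 'a set" where
  "tsupport f = closure {x. f x \<noteq> 0}"

definition test_functions :: "'a::euclidean_space set \<Rightarrow> ('a \<Rightarrow> complex) set" where
  "test_functions \<Omega> = {\<theta>. smooth \<theta> \<and> compact (tsupport \<theta>) \<and> tsupport \<theta> \<subseteq> \<Omega>}"

definition schwartz_functions :: "('a::euclidean_space \<Rightarrow> complex) set" where
  "schwartz_functions =
     {\<theta>. smooth \<theta> \<and>
         (\<forall>N vs. set vs \<subseteq> Basis \<longrightarrow>
            bounded (range (\<lambda>x. (1 + norm x) ^ N *\<^sub>R iter_deriv vs \<theta> x)))}"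

definition deriv_seminorm :: "nat \<Rightarrow> nat \<Rightarrow> ('a::euclidean_space \<Rightarrow> complex) \<Rightarrow> real" where
  "deriv_seminorm m N \<theta> =
     (SUP (x, vs) \<in> UNIV \<times> {vs. set vs \<subseteq> Basis \<and> length vs \<le> N}.
        (1 + norm x) ^ m * norm (iter_deriv vs \<theta> x))"

section \<open>Distributions\<close>

text \<open>
  A distribution is a functional on complex-valued test functions; its values at all other
  functions are irrelevant. Real distributions are those that are real on real-valued test
  functions; complex test functions are used only so that the Fourier transform is available.
\<close>

type_synonym 'a functional = "('a \<Rightarrow> complex) \<Rightarrow> complex"

definition linear_functional_on :: "('a \<Rightarrow> complex) set \<Rightarrow> 'a functional \<Rightarrow> bool" where
  "linear_functional_on X T \<longleftrightarrow>
     (\<forall>\<theta>\<in>X. \<forall>\<eta>\<in>X. \<forall>a b. T (\<lambda>x. a * \<theta> x + b * \<eta> x) = a * T \<theta> + b * T \<eta>)"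

definition real_functional_on :: "('a \<Rightarrow> complex) set \<Rightarrow> 'a functional \<Rightarrow> bool" where
  "real_functional_on X T \<longleftrightarrow> (\<forall>\<theta>\<in>X. range \<theta> \<subseteq> \<real> \<longrightarrow> T \<theta> \<in> \<real>)"

definition distributions :: "'a::euclidean_space set \<Rightarrow> 'a functional set" where
  "distributions \<Omega> =
     {T. linear_functional_on (test_functions \<Omega>) T \<and>
         real_functional_on (test_functions \<Omega>) T \<and>
         (\<forall>K. compact K \<and> K \<subseteq> \<Omega> \<longrightarrow>
            (\<exists>N C. \<forall>\<theta>\<in>test_functions \<Omega>. tsupport \<theta> \<subseteq> K \<longrightarrow>
               cmod (T \<theta>) \<le> C * deriv_seminorm 0 N \<theta>))}"

definition tempered_distributions :: "'a::euclidean_space functional set" where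
  "tempered_distributions =
     {T. linear_functional_on schwartz_functions T \<and>
         real_functional_on schwartz_functions T \<and>
         (\<exists>N C. \<forall>\<theta>\<in>schwartz_functions. cmod (T \<theta>) \<le> C * deriv_seminorm N N \<theta>)}"

text \<open>The distribution \<open>T\<close> on the test functions \<open>X\<close> is (identified with) the function \<open>g\<close>.\<close>

definition represented_by ::
    "('a \<Rightarrow> complex) set \<Rightarrow> 'a measure \<Rightarrow> 'a functional \<Rightarrow> ('a \<Rightarrow> complex) \<Rightarrow> bool" where
  "represented_by X M T g \<longleftrightarrow>
     g \<in> borel_measurable M \<and>
     (\<forall>\<theta>\<in>X. integrable M (\<lambda>x. g x * \<theta> x) \<and> T \<theta> = (\<integral>x. g x * \<theta> x \<partial>M))"

section \<open>Littlewood--Paley pieces and Besov spaces\<close>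

text \<open>
  Convention: the kernel is \<open>exp (- 2 \<pi> i x \<bullet> \<xi>)\<close>, so the inverse carries no constant. Other normalisations give the
  same Besov spaces with equivalent quasi-norms.
\<close>

definition fourier :: "('a::euclidean_space \<Rightarrow> complex) \<Rightarrow> 'a \<Rightarrow> complex" where
  "fourier \<theta> \<xi> = (\<integral>x. cis (- 2 * pi * (x \<bullet> \<xi>)) * \<theta> x \<partial>lebesgue)"

definition inv_fourier :: "('a::euclidean_space \<Rightarrow> complex) \<Rightarrow> 'a \<Rightarrow> complex" where
  "inv_fourier \<theta> x = (\<integral>\<xi>. cis (2 * pi * (x \<bullet> \<xi>)) * \<theta> \<xi> \<partial>lebesgue)"

definition dist_fourier :: "'a::euclidean_space functional \<Rightarrow> 'a functional" where
  "dist_fourier T = (\<lambda>\<theta>. T (fourier \<theta>))"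

definition dist_inv_fourier :: "'a::euclidean_space functional \<Rightarrow> 'a functional" where
  "dist_inv_fourier T = (\<lambda>\<theta>. T (inv_fourier \<theta>))"

definition dist_mult :: "('a \<Rightarrow> real) \<Rightarrow> 'a functional \<Rightarrow> 'a functional" where
  "dist_mult m T = (\<lambda>\<theta>. T (\<lambda>x. of_real (m x) * \<theta> x))"

definition besov_cutoff :: "('a::euclidean_space \<Rightarrow> real) \<Rightarrow> bool" where
  "besov_cutoff \<phi>0 \<longleftrightarrow>
     smooth \<phi>0 \<and>
     (\<forall>\<xi> \<eta>. norm \<xi> = norm \<eta> \<longrightarrow> \<phi>0 \<xi> = \<phi>0 \<eta>) \<and>
     (\<forall>\<xi> \<eta>. norm \<xi> \<le> norm \<eta> \<longrightarrow> \<phi>0 \<eta> \<le> \<phi>0 \<xi>) \<and>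
     (\<forall>\<xi>. 0 \<le> \<phi>0 \<xi> \<and> \<phi>0 \<xi> \<le> 1) \<and>
     (\<forall>\<xi>. norm \<xi> \<le> 1 \<longrightarrow> \<phi>0 \<xi> = 1) \<and>
     tsupport \<phi>0 \<subseteq> cball 0 2"

definition dyadic :: "('a::euclidean_space \<Rightarrow> real) \<Rightarrow> nat \<Rightarrow> 'a \<Rightarrow> real" where
  "dyadic \<phi>0 j \<xi> =
     (if j = 0 then \<phi>0 \<xi>
      else \<phi>0 ((2 powi (- int j)) *\<^sub>R \<xi>) - \<phi>0 ((2 powi (- int j + 1)) *\<^sub>R \<xi>))"

definition LP_piece ::
    "('a::euclidean_space \<Rightarrow> real) \<Rightarrow> nat \<Rightarrow> 'a functional \<Rightarrow> 'a functional" where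
  "LP_piece \<phi>0 j f = dist_inv_fourier (dist_mult (dyadic \<phi>0 j) (dist_fourier f))"

text \<open>
  The \<open>L\<^sup>p(\<real>\<^sup>d)\<close> norm of a tempered distribution: that of the function representing it, which
  is unique almost everywhere, and \<open>\<infinity>\<close> if there is none.
\<close>

definition dist_Lp_norm :: "ennreal \<Rightarrow> 'a::euclidean_space functional \<Rightarrow> ennreal" where
  "dist_Lp_norm p T =
     Inf {Lp_norm lebesgue p g | g. represented_by schwartz_functions lebesgue T g}"

definition besov_norm_Rd ::
    "('a::euclidean_space \<Rightarrow> real) \<Rightarrow> real \<Rightarrow> ennreal \<Rightarrow> ennreal \<Rightarrow> 'a functional \<Rightarrow> ennreal" where
  "besov_norm_Rd \<phi>0 s p q f =
     (if q = \<infinity> then (SUP j. ennreal (2 powr (real j * s)) * dist_Lp_norm p (LP_piece \<phi>0 j f))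
      else ennpowr
        (\<Sum>j. ennreal (2 powr (real j * s * enn2real q)) *
             ennpowr (dist_Lp_norm p (LP_piece \<phi>0 j f)) (enn2real q))
        (1 / enn2real q))"

definition besov_space_Rd ::
    "('a::euclidean_space \<Rightarrow> real) \<Rightarrow> real \<Rightarrow> ennreal \<Rightarrow> ennreal \<Rightarrow> 'a functional set" where
  "besov_space_Rd \<phi>0 s p q = {f \<in> tempered_distributions. besov_norm_Rd \<phi>0 s p q f < \<infinity>}"

definition restricts_to ::
    "'a::euclidean_space functional \<Rightarrow> 'a set \<Rightarrow> 'a functional \<Rightarrow> bool" where
  "restricts_to F \<Omega> f \<longleftrightarrow> (\<forall>\<theta>\<in>test_functions \<Omega>. F \<theta> = f \<theta>)"

definition besov_space ::
    "('a::euclidean_space \<Rightarrow> real) \<Rightarrow> real \<Rightarrow> ennreal \<Rightarrow> ennreal \<Rightarrow> 'a set \<Rightarrow> 'a functional set" where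
  "besov_space \<phi>0 s p q \<Omega> =
     {f \<in> distributions \<Omega>. \<exists>F \<in> besov_space_Rd \<phi>0 s p q. restricts_to F \<Omega> f}"

definition besov_norm ::
    "('a::euclidean_space \<Rightarrow> real) \<Rightarrow> real \<Rightarrow> ennreal \<Rightarrow> ennreal \<Rightarrow> 'a set \<Rightarrow> 'a functional \<Rightarrow> ennreal" where
  "besov_norm \<phi>0 s p q \<Omega> f =
     Inf {besov_norm_Rd \<phi>0 s p q F | F. F \<in> besov_space_Rd \<phi>0 s p q \<and> restricts_to F \<Omega> f}"

section \<open>The variation space of the dictionary\<close>

definition ridge_power :: "nat \<Rightarrow> real \<Rightarrow> real" where
  "ridge_power k t = (max t 0) ^ k"

definition offset_bound :: "'a::euclidean_space set \<Rightarrow> real \<Rightarrow> bool" where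
  "offset_bound \<Omega> c \<longleftrightarrow>
     0 < c \<and>
     - c < (INF (x, \<omega>) \<in> \<Omega> \<times> sphere 0 1. \<omega> \<bullet> x) \<and>
     (INF (x, \<omega>) \<in> \<Omega> \<times> sphere 0 1. \<omega> \<bullet> x) < (SUP (x, \<omega>) \<in> \<Omega> \<times> sphere 0 1. \<omega> \<bullet> x) \<and>
     (SUP (x, \<omega>) \<in> \<Omega> \<times> sphere 0 1. \<omega> \<bullet> x) < c"

definition dictionary :: "nat \<Rightarrow> real \<Rightarrow> ('a::euclidean_space \<Rightarrow> real) set" where
  "dictionary k c = {(\<lambda>x. ridge_power k (\<omega> \<bullet> x - b)) | \<omega> b. \<omega> \<in> sphere 0 1 \<and> b \<in> {-c..c}}"

definition abs_convex_hull :: "('a \<Rightarrow> real) set \<Rightarrow> ('a \<Rightarrow> real) set" where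
  "abs_convex_hull D =
     {(\<lambda>x. \<Sum>i<N. a i * v i x) | (N::nat) a v.
        1 \<le> N \<and> (\<forall>i<N. v i \<in> D) \<and> (\<Sum>i<N. \<bar>a i\<bar>) \<le> 1}"

text \<open>
  Functions on \<open>\<Omega>\<close> are functions on the whole space regarded through \<open>lebesgue_on \<Omega>\<close>;
  their values outside \<open>\<Omega>\<close> play no role.
\<close>

definition dict_closure :: "nat \<Rightarrow> real \<Rightarrow> 'a::euclidean_space set \<Rightarrow> ('a \<Rightarrow> real) set" where
  "dict_closure k c \<Omega> =
     {f \<in> Lp_space (lebesgue_on \<Omega>) 2.
        \<forall>\<epsilon>>0. \<exists>g \<in> abs_convex_hull (dictionary k c).
          Lp_norm (lebesgue_on \<Omega>) 2 (\<lambda>x. f x - g x) < ennreal \<epsilon>}"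

definition L1_norm_fun :: "nat \<Rightarrow> real \<Rightarrow> 'a::euclidean_space set \<Rightarrow> ('a \<Rightarrow> real) \<Rightarrow> ennreal" where
  "L1_norm_fun k c \<Omega> f =
     Inf {ennreal t | t. t > 0 \<and> (\<exists>g \<in> dict_closure k c \<Omega>. f = (\<lambda>x. t * g x))}"

definition L1_space_fun :: "nat \<Rightarrow> real \<Rightarrow> 'a::euclidean_space set \<Rightarrow> ('a \<Rightarrow> real) set" where
  "L1_space_fun k c \<Omega> = {f \<in> Lp_space (lebesgue_on \<Omega>) 2. L1_norm_fun k c \<Omega> f < \<infinity>}"

text \<open>
  The same space with its elements identified as distributions on \<open>\<Omega>\<close>. The representing
  function is unique almost everywhere and the norm does not depend on its choice, so the
  infimum in \<open>L1_norm\<close> is over a singleton.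
\<close>

definition L1_space :: "nat \<Rightarrow> real \<Rightarrow> 'a::euclidean_space set \<Rightarrow> 'a functional set" where
  "L1_space k c \<Omega> =
     {T \<in> distributions \<Omega>. \<exists>u \<in> L1_space_fun k c \<Omega>.
        represented_by (test_functions \<Omega>) (lebesgue_on \<Omega>) T (\<lambda>x. of_real (u x))}"

definition L1_norm :: "nat \<Rightarrow> real \<Rightarrow> 'a::euclidean_space set \<Rightarrow> 'a functional \<Rightarrow> ennreal" where
  "L1_norm k c \<Omega> T =
     Inf {L1_norm_fun k c \<Omega> u | u. u \<in> L1_space_fun k c \<Omega> \<and>
        represented_by (test_functions \<Omega>) (lebesgue_on \<Omega>) T (\<lambda>x. of_real (u x))}"

section \<open>Lipschitz domains and embeddings\<close>

text \<open>
  Near each boundary point, \<open>\<Omega>\<close> is the strict epigraph, in some unit direction \<open>e\<close>, of a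
  Lipschitz function \<open>\<gamma>\<close> on the hyperplane orthogonal to \<open>e\<close>.
\<close>

definition bounded_lipschitz_domain :: "'a::euclidean_space set \<Rightarrow> bool" where
  "bounded_lipschitz_domain \<Omega> \<longleftrightarrow>
     open \<Omega> \<and> connected \<Omega> \<and> \<Omega> \<noteq> {} \<and> bounded \<Omega> \<and>
     (\<forall>x \<in> frontier \<Omega>. \<exists>r e \<gamma> L. 0 < r \<and> norm e = 1 \<and> L-lipschitz_on {v. v \<bullet> e = 0} \<gamma> \<and>
        \<Omega> \<inter> ball x r = {y \<in> ball x r. \<gamma> (y - (y \<bullet> e) *\<^sub>R e) < y \<bullet> e})"

definition embeds :: "'f set \<Rightarrow> ('f \<Rightarrow> ennreal) \<Rightarrow> 'f set \<Rightarrow> ('f \<Rightarrow> ennreal) \<Rightarrow> bool" where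
  "embeds Y normY Z normZ \<longleftrightarrow>
     Y \<subseteq> Z \<and> (\<exists>C::real. \<forall>f\<in>Y. normZ f \<le> ennreal C * normY f)"

end

theory Submission
  imports Defs "HOL-Probability.Sinc_Integral" "HOL-Probability.Characteristic_Functions"
begin

text \<open>
  Both norms are compared on waves \<open>f\<^sub>j x = 2^(j d) h (2^j (x - x\<^sub>0))\<close> around a point \<open>x\<^sub>0\<close>
  of \<open>\<Omega>\<close>, where the transform of \<open>h\<close> is a single Littlewood--Paley bump. Only three
  Littlewood--Paley pieces of \<open>f\<^sub>j\<close> survive, each is again a rapidly decaying wave of the same
  scale, and the Besov quasi-norm is at most a multiple of \<open>2^(j (s + d - d/p))\<close> for all \<open>p, q\<close>.
  For the variation norm one tests with \<open>\<eta> (2^j (x - x\<^sub>0))\<close>, where \<open>\<eta>\<close> is a \<open>k\<close>-th difference of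
  a bump. Moving the difference onto a ridge function gives a factor \<open>2^(- j k)\<close>, because the \<open>k\<close>-th
  difference of \<open>\<sigma>\<^sub>k\<close> with step \<open>t\<close> is at most \<open>k! \<bar>t\<bar>^k\<close>, while the pairing with \<open>f\<^sub>j\<close> is a nonzero
  constant; so the variation norm is at least a multiple of \<open>2^(j (d + k))\<close>. For \<open>s < k + d/p\<close> this grows faster.
\<close>

section \<open>Finite differences\<close>

text \<open>Regularity is measured by finite differences instead of derivatives. The function
  \<open>ridge_power k\<close> has only k - 1 continuous derivatives, yet its k-th difference is
  still of order |t|^k, which is exactly the gain that the lower bound needs. The same device yields
  decay of Fourier transforms without differentiating under the integral sign. The pairing constant
  must not vanish. It is the integral of a k-th difference of the profile against a localised bump.
  A profile that tends to 0 at infinity and has vanishing k-th difference would be identically 0,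
  while its value at the origin is the integral of a nonnegative, nonzero function. Exponents below
  1 need no separate treatment: only pointwise bounds and a sum of three terms are used, never a
  triangle inequality in L^p. The price is decay of an order that grows as p shrinks. Fourier
  inversion enters because the waves arise as inverse transforms, whereas a Littlewood-Paley piece
  begins with the forward transform.\<close>

definition fdiff :: "'a::ab_group_add \<Rightarrow> ('a \<Rightarrow> 'b::ab_group_add) \<Rightarrow> 'a \<Rightarrow> 'b" where
  "fdiff a f = (\<lambda>x. f x - f (x - a))"

lemma fdiff_pow_Suc: "(fdiff a ^^ Suc n) f x = (fdiff a ^^ n) f x - (fdiff a ^^ n) f (x - a)"
  by (simp add: fdiff_def)

lemma fdiff_pow_Suc_eq: "(fdiff a ^^ Suc n) f = (\<lambda>x. (fdiff a ^^ n) f x - (fdiff a ^^ n) f (x - a))"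
  by (simp add: fdiff_pow_Suc fun_eq_iff del: funpow.simps)

lemma fdiff_pow_add:
  "(fdiff a ^^ n) (\<lambda>x. f x + g x) = (\<lambda>x. (fdiff a ^^ n) f x + (fdiff a ^^ n) g x)"
  by (induction n) (auto simp: fdiff_def fun_eq_iff)

lemma fdiff_pow_diff:
  "(fdiff a ^^ n) (\<lambda>x. f x - g x) = (\<lambda>x. (fdiff a ^^ n) f x - (fdiff a ^^ n) g x)"
  by (induction n) (auto simp: fdiff_def fun_eq_iff)

lemma fdiff_pow_cmult:
  fixes c :: "'b::ring"
  shows "(fdiff a ^^ n) (\<lambda>x. c * f x) = (\<lambda>x. c * (fdiff a ^^ n) f x)"
  by (induction n) (auto simp: fdiff_def fun_eq_iff algebra_simps)

lemma fdiff_pow_shift: "(fdiff a ^^ n) (\<lambda>x. f (x - c)) = (\<lambda>x. (fdiff a ^^ n) f (x - c))"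
  by (induction n) (auto simp: fdiff_def fun_eq_iff algebra_simps)

text \<open>The hypothesis holds for affine T, with a' determined by the linear part. Domain and
  codomain of T may differ, so this serves both for dilations of the space and for the map onto the
  line inside a ridge function.\<close>

lemma fdiff_pow_compose:
  assumes "\<And>x. T (x - a) = T x - a'"
  shows "(fdiff a ^^ n) (\<lambda>x. f (T x)) = (\<lambda>x. (fdiff a' ^^ n) f (T x))"
  by (induction n) (auto simp: fdiff_def fun_eq_iff assms)

lemma fdiff_pow_continuous:
  fixes f :: "'a::real_normed_vector \<Rightarrow> 'b::real_normed_vector"
  assumes "continuous_on UNIV f"
  shows "continuous_on UNIV ((fdiff a ^^ n) f)"
proof (induction n)
  case (Suc n)
  have "continuous_on UNIV (\<lambda>x. (fdiff a ^^ n) f (x - a))"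
    by (rule continuous_on_compose2[OF Suc]) (auto intro!: continuous_intros)
  with Suc show ?case unfolding fdiff_pow_Suc_eq by (auto intro!: continuous_intros)
qed (use assms in simp)

lemma fdiff_pow_of_real:
  "(fdiff a ^^ n) (\<lambda>x. of_real (f x)) = (\<lambda>x. of_real ((fdiff a ^^ n) f x))"
  by (induction n) (auto simp: fdiff_def fun_eq_iff)

text \<open>The induction rests on \<open>fdiff a (f g) = fdiff a f \<cdot> g + f(\<cdot> - a) \<cdot> fdiff a g\<close>.\<close>

lemma fdiff_pow_mult_bound:
  fixes f g :: "'a::ab_group_add \<Rightarrow> real"
  assumes "0 \<le> t"
    and "\<And>i x. i \<le> n \<Longrightarrow> \<bar>(fdiff a ^^ i) f x\<bar> \<le> A * t ^ i"
    and "\<And>i x. i \<le> n \<Longrightarrow> \<bar>(fdiff a ^^ i) g x\<bar> \<le> B * t ^ i"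
  shows "\<bar>(fdiff a ^^ n) (\<lambda>x. f x * g x) x\<bar> \<le> 2 ^ n * (A * B) * t ^ n"
  using assms(2,3)
proof (induction n arbitrary: f g A B x)
  case 0
  have "\<bar>f x\<bar> \<le> A" "\<bar>g x\<bar> \<le> B" using 0(1)[of 0 x] 0(2)[of 0 x] by auto
  then show ?case by (auto simp: abs_mult intro!: mult_mono)
next
  case (Suc n)
  have eq: "fdiff a (\<lambda>x. f x * g x) = (\<lambda>x. fdiff a f x * g x + f (x - a) * fdiff a g x)"
    by (auto simp: fdiff_def fun_eq_iff algebra_simps)
  have "(fdiff a ^^ i) (fdiff a f) x = (fdiff a ^^ Suc i) f x"
    "(fdiff a ^^ i) (fdiff a g) x = (fdiff a ^^ Suc i) g x" for i x
    by (simp_all add: funpow_swap1)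
  then have d: "\<bar>(fdiff a ^^ i) (fdiff a f) x\<bar> \<le> (A * t) * t ^ i"
      "\<bar>(fdiff a ^^ i) (fdiff a g) x\<bar> \<le> (B * t) * t ^ i" if "i \<le> n" for i x
    using Suc.prems(1)[of "Suc i" x] Suc.prems(2)[of "Suc i" x] that by (auto simp: mult_ac)
  have s: "\<bar>(fdiff a ^^ i) (\<lambda>x. f (x - a)) x\<bar> \<le> A * t ^ i" if "i \<le> n" for i x
    using Suc.prems(1)[of i "x - a"] that by (simp add: fdiff_pow_shift)
  have "\<bar>(fdiff a ^^ n) (\<lambda>x. fdiff a f x * g x) x\<bar> \<le> 2 ^ n * ((A * t) * B) * t ^ n"
    by (rule Suc.IH) (use d Suc.prems(2) in auto)
  moreover have "\<bar>(fdiff a ^^ n) (\<lambda>x. f (x - a) * fdiff a g x) x\<bar> \<le> 2 ^ n * (A * (B * t)) * t ^ n"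
    by (rule Suc.IH) (use d s in auto)
  ultimately show ?case
    unfolding funpow_Suc_right o_def eq fdiff_pow_add by (auto simp: algebra_simps)
qed

lemma fdiff_pow_has_derivative:
  fixes f :: "'a::real_normed_vector \<Rightarrow> 'b::real_normed_vector"
  assumes "\<And>x. (f has_derivative f' x) (at x)"
  shows "((fdiff a ^^ n) f has_derivative (\<lambda>v. (fdiff a ^^ n) (\<lambda>x. f' x v) x)) (at x)"
proof (induction n arbitrary: x)
  case (Suc n)
  have "((\<lambda>x. (fdiff a ^^ n) f (x - a)) has_derivative
      (\<lambda>v. (fdiff a ^^ n) (\<lambda>x. f' x v) (x - a))) (at x)"
    by (rule has_derivative_compose[where f = "\<lambda>x. x - a" and f' = "\<lambda>v. v", OF _ Suc])
      (auto intro!: derivative_eq_intros)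
  from has_derivative_diff[OF Suc this] show ?case
    unfolding fdiff_pow_Suc_eq .
qed (simp add: assms)

text \<open>Mean value inequality on the line through x in direction b; for this reason only the
  directional derivative along b has to be bounded.\<close>

lemma abs_fdiff_le:
  fixes f :: "'a::real_normed_vector \<Rightarrow> real"
  assumes f: "\<And>x. (f has_derivative f' x) (at x)" and K: "\<And>x. \<bar>f' x b\<bar> \<le> K"
  shows "\<bar>f x - f (x - t *\<^sub>R b)\<bar> \<le> \<bar>t\<bar> * K"
proof -
  define F where "F s = f (x - s *\<^sub>R b)" for s
  have lin: "linear (f' y)" for y using f has_derivative_linear by blast
  have F: "(F has_derivative (\<lambda>h. h * (- f' (x - s *\<^sub>R b) b))) (at s within UNIV)" for s
    unfolding F_def
    by (rule has_derivative_eq_rhs, rule has_derivative_compose[OF _ f])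
      (auto intro!: derivative_eq_intros simp: linear_neg[OF lin] linear_cmul[OF lin])
  have "norm (F t - F 0) \<le> K * norm (t - 0)"
  proof (rule differentiable_bound[OF convex_UNIV F])
    fix s :: real
    have "norm (h * - f' (x - s *\<^sub>R b) b) \<le> norm h * K" for h
      using K[of "x - s *\<^sub>R b"] by (auto simp: abs_mult intro!: mult_left_mono)
    then show "onorm (\<lambda>h. h * - f' (x - s *\<^sub>R b) b) \<le> K"
      by (intro onorm_le) (simp add: mult.commute)
  qed auto
  then show ?thesis by (simp add: F_def abs_minus_commute mult.commute)
qed

text \<open>The induction step behind all difference bounds: one difference is traded for a factor
  |t| and one derivative along b, since differencing commutes with differentiation.\<close>

lemma fdiff_pow_Suc_bound:
  fixes f :: "'a::real_normed_vector \<Rightarrow> real"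
  assumes "\<And>x. (f has_derivative f' x) (at x)"
    and "\<And>x. \<bar>(fdiff (t *\<^sub>R b) ^^ n) (\<lambda>x. f' x b) x\<bar> \<le> B"
  shows "\<bar>(fdiff (t *\<^sub>R b) ^^ Suc n) f x\<bar> \<le> \<bar>t\<bar> * B"
  unfolding fdiff_pow_Suc
  by (rule abs_fdiff_le[OF fdiff_pow_has_derivative[OF assms(1)] assms(2)])

text \<open>The derivative of \<open>ridge_power (Suc k)\<close> is (k + 1) times
  \<open>ridge_power k\<close> as long as k >= 1, and the induction stops at the Lipschitz function
  max(t, 0), before the jump of its derivative matters. The factors k + 1 accumulate to the
  factorial.\<close>

lemma ridge_power_fdiff_bound:
  assumes "1 \<le> k"
  shows "\<bar>(fdiff t ^^ k) (ridge_power k) z\<bar> \<le> fact k * \<bar>t\<bar> ^ k"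
  using assms
proof (induction k arbitrary: z rule: dec_induct)
  case base
  show ?case by (auto simp: fdiff_def ridge_power_def)
next
  case (step k)
  have der: "(ridge_power (Suc k) has_derivative (\<lambda>v. v * (real (Suc k) * ridge_power k x))) (at x)" for x
  proof -
    consider "x > 0" | "x < 0" | "x = 0" by linarith
    then have "(ridge_power (Suc k) has_real_derivative real (Suc k) * ridge_power k x) (at x)"
    proof cases
      case 1
      have "((\<lambda>x. x ^ Suc k) has_real_derivative real (Suc k) * x ^ k) (at x)"
        using DERIV_pow[of "Suc k" x] by simp
      then have "(ridge_power (Suc k) has_real_derivative real (Suc k) * x ^ k) (at x)"
        by (rule has_field_derivative_transform_within_open[where S = "{0<..}"])
          (use 1 in \<open>auto simp: ridge_power_def\<close>)
      then show ?thesis using 1 by (simp add: ridge_power_def)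
    next
      case 2
      have "((\<lambda>x. 0) has_real_derivative 0) (at x)" by simp
      then have "(ridge_power (Suc k) has_real_derivative 0) (at x)"
        by (rule has_field_derivative_transform_within_open[where S = "{..<0}"])
          (use 2 in \<open>auto simp: ridge_power_def\<close>)
      then show ?thesis using 2 \<open>1 \<le> k\<close> by (simp add: ridge_power_def power_0_left)
    next
      \<comment> \<open>At the kink the difference quotient is at most |h|^k, which tends to 0
        because k >= 1.\<close>
      case 3
      have "((\<lambda>h. ridge_power (Suc k) h / h) \<longlongrightarrow> 0) (at 0)"
      proof (rule Lim_null_comparison)
        show "\<forall>\<^sub>F h in at 0. norm (ridge_power (Suc k) h / h) \<le> \<bar>h\<bar> ^ k"
          by (rule always_eventually) (auto simp: ridge_power_def max_def abs_mult)
        have "((\<lambda>h. \<bar>h\<bar> ^ k) \<longlongrightarrow> \<bar>0::real\<bar> ^ k) (at 0)" by (intro tendsto_intros)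
        then show "((\<lambda>h::real. \<bar>h\<bar> ^ k) \<longlongrightarrow> 0) (at 0)" using step by (simp add: power_0_left)
      qed
      then show ?thesis using 3 step
        by (simp add: has_field_derivative_iff ridge_power_def power_0_left)
    qed
    then show ?thesis
      by (simp add: has_field_derivative_def mult_commute_abs)
  qed
  have "\<bar>(fdiff (t *\<^sub>R 1) ^^ Suc k) (ridge_power (Suc k)) z\<bar> \<le> \<bar>t\<bar> * (real (Suc k) * (fact k * \<bar>t\<bar> ^ k))"
  proof (rule fdiff_pow_Suc_bound[OF der])
    fix x
    have "(fdiff t ^^ k) (\<lambda>x. real (Suc k) * ridge_power k x) x
        = real (Suc k) * (fdiff t ^^ k) (ridge_power k) x"
      by (simp only: fdiff_pow_cmult)
    then show "\<bar>(fdiff (t *\<^sub>R 1) ^^ k) (\<lambda>x. 1 * (real (Suc k) * ridge_power k x)) x\<bar>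
        \<le> real (Suc k) * (fact k * \<bar>t\<bar> ^ k)"
      using step.IH[of x] by (simp add: abs_mult mult_left_mono del: of_nat_Suc)
  qed
  then show ?case by (simp add: mult_ac)
qed

section \<open>Smooth functions\<close>

lemma iter_deriv_append: "iter_deriv (vs @ ws) f = iter_deriv vs (iter_deriv ws f)"
  by (induction vs) auto

lemma smooth_frechet_derivative:
  assumes "smooth f" "b \<in> Basis"
  shows "smooth (\<lambda>x. frechet_derivative f (at x) b)"
proof -
  have "iter_deriv vs (\<lambda>x. frechet_derivative f (at x) b) = iter_deriv (vs @ [b]) f" for vs
    by (simp add: iter_deriv_append)
  then show ?thesis using assms unfolding smooth_def by auto
qed

lemma smooth_imp_differentiable: "smooth f \<Longrightarrow> f differentiable (at x)"
  unfolding smooth_def by (metis empty_subsetI iter_deriv.simps(1) list.set(1))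

lemma smooth_imp_continuous: "smooth f \<Longrightarrow> continuous_on UNIV f"
  by (meson continuous_at_imp_continuous_on differentiable_imp_continuous_within smooth_imp_differentiable)

lemma frechet_derivative_eqI: "(f has_derivative f') (at x) \<Longrightarrow> frechet_derivative f (at x) = f'"
  by (metis frechet_derivative_at)

text \<open>\<open>frechet_derivative\<close> chooses among the derivatives at a point, so the two
  values agree as soon as both functions have the same derivatives there; the argument does not ask
  whether any exists.\<close>

lemma iter_deriv_cong_open:
  assumes "open S" "\<And>x. x \<in> S \<Longrightarrow> f x = g x" "x \<in> S"
  shows "iter_deriv vs f x = iter_deriv vs g x"
  using assms(3)
proof (induction vs arbitrary: x)
  case (Cons v vs)
  have "(iter_deriv vs f has_derivative D) (at x) \<longleftrightarrow> (iter_deriv vs g has_derivative D) (at x)" for D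
    using Cons.prems Cons.IH
    by (auto intro: has_derivative_transform_within_open[OF _ assms(1) Cons.prems])
  then have "frechet_derivative (iter_deriv vs f) (at x) = frechet_derivative (iter_deriv vs g) (at x)"
    by (simp add: frechet_derivative_def)
  then show ?case by simp
qed (use assms in auto)

lemma iter_deriv_zero: "iter_deriv vs (\<lambda>x. 0) = (\<lambda>x. 0)"
proof (induction vs)
  case (Cons v vs)
  then show ?case by (simp add: frechet_derivative_const)
qed auto

lemma iter_deriv_bounded:
  fixes f :: "'a::euclidean_space \<Rightarrow> 'b::real_normed_vector"
  assumes "smooth f" "compact (tsupport f)" "set vs \<subseteq> Basis"
  obtains B where "0 < B" "\<And>x. norm (iter_deriv vs f x) \<le> B"
proof -
  have out: "iter_deriv vs f x = 0" if "x \<notin> tsupport f" for x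
  proof -
    have "iter_deriv vs f x = iter_deriv vs (\<lambda>x. 0) x"
      using that closure_subset[of "{x. f x \<noteq> 0}"]
      by (intro iter_deriv_cong_open[where S = "- tsupport f"])
        (auto simp: tsupport_def)
    then show ?thesis by (simp add: iter_deriv_zero)
  qed
  have "continuous_on (tsupport f) (iter_deriv vs f)"
    using assms(1,3) unfolding smooth_def
    by (auto intro!: continuous_at_imp_continuous_on differentiable_imp_continuous_within)
  then have "bounded (iter_deriv vs f ` tsupport f)"
    by (intro compact_imp_bounded compact_continuous_image assms)
  then obtain B where "B > 0" "\<And>x. x \<in> tsupport f \<Longrightarrow> norm (iter_deriv vs f x) \<le> B"
    by (auto simp: bounded_pos)
  then show thesis using out that[of B] by (metis norm_zero less_imp_le)
qed

text \<open>Iterating the one-step bound replaces i differences along b by the pure derivative of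
  order i along b, which is bounded by compact support. Summing these bounds over the finitely many
  i and b gives one constant.\<close>

lemma smooth_fdiff_bound:
  fixes f :: "'a::euclidean_space \<Rightarrow> real"
  assumes "smooth f" "compact (tsupport f)"
  obtains C where "0 < C"
    "\<And>i b t x. i \<le> n \<Longrightarrow> b \<in> Basis \<Longrightarrow> \<bar>(fdiff (t *\<^sub>R b) ^^ i) f x\<bar> \<le> C * \<bar>t\<bar> ^ i"
proof -
  have main: "\<bar>(fdiff (t *\<^sub>R b) ^^ i) f x\<bar> \<le> \<bar>t\<bar> ^ i * B"
    if "smooth f" "b \<in> Basis" "\<And>x. \<bar>iter_deriv (replicate i b) f x\<bar> \<le> B" for i b t x B and f :: "'a \<Rightarrow> real"
    using that(1,3)
  proof (induction i arbitrary: f x)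
    case (Suc i)
    \<comment> \<open>The derivative of f itself sits at the end of the list, while
      \<open>replicate\<close> grows at the front; since all entries are equal, the two lists
      coincide.\<close>
    have eq: "iter_deriv (replicate i b) (\<lambda>x. frechet_derivative f (at x) b)
        = iter_deriv (replicate (Suc i) b) f"
      unfolding replicate_Suc replicate_append_same[symmetric] by (simp add: iter_deriv_append)
    have "\<bar>(fdiff (t *\<^sub>R b) ^^ i) (\<lambda>x. frechet_derivative f (at x) b) x\<bar> \<le> \<bar>t\<bar> ^ i * B" for x
      using Suc.prems that(2) by (intro Suc.IH smooth_frechet_derivative) (auto simp: eq)
    moreover have "(f has_derivative frechet_derivative f (at x)) (at x)" for x
      using Suc.prems(1) smooth_imp_differentiable frechet_derivative_works by blast
    ultimately have "\<bar>(fdiff (t *\<^sub>R b) ^^ Suc i) f x\<bar> \<le> \<bar>t\<bar> * (\<bar>t\<bar> ^ i * B)"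
      by (intro fdiff_pow_Suc_bound)
    then show ?case by (simp add: mult.assoc)
  qed simp
  define P where "P B i b \<longleftrightarrow> 0 < B \<and> (\<forall>x. \<bar>iter_deriv (replicate i b) f x\<bar> \<le> B)" for B :: real and i and b :: 'a
  have "\<exists>B. P B i b" if "b \<in> Basis" for i b
    using iter_deriv_bounded[OF assms, of "replicate i b"] that unfolding P_def
    by (metis real_norm_def set_replicate_conv_if subsetI empty_iff insertE empty_subsetI insert_subset)
  then have "\<forall>i b. \<exists>B. b \<in> Basis \<longrightarrow> P B i b" by blast
  then obtain B where B: "\<And>i b. b \<in> Basis \<Longrightarrow> P (B i b) i b"
    using choice_iff[of "\<lambda>x B. snd x \<in> Basis \<longrightarrow> P B (fst x) (snd x)"] by force
  define C where "C = (\<Sum>(i, b) \<in> {..n} \<times> Basis. B i b)"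
  have le: "B i b \<le> C" if "i \<le> n" "b \<in> Basis" for i b
    unfolding C_def using that B
    by (intro member_le_sum[of "(i, b)" _ "\<lambda>(i, b). B i b", simplified]) (auto simp: P_def less_imp_le)
  obtain b :: 'a where "b \<in> Basis" using nonempty_Basis by blast
  then have "0 < C" using le[of 0 b] B[of b 0] by (auto simp: P_def)
  moreover have "\<bar>(fdiff (t *\<^sub>R b) ^^ i) f x\<bar> \<le> C * \<bar>t\<bar> ^ i" if "i \<le> n" "b \<in> Basis" for i b t x
  proof -
    have "\<bar>(fdiff (t *\<^sub>R b) ^^ i) f x\<bar> \<le> \<bar>t\<bar> ^ i * B i b"
      using B that by (intro main assms) (auto simp: P_def)
    also have "\<dots> \<le> \<bar>t\<bar> ^ i * C" using le that by (intro mult_left_mono) auto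
    finally show ?thesis by (simp add: mult.commute)
  qed
  ultimately show thesis by (rule that)
qed

section \<open>Closure of smooth functions under sums, linear images, affine substitutions and
  differences\<close>

lemma smooth_add:
  assumes "smooth f" "smooth g"
  shows "smooth (\<lambda>x. f x + g x)"
proof -
  have "iter_deriv vs (\<lambda>x. f x + g x) = (\<lambda>x. iter_deriv vs f x + iter_deriv vs g x)"
    if "set vs \<subseteq> Basis" for vs
    using that
  proof (induction vs)
    case (Cons v vs)
    have "frechet_derivative (\<lambda>x. iter_deriv vs f x + iter_deriv vs g x) (at x) =
        (\<lambda>v. frechet_derivative (iter_deriv vs f) (at x) v + frechet_derivative (iter_deriv vs g) (at x) v)" for x
      using Cons.prems assms
      by (intro frechet_derivative_eqI has_derivative_add frechet_derivative_works[THEN iffD1])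
        (auto simp: smooth_def)
    then show ?case using Cons by simp
  qed auto
  then show ?thesis using assms unfolding smooth_def by auto
qed

lemma smooth_linear_image:
  assumes "smooth f" "bounded_linear L"
  shows "smooth (\<lambda>x. L (f x))"
proof -
  interpret bounded_linear L by fact
  have d: "((\<lambda>x. L (iter_deriv vs f x)) has_derivative (\<lambda>v. L (frechet_derivative (iter_deriv vs f) (at x) v))) (at x)"
    if "set vs \<subseteq> Basis" for vs x
    using that assms unfolding smooth_def by (intro has_derivative frechet_derivative_works[THEN iffD1]) auto
  have "iter_deriv vs (\<lambda>x. L (f x)) = (\<lambda>x. L (iter_deriv vs f x))"
    if "set vs \<subseteq> Basis" for vs
    using that
  proof (induction vs)
    case (Cons v vs)
    then show ?case by (simp add: frechet_derivative_eqI[OF d])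
  qed auto
  then show ?thesis using d unfolding smooth_def differentiable_def by metis
qed

lemma smooth_affine:
  fixes f :: "'a::euclidean_space \<Rightarrow> 'b::real_normed_vector"
  assumes "smooth f"
  shows "smooth (\<lambda>x. f (r *\<^sub>R x + a))"
proof -
  have d: "((\<lambda>x. c *\<^sub>R iter_deriv vs f (r *\<^sub>R x + a)) has_derivative
     (\<lambda>v. c *\<^sub>R frechet_derivative (iter_deriv vs f) (at (r *\<^sub>R x + a)) (r *\<^sub>R v))) (at x)"
    if "set vs \<subseteq> Basis" for vs x c
  proof -
    have 1: "(iter_deriv vs f has_derivative frechet_derivative (iter_deriv vs f) (at (r *\<^sub>R x + a))) (at (r *\<^sub>R x + a))"
      using that assms unfolding smooth_def by (intro frechet_derivative_works[THEN iffD1]) auto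
    have 2: "((\<lambda>x. r *\<^sub>R x + a) has_derivative (\<lambda>v. r *\<^sub>R v)) (at x)"
      by (auto intro!: derivative_eq_intros)
    show ?thesis
      by (rule has_derivative_scaleR_right[OF has_derivative_compose[OF 2 1]])
  qed
  have "iter_deriv vs (\<lambda>x. f (r *\<^sub>R x + a)) = (\<lambda>x. r ^ length vs *\<^sub>R iter_deriv vs f (r *\<^sub>R x + a))"
    if "set vs \<subseteq> Basis" for vs
    using that
  proof (induction vs)
    case (Cons v vs)
    have lin: "linear (frechet_derivative (iter_deriv vs f) (at y))" for y
      using Cons.prems assms unfolding smooth_def by (intro linear_frechet_derivative) auto
    show ?case using Cons by (simp add: linear_cmul[OF lin] mult.commute frechet_derivative_eqI[OF d])
  qed auto
  then show ?thesis using d unfolding smooth_def differentiable_def by metis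
qed

lemma smooth_fdiff_pow:
  fixes f :: "'a::euclidean_space \<Rightarrow> 'b::real_normed_vector"
  assumes "smooth f"
  shows "smooth ((fdiff a ^^ n) f)"
proof (induction n)
  case (Suc n)
  have "smooth (\<lambda>x. (fdiff a ^^ n) f x + - (fdiff a ^^ n) f (1 *\<^sub>R x + - a))"
    by (rule smooth_add[OF Suc smooth_linear_image[OF smooth_affine[OF Suc]]])
      (rule bounded_linear_minus[OF bounded_linear_ident])
  then show ?case unfolding fdiff_pow_Suc_eq by simp
qed (use assms in simp)

section \<open>Integration over Euclidean space\<close>

lemma nn_integral_lborel_affine:
  fixes t :: "'a::euclidean_space"
  assumes [measurable]: "f \<in> borel_measurable borel" and "c \<noteq> 0"
  shows "(\<integral>\<^sup>+x. f x \<partial>lborel) = ennreal (\<bar>c\<bar> ^ DIM('a)) * (\<integral>\<^sup>+x. f (t + c *\<^sub>R x) \<partial>lborel)"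
  by (subst lborel_affine[OF assms(2), of t])
    (simp add: nn_integral_density nn_integral_distr nn_integral_cmult)

lemma lborel_integrable_affine:
  fixes f :: "'a::euclidean_space \<Rightarrow> 'b::{banach, second_countable_topology}"
  assumes "integrable lborel f" and "c \<noteq> 0"
  shows "integrable lborel (\<lambda>x. f (t + c *\<^sub>R x))"
proof -
  have [measurable]: "f \<in> borel_measurable borel" using assms(1) by auto
  have "integrable (density (distr lborel borel (\<lambda>x. t + c *\<^sub>R x)) (\<lambda>_. ennreal (\<bar>c\<bar> ^ DIM('a)))) f"
    using assms lborel_affine[of c t] by simp
  then show ?thesis
    using assms(2) integrable_scaleR_right[of "1 / \<bar>c\<bar> ^ DIM('a)" lborel "\<lambda>x. \<bar>c\<bar> ^ DIM('a) *\<^sub>R f (t + c *\<^sub>R x)"]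
    by (subst (asm) integrable_density) (auto simp: integrable_distr_eq)
qed

lemma lborel_integral_affine:
  fixes f :: "'a::euclidean_space \<Rightarrow> 'b::{banach, second_countable_topology}"
  assumes [measurable]: "f \<in> borel_measurable borel" and "c \<noteq> 0"
  shows "(\<integral>x. f x \<partial>lborel) = \<bar>c\<bar> ^ DIM('a) *\<^sub>R (\<integral>x. f (t + c *\<^sub>R x) \<partial>lborel)"
  by (subst lborel_affine[OF assms(2), of t])
    (simp add: integral_density integral_distr)

text \<open>Tensor products reduce to one dimension because \<open>lborel\<close> is the image of a
  product measure. This is used for the polynomial weight and for the Gaussian.\<close>

lemma lborel_integral_prod:
  fixes f :: "'a::euclidean_space \<Rightarrow> real \<Rightarrow> 'b::{real_normed_field, banach, second_countable_topology}"
  assumes f: "\<And>b. b \<in> Basis \<Longrightarrow> integrable lborel (f b)"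
  shows "integrable lborel (\<lambda>x. \<Prod>b\<in>Basis. f b (x \<bullet> b))"
    and "(\<integral>x. (\<Prod>b\<in>Basis. f b (x \<bullet> b)) \<partial>lborel) = (\<Prod>b\<in>Basis. (\<integral>x. f b x \<partial>lborel))"
proof -
  interpret P: product_sigma_finite "\<lambda>_::'a. lborel :: real measure" ..
  have m [measurable]: "f b \<in> borel_measurable borel" if "b \<in> Basis" for b
    using f[OF that] by auto
  have m2 [measurable]: "(\<lambda>g. \<Sum>b\<in>Basis. g b *\<^sub>R b) \<in> (\<Pi>\<^sub>M b\<in>(Basis::'a set). lborel) \<rightarrow>\<^sub>M borel"
    by measurable
  have m3: "(\<lambda>x. \<Prod>b\<in>Basis. f b (x \<bullet> b)) \<in> borel_measurable borel"
    by (intro borel_measurable_prod measurable_compose[OF _ m]) auto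
  show "integrable lborel (\<lambda>x. \<Prod>b\<in>Basis. f b (x \<bullet> b))"
    unfolding lborel_eq[where 'a = 'a]
    by (subst integrable_distr_eq) (use m3 f in \<open>auto intro!: P.product_integrable_prod\<close>)
  show "(\<integral>x. (\<Prod>b\<in>Basis. f b (x \<bullet> b)) \<partial>lborel) = (\<Prod>b\<in>Basis. (\<integral>x. f b x \<partial>lborel))"
    unfolding lborel_eq[where 'a = 'a]
    by (subst integral_distr) (use m3 f in \<open>auto intro!: P.product_integral_prod\<close>)
qed

text \<open>The threshold 2d comes from the comparison function, the product of the one-dimensional
  integrands 1 / (1 + t^2): each factor 1 + (x . b)^2 is at most (1 + |x|)^2.\<close>

lemma integrable_norm_powr:
  assumes "2 * real DIM('a) \<le> r"
  shows "integrable lborel (\<lambda>x::'a::euclidean_space. (1 + norm x) powr (- r))"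
proof -
  have "set_integrable lborel UNIV (\<lambda>x::real. inverse (1 + x\<^sup>2))"
    using integrable_inverse_1_plus_square by (simp add: einterval_eq_UNIV)
  then have "integrable lborel (\<lambda>x::real. inverse (1 + x\<^sup>2))"
    by (simp add: set_integrable_def)
  then have *: "integrable lborel (\<lambda>x::'a. \<Prod>b\<in>Basis. inverse (1 + (x \<bullet> b)\<^sup>2))"
    by (rule lborel_integral_prod(1))
  show ?thesis
  proof (rule Bochner_Integration.integrable_bound[OF *], goal_cases)
    case 2
    have "(1 + norm x) powr (- r) \<le> (\<Prod>b\<in>Basis. inverse (1 + (x \<bullet> b)\<^sup>2))" for x :: 'a
    proof -
      have "1 + (x \<bullet> b)\<^sup>2 \<le> (1 + norm x)\<^sup>2" if "b \<in> Basis" for b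
      proof -
        have "\<bar>x \<bullet> b\<bar>\<^sup>2 \<le> (norm x)\<^sup>2" using Basis_le_norm[OF that] by (intro power_mono) auto
        also have "1 + \<dots> \<le> (1 + norm x)\<^sup>2" by (simp add: power2_eq_square algebra_simps)
        finally show ?thesis by simp
      qed
      then have "(\<Prod>b\<in>Basis. 1 + (x \<bullet> b)\<^sup>2) \<le> (\<Prod>b\<in>(Basis::'a set). (1 + norm x)\<^sup>2)"
        by (intro prod_mono) auto
      also have "\<dots> = (1 + norm x) powr (2 * real DIM('a))"
        using powr_realpow[of "1 + norm x" "2 * DIM('a)"] by (simp add: power_mult add_pos_nonneg)
      also have "\<dots> \<le> (1 + norm x) powr r" using assms by (intro powr_mono) auto
      finally have "(\<Prod>b\<in>Basis. 1 + (x \<bullet> b)\<^sup>2) \<le> (1 + norm x) powr r" .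
      moreover have "0 < (\<Prod>b\<in>Basis. 1 + (x \<bullet> b)\<^sup>2)" by (intro prod_pos) (auto intro: add_pos_nonneg)
      ultimately have "inverse ((1 + norm x) powr r) \<le> inverse (\<Prod>b\<in>Basis. 1 + (x \<bullet> b)\<^sup>2)"
        by (rule le_imp_inverse_le)
      then show ?thesis
        using prod_inversef[of "\<lambda>b. 1 + (x \<bullet> b)\<^sup>2" Basis] by (simp add: o_def powr_minus)
    qed
    then show ?case by (auto simp: abs_of_nonneg prod_nonneg)
  qed simp
qed

lemma integrable_power_decay:
  fixes f :: "'a::euclidean_space \<Rightarrow> 'b::{banach, second_countable_topology}"
  assumes "f \<in> borel_measurable borel"
    and "\<And>x. norm (f x) \<le> C * (1 + norm x) powr (- r)" and "2 * real DIM('a) \<le> r"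
  shows "integrable lborel f"
  by (rule Bochner_Integration.integrable_bound[OF integrable_mult_right[OF integrable_norm_powr[OF assms(3)], of C]])
    (use assms(1) in \<open>auto intro!: always_eventually order_trans[OF assms(2)]\<close>)

lemma integrable_continuous_bounded_support:
  fixes f :: "'a::euclidean_space \<Rightarrow> 'b::{banach, second_countable_topology}"
  assumes "continuous_on UNIV f" and "\<And>x. R < norm x \<Longrightarrow> f x = 0"
  shows "integrable lborel f"
proof -
  have "integrable lborel (\<lambda>x. indicator (cball 0 R) x *\<^sub>R f x)"
    using assms(1) by (intro borel_integrable_compact) (auto intro: continuous_on_subset)
  also have "(\<lambda>x. indicator (cball 0 R) x *\<^sub>R f x) = f"
    using assms(2) by (auto simp: fun_eq_iff indicator_def not_le)
  finally show ?thesis .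
qed

text \<open>If the integral were 0, the set where f is nonzero would be open and negligible, hence
  empty.\<close>

lemma integral_continuous_nonneg_pos:
  fixes f :: "'a::euclidean_space \<Rightarrow> real"
  assumes cont: "continuous_on UNIV f" and int: "integrable lborel f"
    and nn: "\<And>x. 0 \<le> f x" and pos: "0 < f a"
  shows "0 < (\<integral>x. f x \<partial>lborel)"
proof (rule ccontr)
  assume "\<not> ?thesis"
  moreover have "0 \<le> (\<integral>x. f x \<partial>lborel)" by (simp add: nn)
  ultimately have "(\<integral>x. f x \<partial>lborel) = 0" by linarith
  then have "AE x in lborel. f x = 0"
    using integral_nonneg_eq_0_iff_AE[OF int] nn by simp
  moreover have op: "open {x. f x \<noteq> 0}"
    using open_Collect_neq[OF cont continuous_on_const] by simp
  ultimately have "{x. f x \<noteq> 0} \<in> null_sets lborel"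
    using AE_iff_measurable[of "{x. f x \<noteq> 0}" lborel "\<lambda>x. f x = 0"] by (auto simp: null_sets_def)
  then have "negligible {x. f x \<noteq> 0}" by (simp add: negligible_iff_null_sets null_sets_completionI)
  moreover have "{x. f x \<noteq> 0} \<noteq> {}" using pos by force
  ultimately show False using open_not_negligible[OF op] by blast
qed

section \<open>The Fourier transform\<close>

text \<open>A frequency parameter treats all transforms together: s = -2 pi is
  \<open>fourier\<close>, s = 2 pi is \<open>inv_fourier\<close>, and s = 1 suits the standard
  Gaussian. Integration is over \<open>lborel\<close>, where Fubini and affine substitution are at
  hand.\<close>

definition ftrans :: "real \<Rightarrow> ('a::euclidean_space \<Rightarrow> complex) \<Rightarrow> 'a \<Rightarrow> complex" where
  "ftrans s f x = (\<integral>y. cis (s * (x \<bullet> y)) * f y \<partial>lborel)"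

lemma continuous_cis_comp [continuous_intros]: "continuous_on S f \<Longrightarrow> continuous_on S (\<lambda>x. cis (f x))"
  unfolding cis_conv_exp by (intro continuous_intros)

lemma cis_measurable [measurable]: "cis \<in> borel_measurable borel"
  by (intro borel_measurable_continuous_onI continuous_cis_comp continuous_on_id)

lemma cis_inner_measurable [measurable]: "(\<lambda>y. cis (s * (x \<bullet> y))) \<in> borel_measurable borel"
  by (intro borel_measurable_continuous_onI continuous_intros)

lemma fourier_eq_ftrans: "f \<in> borel_measurable borel \<Longrightarrow> fourier f = ftrans (- (2 * pi)) f"
  unfolding fourier_def ftrans_def fun_eq_iff
  by (subst integral_completion)
    (auto simp: inner_commute)

lemma inv_fourier_eq_ftrans: "f \<in> borel_measurable borel \<Longrightarrow> inv_fourier f = ftrans (2 * pi) f"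
  unfolding inv_fourier_def ftrans_def fun_eq_iff
  by (subst integral_completion) auto

lemma integrable_cis_mult:
  assumes "integrable lborel f"
  shows "integrable lborel (\<lambda>y. cis (s * (x \<bullet> y)) * f y)"
  by (rule Bochner_Integration.integrable_bound[OF assms]) (use assms in \<open>auto simp: norm_mult\<close>)

lemma norm_ftrans_le:
  assumes "integrable lborel f"
  shows "norm (ftrans s f x) \<le> (\<integral>y. norm (f y) \<partial>lborel)"
  unfolding ftrans_def
  using integral_norm_bound[of lborel "\<lambda>y. cis (s * (x \<bullet> y)) * f y"] by (simp add: norm_mult)

lemma continuous_ftrans:
  assumes "integrable lborel f"
  shows "continuous_on UNIV (ftrans s f)"
  unfolding continuous_on_sequentially comp_def
proof safe
  fix X :: "nat \<Rightarrow> 'a" and x assume X: "X \<longlonglongrightarrow> x"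
  show "(\<lambda>n. ftrans s f (X n)) \<longlonglongrightarrow> ftrans s f x"
    unfolding ftrans_def
  proof (rule integral_dominated_convergence[where w = "\<lambda>y. norm (f y)"])
    show "AE y in lborel. (\<lambda>n. cis (s * (X n \<bullet> y)) * f y) \<longlonglongrightarrow> cis (s * (x \<bullet> y)) * f y"
    proof (intro always_eventually allI)
      fix y
      have "continuous_on UNIV cis" by (rule continuous_cis_comp[OF continuous_on_id])
      moreover have "(\<lambda>n. s * (X n \<bullet> y)) \<longlonglongrightarrow> s * (x \<bullet> y)" by (intro tendsto_intros X)
      ultimately have "(\<lambda>n. cis (s * (X n \<bullet> y))) \<longlonglongrightarrow> cis (s * (x \<bullet> y))"
        by (rule continuous_on_tendsto_compose) auto
      then show "(\<lambda>n. cis (s * (X n \<bullet> y)) * f y) \<longlonglongrightarrow> cis (s * (x \<bullet> y)) * f y"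
        by (rule tendsto_mult[OF _ tendsto_const])
    qed
    show "AE y in lborel. norm (cis (s * (X n \<bullet> y)) * f y) \<le> norm (f y)" for n
      by (simp add: norm_mult)
    have [measurable]: "f \<in> borel_measurable borel" using assms by auto
    show "(\<lambda>y. cis (s * (x \<bullet> y)) * f y) \<in> borel_measurable lborel"
      "(\<lambda>y. cis (s * (X n \<bullet> y)) * f y) \<in> borel_measurable lborel" for n
      by measurable
    show "integrable lborel (\<lambda>y. norm (f y))" using assms by simp
  qed
qed

text \<open>Fubini and the symmetry of the kernel in x and y. Transforms of distributions are turned
  into transforms of functions by this identity alone.\<close>

lemma ftrans_mult:
  fixes f g :: "'a::euclidean_space \<Rightarrow> complex"
  assumes f: "integrable lborel f" and g: "integrable lborel g"
  shows "(\<integral>x. f x * ftrans s g x \<partial>lborel) = (\<integral>y. ftrans s f y * g y \<partial>lborel)"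
proof -
  have [measurable]: "f \<in> borel_measurable borel" "g \<in> borel_measurable borel" using f g by auto
  have [measurable]: "(\<lambda>p::'a \<times> 'a. cis (s * (fst p \<bullet> snd p))) \<in> borel_measurable borel"
    by (intro borel_measurable_continuous_onI continuous_intros)
  have m: "(\<lambda>p::'a \<times> 'a. cis (s * (fst p \<bullet> snd p))) \<in> borel_measurable (lborel \<Otimes>\<^sub>M lborel)"
    by (subst lborel_prod) simp
  have int: "integrable (lborel \<Otimes>\<^sub>M lborel) (\<lambda>(x, y). f x * (cis (s * (x \<bullet> y)) * g y))"
  proof (rule lborel_pair.Fubini_integrable)
    show "(\<lambda>(x, y). f x * (cis (s * (x \<bullet> y)) * g y)) \<in> borel_measurable (lborel \<Otimes>\<^sub>M lborel)"
      using m unfolding split_beta by measurable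
    show "integrable lborel (\<lambda>x. \<integral>y. norm (case (x, y) of (x, y) \<Rightarrow> f x * (cis (s * (x \<bullet> y)) * g y)) \<partial>lborel)"
      using f by (simp add: norm_mult)
    show "AE x in lborel. integrable lborel (\<lambda>y. case (x, y) of (x, y) \<Rightarrow> f x * (cis (s * (x \<bullet> y)) * g y))"
      using integrable_cis_mult[OF g] by simp
  qed
  have "(\<integral>x. f x * ftrans s g x \<partial>lborel) = (\<integral>x. (\<integral>y. f x * (cis (s * (x \<bullet> y)) * g y) \<partial>lborel) \<partial>lborel)"
    by (simp add: ftrans_def)
  also have "\<dots> = (\<integral>y. (\<integral>x. f x * (cis (s * (x \<bullet> y)) * g y) \<partial>lborel) \<partial>lborel)"
    by (rule lborel_pair.Fubini_integral[OF int, symmetric])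
  also have "\<dots> = (\<integral>y. (\<integral>x. (cis (s * (y \<bullet> x)) * f x) * g y \<partial>lborel) \<partial>lborel)"
    by (simp add: mult_ac inner_commute)
  also have "\<dots> = (\<integral>y. ftrans s f y * g y \<partial>lborel)"
    by (simp add: ftrans_def)
  finally show ?thesis .
qed

text \<open>A modulation becomes a translation by t, a dilation by c the inverse dilation. With c =
  2^(-j) and t = x0 it turns the transform of a fixed bump into a wave at x0; with t = 0 it rescales
  the Gaussian.\<close>

lemma ftrans_affine:
  fixes f :: "'a::euclidean_space \<Rightarrow> complex"
  assumes [measurable]: "f \<in> borel_measurable borel" and "c \<noteq> 0"
  shows "ftrans s (\<lambda>y. cis (s * - (t \<bullet> y)) * f (c *\<^sub>R y)) x
    = of_real (1 / \<bar>c\<bar> ^ DIM('a)) * ftrans s f ((1 / c) *\<^sub>R (x - t))"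
proof -
  have "ftrans s (\<lambda>y. cis (s * - (t \<bullet> y)) * f (c *\<^sub>R y)) x
      = \<bar>1 / c\<bar> ^ DIM('a) *\<^sub>R
        (\<integral>y. cis (s * (x \<bullet> (0 + (1 / c) *\<^sub>R y))) * (cis (s * - (t \<bullet> (0 + (1 / c) *\<^sub>R y))) * f (c *\<^sub>R (0 + (1 / c) *\<^sub>R y))) \<partial>lborel)"
    unfolding ftrans_def
    by (rule lborel_integral_affine)
      (use assms(2) in \<open>auto intro!: borel_measurable_times measurable_compose[OF _ assms(1)]\<close>)
  also have "(\<lambda>y. cis (s * (x \<bullet> (0 + (1 / c) *\<^sub>R y))) * (cis (s * - (t \<bullet> (0 + (1 / c) *\<^sub>R y))) * f (c *\<^sub>R (0 + (1 / c) *\<^sub>R y))))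
      = (\<lambda>y. cis (s * (((1 / c) *\<^sub>R (x - t)) \<bullet> y)) * f y)"
    using assms(2) unfolding mult.assoc[symmetric] cis_mult by (auto simp: algebra_simps inner_diff_left fun_eq_iff)
  finally show ?thesis
    by (simp add: ftrans_def scaleR_conv_of_real power_divide)
qed

section \<open>The Gaussian and Fourier inversion\<close>

definition gaussian :: "'a::euclidean_space \<Rightarrow> real" where
  "gaussian x = (\<Prod>b\<in>Basis. std_normal_density (x \<bullet> b))"

lemma cis_inner_prod: "cis (x \<bullet> y) = (\<Prod>b\<in>Basis. cis ((x \<bullet> b) * (y \<bullet> b)))"
proof -
  have "cis (\<Sum>b\<in>B. f b) = (\<Prod>b\<in>B. cis (f b))" for B :: "'a set" and f
    by (induction B rule: infinite_finite_induct) (auto simp: cis_mult[symmetric])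
  then show ?thesis by (subst euclidean_inner) simp
qed

text \<open>The product form of the definition makes the transform split into one-dimensional
  characteristic functions; this radial form gives continuity and pointwise bounds.\<close>

lemma gaussian_eq: "gaussian (x::'a::euclidean_space) = (1 / sqrt (2 * pi)) ^ DIM('a) * exp (- (norm x)\<^sup>2 / 2)"
proof -
  have "(norm x)\<^sup>2 = (\<Sum>b\<in>Basis. (x \<bullet> b)\<^sup>2)"
    unfolding power2_norm_eq_inner euclidean_inner[of x x] by (simp add: power2_eq_square)
  then show ?thesis
    by (simp add: gaussian_def std_normal_density_def prod.distrib exp_sum[symmetric] sum_negf sum_divide_distrib prod_dividef power_divide)
qed

lemma integrable_gaussian: "integrable lborel (gaussian :: 'a::euclidean_space \<Rightarrow> real)"
  and integral_gaussian: "(\<integral>x. gaussian (x::'a) \<partial>lborel) = 1"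
  using lborel_integral_prod[of "\<lambda>b::'a. std_normal_density"]
  by (auto simp: gaussian_def[abs_def])

lemma ftrans_gaussian:
  "ftrans 1 (\<lambda>x. of_real (gaussian x)) (z::'a::euclidean_space) = of_real (sqrt (2 * pi) ^ DIM('a) * gaussian z)"
proof -
  have 1: "integrable lborel (\<lambda>x. cis (x * c) * of_real (std_normal_density x))" for c
    by (rule Bochner_Integration.integrable_bound[OF integrable_normal_density[of 1 0]])
      (auto simp: norm_mult)
  have 2: "(\<integral>x. cis (x * c) * of_real (std_normal_density x) \<partial>lborel) = of_real (exp (- c\<^sup>2 / 2))" for c
  proof -
    have "char std_normal_distribution c = (\<integral>x. std_normal_density x *\<^sub>R iexp (c * x) \<partial>lborel)"
      unfolding char_def by (subst integral_density) (auto simp: normal_density_nonneg)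
    then show ?thesis
      by (simp add: char_std_normal_distribution scaleR_conv_of_real cis_conv_exp mult_ac)
  qed
  have "ftrans 1 (\<lambda>x. of_real (gaussian x)) z
     = (\<integral>x. (\<Prod>b\<in>Basis. cis ((x \<bullet> b) * (z \<bullet> b)) * of_real (std_normal_density (x \<bullet> b))) \<partial>lborel)"
    unfolding ftrans_def
    by (simp only: mult_1 inner_commute[of z] cis_inner_prod[of _ z] gaussian_def of_real_prod prod.distrib)
  also have "\<dots> = (\<Prod>b\<in>Basis. (\<integral>x. cis (x * (z \<bullet> b)) * of_real (std_normal_density x) \<partial>lborel))"
    by (rule lborel_integral_prod(2)[of "\<lambda>b x. cis (x * (z \<bullet> b)) * of_real (std_normal_density x)"]) (rule 1)
  also have "\<dots> = of_real (\<Prod>b\<in>Basis. exp (- (z \<bullet> b)\<^sup>2 / 2))"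
    by (simp only: 2 of_real_prod)
  also have "(\<Prod>b\<in>Basis. exp (- (z \<bullet> b)\<^sup>2 / 2)) = (\<Prod>b\<in>Basis. sqrt (2 * pi) * std_normal_density (z \<bullet> b))"
    by (simp add: std_normal_density_def)
  also have "\<dots> = sqrt (2 * pi) ^ DIM('a) * gaussian z"
    unfolding prod.distrib by (simp add: gaussian_def)
  finally show ?thesis .
qed

text \<open>Gaussian summation. The outer integral is damped by a Gaussian of width 1 / epsilon,
  normalised to 1 at the origin. \<open>ftrans_mult\<close> moves the inner transform onto the
  damping factor, which becomes an approximate identity at \<eta>. Dominated convergence evaluates
  both forms as epsilon tends to 0, with majorants |h| on one side and K times the Gaussian on the
  other.\<close>

theorem ftrans_inversion:
  fixes M :: "'a::euclidean_space \<Rightarrow> complex"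
  assumes int: "integrable lborel M" and cont: "continuous_on UNIV M"
    and K: "\<And>x. norm (M x) \<le> K" and int': "integrable lborel (ftrans (2 * pi) M)"
  shows "ftrans (- (2 * pi)) (ftrans (2 * pi) M) \<eta> = M \<eta>"
proof -
  define h where "h = ftrans (2 * pi) M"
  define \<epsilon> where "\<epsilon> n = 1 / real (Suc n)" for n
  have \<epsilon>: "\<epsilon> n > 0" for n by (simp add: \<epsilon>_def)
  have \<epsilon>0: "\<epsilon> \<longlonglongrightarrow> 0" unfolding \<epsilon>_def[abs_def] using LIMSEQ_inverse_real_of_nat by (simp add: inverse_eq_divide)
  have [measurable]: "M \<in> borel_measurable borel" "h \<in> borel_measurable borel"
    using int int' by (auto simp: h_def)
  have gm [measurable]: "gaussian \<in> borel_measurable (borel :: 'a measure)"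
    using integrable_gaussian by auto
  have gc: "continuous_on UNIV (gaussian :: 'a \<Rightarrow> real)"
    unfolding gaussian_eq[abs_def] by (intro continuous_intros) auto
  \<comment> \<open>This factor makes the damping equal to 1 at the origin. It is also the constant
    in \<open>ftrans_gaussian\<close>, so c * c = (2 pi)^d appears below.\<close>
  define c where "c = sqrt (2 * pi) ^ DIM('a)"
  have c0: "c > 0" by (simp add: c_def)
  define f where "f n x = cis (- (2 * pi) * (\<eta> \<bullet> x)) * of_real (c * gaussian (\<epsilon> n *\<^sub>R x))" for n x
  have fint: "integrable lborel (f n)" for n
  proof -
    have "integrable lborel (\<lambda>x. gaussian (0 + \<epsilon> n *\<^sub>R x))"
      using \<epsilon>[of n] by (intro lborel_integrable_affine integrable_gaussian) auto
    then show ?thesis unfolding f_def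
      by (intro integrable_cis_mult integrable_of_real integrable_mult_right) simp
  qed
  have 1: "(\<integral>x. f n x * h x \<partial>lborel) = (\<integral>z. of_real (gaussian z) * M (\<eta> + (\<epsilon> n / (2 * pi)) *\<^sub>R z) \<partial>lborel)" for n
  proof -
    \<comment> \<open>The point of evaluation anticipates the substitution made next: the modulation
      by \<eta> cancels, a fixed Gaussian in z remains, and its prefactor is the inverse of the
      Jacobian.\<close>
    have F: "ftrans (2 * pi) (f n) (\<eta> + (\<epsilon> n / (2 * pi)) *\<^sub>R z) = of_real ((2 * pi / \<epsilon> n) ^ DIM('a) * gaussian z)" for z
    proof -
      have "ftrans (2 * pi) (f n) (\<eta> + (\<epsilon> n / (2 * pi)) *\<^sub>R z) = ftrans 1 (\<lambda>x. cis (1 * - (0 \<bullet> x)) * of_real (c * gaussian (\<epsilon> n *\<^sub>R x))) (\<epsilon> n *\<^sub>R z)"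
        unfolding ftrans_def f_def mult.assoc[symmetric] cis_mult
        by (intro Bochner_Integration.integral_cong refl arg_cong2[where f = "(*)"] arg_cong[where f = cis])
          (auto simp: algebra_simps inner_add_left)
      also have "\<dots> = of_real (1 / \<bar>\<epsilon> n\<bar> ^ DIM('a)) * ftrans 1 (\<lambda>x. of_real (c * gaussian x)) ((1 / \<epsilon> n) *\<^sub>R (\<epsilon> n *\<^sub>R z - 0))"
        by (rule ftrans_affine) (use \<epsilon>[of n] in auto)
      also have "(1 / \<epsilon> n) *\<^sub>R (\<epsilon> n *\<^sub>R z - 0) = z" using \<epsilon>[of n] by simp
      also have "ftrans 1 (\<lambda>x. of_real (c * gaussian x)) z = of_real c * ftrans 1 (\<lambda>x. of_real (gaussian x)) z"
        by (simp add: ftrans_def mult.left_commute)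
      also have "of_real (1 / \<bar>\<epsilon> n\<bar> ^ DIM('a)) * \<dots> = of_real (1 / \<epsilon> n ^ DIM('a) * (c * c) * gaussian z)"
        unfolding ftrans_gaussian c_def[symmetric] using \<epsilon>[of n] by simp
      also have "c * c = (2 * pi) ^ DIM('a)"
        unfolding c_def power_mult_distrib[symmetric] by simp
      finally show ?thesis by (simp add: power_divide)
    qed
    have "(\<integral>x. f n x * h x \<partial>lborel) = (\<integral>x. ftrans (2 * pi) (f n) x * M x \<partial>lborel)"
      unfolding h_def by (rule ftrans_mult[OF fint int])
    also have "\<dots> = \<bar>\<epsilon> n / (2 * pi)\<bar> ^ DIM('a) *\<^sub>R (\<integral>z. ftrans (2 * pi) (f n) (\<eta> + (\<epsilon> n / (2 * pi)) *\<^sub>R z) * M (\<eta> + (\<epsilon> n / (2 * pi)) *\<^sub>R z) \<partial>lborel)"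
      using \<epsilon>[of n] borel_measurable_continuous_onI[OF continuous_ftrans[OF fint[of n]]]
      by (intro lborel_integral_affine) auto
    also have "\<dots> = (\<integral>z. of_real (\<bar>\<epsilon> n / (2 * pi)\<bar> ^ DIM('a) * (2 * pi / \<epsilon> n) ^ DIM('a)) * (of_real (gaussian z) * M (\<eta> + (\<epsilon> n / (2 * pi)) *\<^sub>R z)) \<partial>lborel)"
      by (simp add: F scaleR_conv_of_real mult.assoc)
    also have "\<bar>\<epsilon> n / (2 * pi)\<bar> ^ DIM('a) * (2 * pi / \<epsilon> n) ^ DIM('a) = 1"
      unfolding power_mult_distrib[symmetric] using \<epsilon>[of n] by simp
    finally show ?thesis by simp
  qed
  have lim1: "(\<lambda>n. \<integral>x. f n x * h x \<partial>lborel) \<longlonglongrightarrow> ftrans (- (2 * pi)) h \<eta>"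
    unfolding ftrans_def
  proof (rule integral_dominated_convergence[where w = "\<lambda>x. norm (h x)"])
    show "AE x in lborel. (\<lambda>n. f n x * h x) \<longlonglongrightarrow> cis (- (2 * pi) * (\<eta> \<bullet> x)) * h x"
    proof (intro always_eventually allI)
      fix x :: 'a
      have "(\<lambda>n. \<epsilon> n *\<^sub>R x) \<longlonglongrightarrow> 0 *\<^sub>R x" by (intro tendsto_intros \<epsilon>0)
      then have "(\<lambda>n. gaussian (\<epsilon> n *\<^sub>R x)) \<longlonglongrightarrow> gaussian (0 *\<^sub>R x)"
        by (intro continuous_on_tendsto_compose[OF gc]) auto
      then have "(\<lambda>n. f n x * h x) \<longlonglongrightarrow> cis (- (2 * pi) * (\<eta> \<bullet> x)) * of_real (c * gaussian (0 *\<^sub>R x)) * h x"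
        unfolding f_def by (intro tendsto_intros)
      moreover have "c * gaussian (0 *\<^sub>R x) = 1"
        using c0 by (simp add: gaussian_eq c_def power_divide)
      ultimately show "(\<lambda>n. f n x * h x) \<longlonglongrightarrow> cis (- (2 * pi) * (\<eta> \<bullet> x)) * h x"
        by (simp only: of_real_1 mult_1_right)
    qed
    have "\<bar>c * gaussian y\<bar> \<le> 1" for y :: 'a
      using c0 by (auto simp: gaussian_eq c_def power_divide)
    then show "AE x in lborel. norm (f n x * h x) \<le> norm (h x)" for n
      by (intro always_eventually allI)
        (simp add: f_def norm_mult mult_left_le_one_le flip: of_real_mult abs_mult)
    show "(\<lambda>x. f n x * h x) \<in> borel_measurable lborel" for n
      using fint[of n] by auto
    show "(\<lambda>x. cis (- (2 * pi) * (\<eta> \<bullet> x)) * h x) \<in> borel_measurable lborel" by measurable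
    show "integrable lborel (\<lambda>x. norm (h x))" using int' by (simp add: h_def)
  qed
  have lim2: "(\<lambda>n. \<integral>x. f n x * h x \<partial>lborel) \<longlonglongrightarrow> (\<integral>z. of_real (gaussian (z::'a)) * M \<eta> \<partial>lborel)"
    unfolding 1
  proof (rule integral_dominated_convergence[where w = "\<lambda>z. gaussian z * K"])
    show "AE z in lborel. (\<lambda>n. of_real (gaussian z) * M (\<eta> + (\<epsilon> n / (2 * pi)) *\<^sub>R z)) \<longlonglongrightarrow> of_real (gaussian z) * M \<eta>"
    proof (intro always_eventually allI tendsto_intros)
      fix z :: 'a
      have "(\<lambda>n. \<eta> + (\<epsilon> n / (2 * pi)) *\<^sub>R z) \<longlonglongrightarrow> \<eta> + (0 / (2 * pi)) *\<^sub>R z"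
        by (intro tendsto_intros \<epsilon>0) auto
      then show "(\<lambda>n. M (\<eta> + (\<epsilon> n / (2 * pi)) *\<^sub>R z)) \<longlonglongrightarrow> M \<eta>"
        by (intro continuous_on_tendsto_compose[OF cont]) auto
    qed
    have "0 \<le> gaussian z" for z :: 'a by (simp add: gaussian_eq)
    then show "AE z in lborel. norm (of_real (gaussian z) * M (\<eta> + (\<epsilon> n / (2 * pi)) *\<^sub>R z)) \<le> gaussian z * K" for n
      by (intro always_eventually allI) (auto simp: norm_mult K intro!: mult_left_mono)
  qed (use integrable_gaussian in auto)
  have "ftrans (- (2 * pi)) h \<eta> = (\<integral>z. of_real (gaussian (z::'a)) * M \<eta> \<partial>lborel)"
    by (rule LIMSEQ_unique[OF lim1 lim2])
  also have "\<dots> = M \<eta>" using integrable_gaussian[where 'a = 'a] by (simp add: integral_gaussian)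
  finally show ?thesis by (simp add: h_def)
qed

section \<open>Decay of the Fourier transform\<close>

lemma fdiff_pow_support:
  fixes f :: "'a::real_normed_vector \<Rightarrow> 'b::ab_group_add"
  assumes "\<And>x. R < norm x \<Longrightarrow> f x = 0" and "R + real n * norm a < norm x"
  shows "(fdiff a ^^ n) f x = 0"
  using assms(2)
proof (induction n arbitrary: x)
  case (Suc n)
  have "norm x - norm a \<le> norm (x - a)" by (rule norm_triangle_ineq2)
  then have "(fdiff a ^^ n) f (x - a) = 0"
    using Suc.prems by (intro Suc.IH) (simp add: algebra_simps)
  moreover have "R + real n * norm a \<le> R + real (Suc n) * norm a" by (simp add: algebra_simps)
  then have "(fdiff a ^^ n) f x = 0" using Suc.prems by (intro Suc.IH) simp
  ultimately show ?case by (simp add: fdiff_pow_Suc_eq del: funpow.simps)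
qed (use assms in simp)

lemma ftrans_fdiff:
  assumes "continuous_on UNIV f" and "\<And>x. R < norm x \<Longrightarrow> f x = 0"
  shows "ftrans s ((fdiff a ^^ n) f) x = (1 - cis (s * (x \<bullet> a))) ^ n * ftrans s f x"
proof (induction n)
  case (Suc n)
  define g where "g = (fdiff a ^^ n) f"
  have c: "continuous_on UNIV g"
    unfolding g_def by (rule fdiff_pow_continuous[OF assms(1)])
  have int: "integrable lborel g"
    by (rule integrable_continuous_bounded_support[OF c])
      (auto simp: g_def intro!: fdiff_pow_support[OF assms(2)])
  then have [measurable]: "g \<in> borel_measurable borel" by auto
  have "ftrans s (\<lambda>y. g (y - a)) x = (\<integral>y. cis (s * (x \<bullet> (a + 1 *\<^sub>R y))) * g (a + 1 *\<^sub>R y - a) \<partial>lborel)"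
    unfolding ftrans_def by (subst lborel_integral_affine[where c = 1 and t = a]) auto
  also have "\<dots> = (\<integral>y. cis (s * (x \<bullet> a)) * (cis (s * (x \<bullet> y)) * g y) \<partial>lborel)"
    unfolding mult.assoc[symmetric] cis_mult by (simp add: inner_add_right distrib_left)
  also have "\<dots> = cis (s * (x \<bullet> a)) * ftrans s g x"
    by (simp add: ftrans_def)
  finally have 1: "ftrans s (\<lambda>y. g (y - a)) x = cis (s * (x \<bullet> a)) * ftrans s g x" .
  have int': "integrable lborel (\<lambda>y. g (y - a))"
    using lborel_integrable_affine[OF int, of 1 "- a"] by simp
  have "ftrans s (\<lambda>y. g y - g (y - a)) x = ftrans s g x - ftrans s (\<lambda>y. g (y - a)) x"
    unfolding ftrans_def right_diff_distrib
    by (rule Bochner_Integration.integral_diff) (rule integrable_cis_mult int int')+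
  then show ?case
    unfolding fdiff_pow_Suc_eq g_def[symmetric] 1 using Suc
    by (simp add: g_def[symmetric] algebra_simps)
qed simp

text \<open>Stands in for bounded pure derivatives up to order n. Lower orders are included because
  the product rule for differences mixes them.\<close>

definition fdiff_bounded :: "nat \<Rightarrow> ('a::euclidean_space \<Rightarrow> real) \<Rightarrow> bool" where
  "fdiff_bounded n f \<longleftrightarrow>
     (\<exists>C. \<forall>i\<le>n. \<forall>b\<in>Basis. \<forall>t x. \<bar>(fdiff (t *\<^sub>R b) ^^ i) f x\<bar> \<le> C * \<bar>t\<bar> ^ i)"

lemma fdiff_boundedI:
  "(\<And>i b t x. i \<le> n \<Longrightarrow> b \<in> Basis \<Longrightarrow> \<bar>(fdiff (t *\<^sub>R b) ^^ i) f x\<bar> \<le> C * \<bar>t\<bar> ^ i) \<Longrightarrow> fdiff_bounded n f"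
  unfolding fdiff_bounded_def by blast

lemma fdiff_boundedE:
  fixes f :: "'a::euclidean_space \<Rightarrow> real"
  assumes "fdiff_bounded n f"
  obtains C where "0 \<le> C"
    "\<And>i b t x. i \<le> n \<Longrightarrow> b \<in> Basis \<Longrightarrow> \<bar>(fdiff (t *\<^sub>R b) ^^ i) f x\<bar> \<le> C * \<bar>t\<bar> ^ i"
proof -
  obtain C where C: "\<And>i b t x. i \<le> n \<Longrightarrow> b \<in> Basis \<Longrightarrow> \<bar>(fdiff (t *\<^sub>R b) ^^ i) f x\<bar> \<le> C * \<bar>t\<bar> ^ i"
    using assms unfolding fdiff_bounded_def by blast
  obtain b :: 'a where "b \<in> Basis" using nonempty_Basis by blast
  from C[of 0 b 0 0] this have "0 \<le> C" by simp
  then show thesis using C that by blast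
qed

lemma smooth_imp_fdiff_bounded:
  "smooth f \<Longrightarrow> compact (tsupport f) \<Longrightarrow> fdiff_bounded n f"
  by (metis fdiff_boundedI smooth_fdiff_bound)

lemma fdiff_bounded_diff:
  assumes "fdiff_bounded n f" "fdiff_bounded n g"
  shows "fdiff_bounded n (\<lambda>x. f x - g x)"
proof -
  from assms(1) obtain C where C: "\<And>i b t x. i \<le> n \<Longrightarrow> b \<in> Basis \<Longrightarrow> \<bar>(fdiff (t *\<^sub>R b) ^^ i) f x\<bar> \<le> C * \<bar>t\<bar> ^ i"
    by (rule fdiff_boundedE) blast
  from assms(2) obtain D where D: "\<And>i b t x. i \<le> n \<Longrightarrow> b \<in> Basis \<Longrightarrow> \<bar>(fdiff (t *\<^sub>R b) ^^ i) g x\<bar> \<le> D * \<bar>t\<bar> ^ i"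
    by (rule fdiff_boundedE) blast
  show ?thesis
  proof (rule fdiff_boundedI[where C = "C + D"])
    fix i b t x assume "i \<le> n" "(b::'a) \<in> Basis"
    then show "\<bar>(fdiff (t *\<^sub>R b) ^^ i) (\<lambda>x. f x - g x) x\<bar> \<le> (C + D) * \<bar>t\<bar> ^ i"
      using C[of i b t x] D[of i b t x] unfolding fdiff_pow_diff by (auto simp: distrib_right)
  qed
qed

lemma fdiff_bounded_scale:
  assumes "fdiff_bounded n f"
  shows "fdiff_bounded n (\<lambda>x. f (r *\<^sub>R x))"
proof -
  from assms obtain C where "0 \<le> C" and C: "\<And>i b t x. i \<le> n \<Longrightarrow> b \<in> Basis \<Longrightarrow> \<bar>(fdiff (t *\<^sub>R b) ^^ i) f x\<bar> \<le> C * \<bar>t\<bar> ^ i"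
    by (rule fdiff_boundedE) blast
  show ?thesis
  \<comment> \<open>The base 1 + |r| rather than |r| dominates |r|^i for every i up to n, also when
    |r| < 1.\<close>
  proof (rule fdiff_boundedI[where C = "C * (1 + \<bar>r\<bar>) ^ n"])
    fix i b t x assume i: "i \<le> n" "(b::'a) \<in> Basis"
    have "(fdiff (t *\<^sub>R b) ^^ i) (\<lambda>x. f (r *\<^sub>R x)) = (\<lambda>x. (fdiff ((r * t) *\<^sub>R b) ^^ i) f (r *\<^sub>R x))"
      by (rule fdiff_pow_compose) (simp add: algebra_simps)
    then have "\<bar>(fdiff (t *\<^sub>R b) ^^ i) (\<lambda>x. f (r *\<^sub>R x)) x\<bar> \<le> C * \<bar>r * t\<bar> ^ i"
      using C[OF i, of "r * t" "r *\<^sub>R x"] by simp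
    also have "\<dots> = C * \<bar>r\<bar> ^ i * \<bar>t\<bar> ^ i" by (simp add: abs_mult power_mult_distrib)
    also have "\<dots> \<le> C * (1 + \<bar>r\<bar>) ^ n * \<bar>t\<bar> ^ i"
    proof (intro mult_right_mono mult_left_mono)
      have "\<bar>r\<bar> ^ i \<le> (1 + \<bar>r\<bar>) ^ i" by (intro power_mono) auto
      also have "\<dots> \<le> (1 + \<bar>r\<bar>) ^ n" using i by (intro power_increasing) auto
      finally show "\<bar>r\<bar> ^ i \<le> (1 + \<bar>r\<bar>) ^ n" .
    qed (use \<open>0 \<le> C\<close> in auto)
    finally show "\<bar>(fdiff (t *\<^sub>R b) ^^ i) (\<lambda>x. f (r *\<^sub>R x)) x\<bar> \<le> C * (1 + \<bar>r\<bar>) ^ n * \<bar>t\<bar> ^ i" .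
  qed
qed

lemma fdiff_bounded_mult:
  assumes "fdiff_bounded n f" "fdiff_bounded n g"
  shows "fdiff_bounded n (\<lambda>x. f x * g x)"
proof -
  from assms(1) obtain C where "0 \<le> C" and C: "\<And>i b t x. i \<le> n \<Longrightarrow> b \<in> Basis \<Longrightarrow> \<bar>(fdiff (t *\<^sub>R b) ^^ i) f x\<bar> \<le> C * \<bar>t\<bar> ^ i"
    by (rule fdiff_boundedE) blast
  from assms(2) obtain D where "0 \<le> D" and D: "\<And>i b t x. i \<le> n \<Longrightarrow> b \<in> Basis \<Longrightarrow> \<bar>(fdiff (t *\<^sub>R b) ^^ i) g x\<bar> \<le> D * \<bar>t\<bar> ^ i"
    by (rule fdiff_boundedE) blast
  show ?thesis
  proof (rule fdiff_boundedI[where C = "2 ^ n * (C * D)"])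
    fix i b t x assume i: "i \<le> n" "(b::'a) \<in> Basis"
    have "\<bar>(fdiff (t *\<^sub>R b) ^^ i) (\<lambda>x. f x * g x) x\<bar> \<le> 2 ^ i * (C * D) * \<bar>t\<bar> ^ i"
      using i C D by (intro fdiff_pow_mult_bound) auto
    also have "\<dots> \<le> 2 ^ n * (C * D) * \<bar>t\<bar> ^ i"
      using i \<open>0 \<le> C\<close> \<open>0 \<le> D\<close> by (intro mult_right_mono power_increasing) auto
    finally show "\<bar>(fdiff (t *\<^sub>R b) ^^ i) (\<lambda>x. f x * g x) x\<bar> \<le> 2 ^ n * (C * D) * \<bar>t\<bar> ^ i" .
  qed
qed

text \<open>
  Differencing \<open>f\<close> with step \<open>a\<close> multiplies the transform by \<open>1 - cis (s * (x \<bullet> a))\<close>, which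
  is \<open>2\<close> for a step of length \<open>1 / (2 * (x \<bullet> b))\<close> along a coordinate axis \<open>b\<close>.
\<close>

lemma ftrans_decay:
  fixes f :: "'a::euclidean_space \<Rightarrow> real"
  assumes cont: "continuous_on UNIV f" and supp: "\<And>x. R < norm x \<Longrightarrow> f x = 0"
    and "fdiff_bounded n f"
  obtains B where "0 \<le> B"
    "\<And>x. norm (ftrans (2 * pi) (\<lambda>x. of_real (f x)) x) \<le> B * (1 + norm x) powr (- real n)"
proof -
  from assms(3) obtain C where "0 \<le> C" and
    C': "\<And>i b t x. i \<le> n \<Longrightarrow> b \<in> Basis \<Longrightarrow> \<bar>(fdiff (t *\<^sub>R b) ^^ i) f x\<bar> \<le> C * \<bar>t\<bar> ^ i"
    by (rule fdiff_boundedE) blast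
  note C = C'[OF order_refl]
  let ?f = "\<lambda>x. complex_of_real (f x)"
  let ?F = "ftrans (2 * pi) ?f"
  define D where "D = real DIM('a)"
  have "D \<ge> 1" by (simp add: D_def)
  \<comment> \<open>The step chosen below has length at most D, so this ball contains the support of
    the n-th difference for every x.\<close>
  define V where "V = measure lborel (cball 0 (R + real n * D) :: 'a set)"
  define A where "A = (\<integral>x. norm (?f x) \<partial>lborel)"
  have [simp]: "0 \<le> V" "0 \<le> A" by (auto simp: V_def A_def)
  have cont': "continuous_on UNIV ?f" by (intro continuous_intros cont)
  have supp': "R < norm x \<Longrightarrow> ?f x = 0" for x by (simp add: supp)
  have int: "integrable lborel ?f"
    by (rule integrable_continuous_bounded_support[OF cont' supp'])
  have powr: "(1 + norm x) powr (- real n) = 1 / (1 + norm x) ^ n" for x :: 'a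
    by (simp add: powr_minus powr_realpow add_pos_nonneg inverse_eq_divide)
  have "norm (?F x) \<le> (C * V * D ^ n + A * 2 ^ n) * (1 + norm x) powr (- real n)" for x
  \<comment> \<open>Near the origin the required step would be too long, but there the trivial bound
    A suffices, because (1 + |x|)^n <= 2^n.\<close>
  proof (cases "norm x < 1")
    case True
    have "norm (?F x) \<le> A" unfolding A_def by (rule norm_ftrans_le[OF int])
    moreover have "(1 + norm x) ^ n \<le> 2 ^ n" using True by (intro power_mono) auto
    then have "A * 1 \<le> A * (2 ^ n / (1 + norm x) ^ n)"
      by (intro mult_left_mono) (auto simp: field_simps add_pos_nonneg)
    moreover have "0 \<le> C * V * D ^ n / (1 + norm x) ^ n"
      using \<open>0 \<le> C\<close> \<open>D \<ge> 1\<close> by simp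
    ultimately show ?thesis by (simp add: powr distrib_right add_divide_distrib)
  next
    case False
    \<comment> \<open>By pigeonhole some coordinate has size at least |x| / d; differencing is done
      along that axis.\<close>
    have "norm x \<le> (\<Sum>b\<in>Basis. \<bar>x \<bullet> b\<bar>)" by (rule norm_le_l1)
    moreover have "(\<Sum>b\<in>Basis. \<bar>x \<bullet> b\<bar>) < (\<Sum>b\<in>(Basis::'a set). norm x / D)"
      if "\<forall>b\<in>Basis. \<bar>x \<bullet> b\<bar> < norm x / D"
      using that by (intro sum_strict_mono) auto
    ultimately obtain b where b: "b \<in> Basis" "norm x / D \<le> \<bar>x \<bullet> b\<bar>"
      using \<open>D \<ge> 1\<close> by (force simp: D_def not_less)
    have xD: "0 < norm x / D" using False \<open>D \<ge> 1\<close> by (intro divide_pos_pos) linarith+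
    then have xb: "x \<bullet> b \<noteq> 0" using b by auto
    define t where "t = 1 / (2 * (x \<bullet> b))"
    have tle: "\<bar>t\<bar> \<le> D / (1 + norm x)"
    proof -
      have "\<bar>t\<bar> = 1 / (2 * \<bar>x \<bullet> b\<bar>)" by (simp add: t_def)
      also have "\<dots> \<le> 1 / (2 * (norm x / D))"
        using b xD xb by (intro divide_left_mono mult_left_mono mult_pos_pos) auto
      also have "\<dots> = D / (2 * norm x)" using \<open>D \<ge> 1\<close> by simp
      \<comment> \<open>Here 2 |x| >= 1 + |x|, since |x| >= 1 in this case.\<close>
      also have "\<dots> \<le> D / (1 + norm x)" using False \<open>D \<ge> 1\<close>
        by (intro divide_left_mono mult_pos_pos) (auto intro: add_pos_nonneg)
      finally show ?thesis .
    qed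
    also have "\<dots> \<le> D" using \<open>D \<ge> 1\<close> by (simp add: field_simps add_pos_nonneg)
    finally have tle': "\<bar>t\<bar> \<le> D" .
    define g where "g = (fdiff (t *\<^sub>R b) ^^ n) ?f"
    have g_eq: "g y = of_real ((fdiff (t *\<^sub>R b) ^^ n) f y)" for y
      unfolding g_def fdiff_pow_of_real ..
    have gs: "g y = 0" if "R + real n * D < norm y" for y
    proof -
      have "real n * norm (t *\<^sub>R b) \<le> real n * D" using tle' b by (intro mult_left_mono) auto
      then show ?thesis unfolding g_def using that by (intro fdiff_pow_support[OF supp']) auto
    qed
    have gint: "integrable lborel g"
      by (rule integrable_continuous_bounded_support[OF _ gs])
        (auto simp: g_def intro!: fdiff_pow_continuous cont')
    have "2 ^ n * norm (?F x) = norm (ftrans (2 * pi) g x)"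
    proof -
      have pi: "2 * pi * (x \<bullet> (t *\<^sub>R b)) = pi" using xb by (simp add: t_def)
      have "ftrans (2 * pi) g x = (1 - cis (2 * pi * (x \<bullet> (t *\<^sub>R b)))) ^ n * ?F x"
        unfolding g_def by (rule ftrans_fdiff[OF cont' supp'])
      then show ?thesis by (simp only: pi cis_pi) (simp add: norm_mult norm_power)
    qed
    also have "\<dots> \<le> (\<integral>y. norm (g y) \<partial>lborel)" by (rule norm_ftrans_le[OF gint])
    also have "\<dots> \<le> (\<integral>y. indicator (cball 0 (R + real n * D)) (y::'a) * (C * \<bar>t\<bar> ^ n) \<partial>lborel)"
    proof (rule integral_mono)
      show "integrable lborel (\<lambda>y. norm (g y))" using gint by simp
      show "integrable lborel (\<lambda>y::'a. indicator (cball 0 (R + real n * D)) y * (C * \<bar>t\<bar> ^ n) :: real)"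
        by (intro integrable_mult_left integrable_real_indicator emeasure_bounded_finite) auto
      show "norm (g y) \<le> indicator (cball 0 (R + real n * D)) y * (C * \<bar>t\<bar> ^ n)" for y
        using gs[of y] C[OF b(1), of t y] by (auto simp: g_eq indicator_def)
    qed
    also have "\<dots> = V * (C * \<bar>t\<bar> ^ n)" by (simp add: V_def)
    also have "\<dots> \<le> V * (C * (D / (1 + norm x)) ^ n)"
      using tle \<open>0 \<le> C\<close> by (intro mult_left_mono power_mono) auto
    finally have 1: "2 ^ n * norm (?F x) \<le> V * (C * (D / (1 + norm x)) ^ n)" .
    have "1 * norm (?F x) \<le> 2 ^ n * norm (?F x)" by (intro mult_right_mono) auto
    moreover have "0 \<le> A * 2 ^ n / (1 + norm x) ^ n" by simp
    moreover have "V * (C * (D / (1 + norm x)) ^ n) = C * V * D ^ n / (1 + norm x) ^ n"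
      by (simp add: power_divide)
    ultimately have "norm (?F x) \<le> C * V * D ^ n / (1 + norm x) ^ n + A * 2 ^ n / (1 + norm x) ^ n"
      using 1 by linarith
    then show ?thesis by (simp add: powr distrib_right add_divide_distrib)
  qed
  then show thesis using \<open>0 \<le> C\<close> \<open>D \<ge> 1\<close> by (intro that[of "C * V * D ^ n + A * 2 ^ n"]) auto
qed

section \<open>Schwartz and test functions\<close>

lemma schwartz_bound:
  assumes "\<theta> \<in> schwartz_functions"
  obtains C where "\<And>x. (1 + norm x) ^ N * norm (\<theta> x) \<le> C"
proof -
  have "bounded (range (\<lambda>x. (1 + norm x) ^ N *\<^sub>R iter_deriv [] \<theta> x))"
    using assms unfolding schwartz_functions_def mem_Collect_eq
    by (elim conjE allE[of _ N] allE[of _ "[]"]) simp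
  then show thesis using that by (auto simp: bounded_iff abs_mult)
qed

lemma schwartz_continuous: "\<theta> \<in> schwartz_functions \<Longrightarrow> continuous_on UNIV \<theta>"
  by (auto simp: schwartz_functions_def intro: smooth_imp_continuous)

lemma schwartz_integrable:
  fixes \<theta> :: "'a::euclidean_space \<Rightarrow> complex"
  assumes "\<theta> \<in> schwartz_functions"
  shows "integrable lborel \<theta>"
proof -
  obtain C where C: "\<And>x. (1 + norm x) ^ (2 * DIM('a)) * norm (\<theta> x) \<le> C"
    using schwartz_bound[OF assms] by blast
  show ?thesis
  proof (rule integrable_power_decay)
    show "\<theta> \<in> borel_measurable borel"
      by (intro borel_measurable_continuous_onI schwartz_continuous assms)
    show "norm (\<theta> x) \<le> C * (1 + norm x) powr - real (2 * DIM('a))" for x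
      using C[of x] powr_realpow[of "1 + norm x" "2 * DIM('a)"]
      by (simp add: powr_minus field_simps add_pos_nonneg)
  qed simp
qed

lemma test_function_continuous: "\<theta> \<in> test_functions \<Omega> \<Longrightarrow> continuous_on UNIV \<theta>"
  by (auto simp: test_functions_def intro: smooth_imp_continuous)

lemma zero_outside_tsupport: "x \<notin> tsupport f \<Longrightarrow> f x = 0"
  using closure_subset[of "{x. f x \<noteq> 0}"] by (auto simp: tsupport_def)

lemma test_function_integrable:
  assumes "\<theta> \<in> test_functions \<Omega>"
  shows "integrable lborel \<theta>"
proof -
  have "bounded (tsupport \<theta>)" using assms by (auto simp: test_functions_def compact_imp_bounded)
  then obtain R where "\<And>x. x \<in> tsupport \<theta> \<Longrightarrow> norm x \<le> R" by (auto simp: bounded_iff)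
  then show ?thesis
    by (intro integrable_continuous_bounded_support[OF test_function_continuous[OF assms], of R])
      (metis not_less zero_outside_tsupport)
qed

text \<open>\<open>deriv_seminorm\<close> is a supremum of reals, hence an upper bound only for a
  bounded set of values.\<close>

lemma norm_le_deriv_seminorm:
  assumes "bounded (range \<theta>)"
  shows "norm (\<theta> x) \<le> deriv_seminorm 0 0 \<theta>"
proof -
  have "{vs. set vs \<subseteq> Basis \<and> length vs \<le> 0} = {[]}" by auto
  then have "deriv_seminorm 0 0 \<theta> = (SUP x. norm (\<theta> x))"
    unfolding deriv_seminorm_def
    by (intro arg_cong[where f = Sup]) (auto simp: image_iff)
  moreover have "bdd_above (range (\<lambda>x. norm (\<theta> x)))"
    using assms unfolding bounded_iff bdd_above_def by blast
  ultimately show ?thesis using cSUP_upper[of x UNIV "\<lambda>x. norm (\<theta> x)"] by simp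
qed

lemma schwartz_bounded: "\<theta> \<in> schwartz_functions \<Longrightarrow> bounded (range \<theta>)"
  by (rule schwartz_bound[of \<theta> 0]) (auto simp: bounded_iff)

lemma test_function_bounded:
  assumes "\<theta> \<in> test_functions \<Omega>"
  shows "bounded (range \<theta>)"
proof -
  have "compact (\<theta> ` tsupport \<theta>)"
    using assms test_function_continuous[OF assms]
    by (intro compact_continuous_image) (auto simp: test_functions_def intro: continuous_on_subset)
  then have "bounded (insert 0 (\<theta> ` tsupport \<theta>))" by (auto intro: compact_imp_bounded)
  then show ?thesis
    by (rule bounded_subset) (use zero_outside_tsupport[of _ \<theta>] in blast)
qed

text \<open>The integral extends over the whole space even when the test function lives on a smaller
  set. The same functional is therefore a tempered distribution, a distribution on \<Omega>, and its
  own restriction.\<close>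

definition fun_dist :: "('a::euclidean_space \<Rightarrow> real) \<Rightarrow> 'a functional" where
  "fun_dist g = (\<lambda>\<theta>. \<integral>x. of_real (g x) * \<theta> x \<partial>lebesgue)"

lemma fun_dist_lborel:
  assumes [measurable]: "g \<in> borel_measurable borel" "\<theta> \<in> borel_measurable borel"
  shows "fun_dist g \<theta> = (\<integral>x. of_real (g x) * \<theta> x \<partial>lborel)"
  unfolding fun_dist_def by (rule integral_completion) simp

text \<open>X is kept abstract so that Schwartz functions and test functions are treated together;
  only integrability and boundedness of the arguments enter.\<close>

lemma fun_dist_properties:
  assumes g: "integrable lborel g" "\<And>x. \<bar>g x\<bar> \<le> K"
    and X: "\<And>\<theta>. \<theta> \<in> X \<Longrightarrow> integrable lborel \<theta> \<and> bounded (range \<theta>)"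
  shows "linear_functional_on X (fun_dist g)" "real_functional_on X (fun_dist g)"
    "\<theta> \<in> X \<Longrightarrow> norm (fun_dist g \<theta>) \<le> (\<integral>x. \<bar>g x\<bar> \<partial>lborel) * deriv_seminorm 0 0 \<theta>"
proof -
  have [measurable]: "g \<in> borel_measurable borel" using g by auto
  have int: "integrable lborel (\<lambda>x. of_real (g x) * \<theta> x)" if "\<theta> \<in> X" for \<theta>
  proof (rule Bochner_Integration.integrable_bound)
    show "integrable lborel (\<lambda>x. of_real K * \<theta> x)" using X[OF that] by simp
    have "\<bar>g x\<bar> \<le> \<bar>K\<bar>" for x using g(2)[of x] by simp
    then show "AE x in lborel. norm (of_real (g x) * \<theta> x) \<le> norm (of_real K * \<theta> x)"
      by (auto simp: norm_mult intro!: always_eventually mult_right_mono)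
    have "\<theta> \<in> borel_measurable borel" using X[OF that] by auto
    then show "(\<lambda>x. of_real (g x) * \<theta> x) \<in> borel_measurable lborel" by measurable
  qed
  have m: "\<theta> \<in> borel_measurable borel" if "\<theta> \<in> X" for \<theta> using X[OF that] by auto
  show "linear_functional_on X (fun_dist g)"
    unfolding linear_functional_on_def
  proof safe
    fix \<theta> \<eta> a b assume t: "\<theta> \<in> X" "\<eta> \<in> X"
    note [measurable] = m[OF t(1)] m[OF t(2)]
    have "fun_dist g (\<lambda>x. a * \<theta> x + b * \<eta> x)
        = (\<integral>x. a * (of_real (g x) * \<theta> x) + b * (of_real (g x) * \<eta> x) \<partial>lborel)"
      by (subst fun_dist_lborel) (auto simp: algebra_simps)
    also have "\<dots> = a * fun_dist g \<theta> + b * fun_dist g \<eta>"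
      using int[OF t(1)] int[OF t(2)] by (simp add: fun_dist_lborel)
    finally show "fun_dist g (\<lambda>x. a * \<theta> x + b * \<eta> x) = a * fun_dist g \<theta> + b * fun_dist g \<eta>" .
  qed
  show "real_functional_on X (fun_dist g)"
    unfolding real_functional_on_def
  proof safe
    fix \<theta> assume t: "\<theta> \<in> X" "range \<theta> \<subseteq> \<real>"
    then have "\<theta> x \<in> \<real>" for x by blast
    then have "\<theta> = (\<lambda>x. of_real (Re (\<theta> x)))" by (auto simp: fun_eq_iff)
    then have "fun_dist g \<theta> = (\<integral>x. of_real (g x * Re (\<theta> x)) \<partial>lebesgue)"
      unfolding fun_dist_def by (metis of_real_mult)
    then show "fun_dist g \<theta> \<in> \<real>" by (simp only: integral_complex_of_real Reals_of_real)
  qed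
  show "norm (fun_dist g \<theta>) \<le> (\<integral>x. \<bar>g x\<bar> \<partial>lborel) * deriv_seminorm 0 0 \<theta>" if t: "\<theta> \<in> X"
  proof -
    have "norm (fun_dist g \<theta>) \<le> (\<integral>x. norm (of_real (g x) * \<theta> x) \<partial>lborel)"
      unfolding fun_dist_lborel[OF \<open>g \<in> borel_measurable borel\<close> m[OF t]] by (rule integral_norm_bound)
    also have "\<dots> \<le> (\<integral>x. \<bar>g x\<bar> * deriv_seminorm 0 0 \<theta> \<partial>lborel)"
    proof (rule integral_mono)
      show "integrable lborel (\<lambda>x. norm (of_real (g x) * \<theta> x))" by (intro integrable_norm int t)
      show "integrable lborel (\<lambda>x. \<bar>g x\<bar> * deriv_seminorm 0 0 \<theta>)" using g by simp
      show "norm (of_real (g x) * \<theta> x) \<le> \<bar>g x\<bar> * deriv_seminorm 0 0 \<theta>" for x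
        using norm_le_deriv_seminorm[of \<theta> x] X[OF t] by (auto simp: norm_mult intro!: mult_left_mono)
    qed
    finally show ?thesis by simp
  qed
qed

lemma fun_dist_tempered:
  assumes g: "integrable lborel g" "\<And>x. \<bar>g x\<bar> \<le> K"
  shows "fun_dist g \<in> tempered_distributions"
proof -
  have X: "integrable lborel \<theta> \<and> bounded (range \<theta>)" if "\<theta> \<in> schwartz_functions" for \<theta> :: "'a \<Rightarrow> complex"
    using that schwartz_integrable schwartz_bounded by blast
  show ?thesis
    unfolding tempered_distributions_def mem_Collect_eq
    using fun_dist_properties[OF g X] by blast
qed

lemma fun_dist_distribution:
  assumes g: "integrable lborel g" "\<And>x. \<bar>g x\<bar> \<le> K"
  shows "fun_dist g \<in> distributions \<Omega>"
proof -
  have X: "integrable lborel \<theta> \<and> bounded (range \<theta>)" if "\<theta> \<in> test_functions \<Omega>" for \<theta>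
    using that test_function_integrable test_function_bounded by blast
  show ?thesis
    unfolding distributions_def mem_Collect_eq
    using fun_dist_properties[OF g X] by blast
qed

section \<open>Band-limited waves\<close>

locale littlewood_paley =
  fixes \<phi>0 :: "'a::euclidean_space \<Rightarrow> real"
  assumes cutoff: "besov_cutoff \<phi>0"
begin

lemma phi_smooth: "smooth \<phi>0"
  and phi_norm: "norm \<xi> = norm \<eta> \<Longrightarrow> \<phi>0 \<xi> = \<phi>0 \<eta>"
  and phi_antimono: "norm \<xi> \<le> norm \<eta> \<Longrightarrow> \<phi>0 \<eta> \<le> \<phi>0 \<xi>"
  and phi_bounds: "0 \<le> \<phi>0 \<xi>" "\<phi>0 \<xi> \<le> 1"
  and phi_one: "norm \<xi> \<le> 1 \<Longrightarrow> \<phi>0 \<xi> = 1"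
  and phi_support: "tsupport \<phi>0 \<subseteq> cball 0 2"
  using cutoff unfolding besov_cutoff_def by blast+

lemma phi_zero: "2 < norm \<xi> \<Longrightarrow> \<phi>0 \<xi> = 0"
  using phi_support zero_outside_tsupport[of \<xi> \<phi>0] by (metis mem_cball_0 not_less subsetD)

lemma phi_compact: "compact (tsupport \<phi>0)"
  unfolding compact_eq_bounded_closed
  using bounded_subset[OF bounded_cball phi_support] by (simp add: tsupport_def)

lemma phi_continuous: "continuous_on UNIV \<phi>0"
  by (rule smooth_imp_continuous[OF phi_smooth])

text \<open>The common shape of all dyadic cutoffs with index at least 1, rescaled to the annulus
  1/2 <= |\<xi>| <= 2.\<close>

definition band :: "'a \<Rightarrow> real" where
  "band \<xi> = \<phi>0 \<xi> - \<phi>0 (2 *\<^sub>R \<xi>)"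

lemma band_nonneg: "0 \<le> band \<xi>"
  unfolding band_def using phi_antimono[of \<xi> "2 *\<^sub>R \<xi>"] by simp

lemma band_le_1: "band \<xi> \<le> 1"
  unfolding band_def using phi_bounds(1)[of "2 *\<^sub>R \<xi>"] phi_bounds(2)[of \<xi>] by simp

lemma band_small: "norm \<xi> \<le> 1 / 2 \<Longrightarrow> band \<xi> = 0"
  unfolding band_def using phi_one[of \<xi>] phi_one[of "2 *\<^sub>R \<xi>"] by simp

lemma band_large: "2 < norm \<xi> \<Longrightarrow> band \<xi> = 0"
  unfolding band_def using phi_zero[of \<xi>] phi_zero[of "2 *\<^sub>R \<xi>"] by simp

lemma band_uminus: "band (- \<xi>) = band \<xi>"
  unfolding band_def using phi_norm[of \<xi> "- \<xi>"] phi_norm[of "2 *\<^sub>R \<xi>" "- (2 *\<^sub>R \<xi>)"] by simp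

lemma band_continuous: "continuous_on UNIV band"
  unfolding band_def
  by (intro continuous_intros phi_continuous continuous_on_compose2[OF phi_continuous, of UNIV "\<lambda>x. 2 *\<^sub>R x"]) auto

lemma band_scaled_continuous: "continuous_on UNIV (\<lambda>\<xi>. band (r *\<^sub>R \<xi>))"
  by (rule continuous_on_compose2[OF band_continuous]) (auto intro!: continuous_intros)

lemma band_fdiff_bounded: "fdiff_bounded n band"
proof -
  have "fdiff_bounded n \<phi>0" by (intro smooth_imp_fdiff_bounded phi_smooth phi_compact)
  then show ?thesis unfolding band_def by (intro fdiff_bounded_diff fdiff_bounded_scale)
qed

lemma dyadic_eq_band: "1 \<le> i \<Longrightarrow> dyadic \<phi>0 i \<xi> = band ((1 / 2 ^ i) *\<^sub>R \<xi>)"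
proof -
  have "(2::real) powi (- int i + 1) = 2 * (1 / 2 ^ i)"
    by (subst power_int_add) (auto simp: power_int_minus inverse_eq_divide)
  moreover have "(2::real) powi (- int i) = 1 / 2 ^ i" by (simp add: power_int_minus inverse_eq_divide)
  moreover assume "1 \<le> i"
  ultimately show ?thesis by (simp only: dyadic_def band_def scaleR_scaleR) simp
qed

lemma dyadic_continuous: "continuous_on UNIV (dyadic \<phi>0 i)"
proof (cases "i = 0")
  case True
  then have "dyadic \<phi>0 i = \<phi>0" by (auto simp: dyadic_def)
  then show ?thesis using phi_continuous by simp
next
  case False
  then have "dyadic \<phi>0 i = (\<lambda>\<xi>. band ((1 / 2 ^ i) *\<^sub>R \<xi>))" by (auto simp: dyadic_eq_band)
  then show ?thesis using band_scaled_continuous by simp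
qed

lemma dyadic_large: "2 * 2 ^ i < norm \<xi> \<Longrightarrow> dyadic \<phi>0 i \<xi> = 0"
proof (cases "i = 0")
  case True
  then show "2 * 2 ^ i < norm \<xi> \<Longrightarrow> ?thesis" by (simp add: dyadic_def phi_zero)
next
  case False
  then show "2 * 2 ^ i < norm \<xi> \<Longrightarrow> ?thesis"
    by (subst dyadic_eq_band) (auto intro!: band_large simp: field_simps)
qed

text \<open>Indices at distance 2 give annuli whose closures touch in a sphere. The product still
  vanishes there, because \<open>band\<close> is 0 on the closed ball of radius 1/2, so the lower
  bounds on |\<xi>| are strict.\<close>

lemma dyadic_band_disjoint:
  assumes "2 \<le> j" and "i + 2 \<le> j \<or> j + 2 \<le> i"
  shows "dyadic \<phi>0 i \<xi> * band ((1 / 2 ^ j) *\<^sub>R \<xi>) = 0"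
proof (rule ccontr)
  assume "dyadic \<phi>0 i \<xi> * band ((1 / 2 ^ j) *\<^sub>R \<xi>) \<noteq> 0"
  then have d: "dyadic \<phi>0 i \<xi> \<noteq> 0" and b: "band ((1 / 2 ^ j) *\<^sub>R \<xi>) \<noteq> 0" by auto
  from d have 1: "norm \<xi> \<le> 2 ^ (i + 1)" using dyadic_large[of i \<xi>] by (metis not_less power_Suc Suc_eq_plus1)
  have 2: "2 ^ j < 2 * norm \<xi>"
    by (rule ccontr) (use b band_small[of "(1 / 2 ^ j) *\<^sub>R \<xi>"] in \<open>simp add: field_simps\<close>)
  have 3: "norm \<xi> \<le> 2 ^ (j + 1)"
    by (rule ccontr) (use b band_large[of "(1 / 2 ^ j) *\<^sub>R \<xi>"] in \<open>simp add: field_simps\<close>)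
  from assms(2) show False
  proof
    assume "i + 2 \<le> j"
    then have "(2::real) ^ (i + 2) \<le> 2 ^ j" by (intro power_increasing) auto
    then show False using 1 2 by simp
  next
    assume ij: "j + 2 \<le> i"
    then have "dyadic \<phi>0 i \<xi> = band ((1 / 2 ^ i) *\<^sub>R \<xi>)" by (intro dyadic_eq_band) auto
    then have "2 ^ i < 2 * norm \<xi>"
      by (intro ccontr[of "2 ^ i < 2 * norm \<xi>"]) (use d band_small[of "(1 / 2 ^ i) *\<^sub>R \<xi>"] in \<open>simp add: field_simps\<close>)
    moreover have "(2::real) ^ (j + 2) \<le> 2 ^ i" using ij by (intro power_increasing) auto
    ultimately show False using 3 by simp
  qed
qed

section \<open>The profile, its rescaled waves and their Littlewood-Paley pieces\<close>

definition profile :: "'a \<Rightarrow> real" where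
  "profile x = Re (ftrans (2 * pi) (\<lambda>\<xi>. of_real (band \<xi>)) x)"

lemma band_integrable: "integrable lborel (\<lambda>\<xi>. complex_of_real (band \<xi>))"
  by (rule integrable_continuous_bounded_support[where R = 2])
    (auto intro!: continuous_intros band_continuous simp: band_large)

text \<open>\<open>band\<close> is even, so replacing \<xi> by its negative conjugates the integrand
  and the transform is real; \<open>Re\<close> in the definition of \<open>profile\<close> loses
  nothing.\<close>

lemma ftrans_band: "ftrans (2 * pi) (\<lambda>\<xi>. of_real (band \<xi>)) x = of_real (profile x)"
proof -
  let ?f = "\<lambda>\<xi>. cis (2 * pi * (x \<bullet> \<xi>)) * of_real (band \<xi>)"
  have [measurable]: "(\<lambda>\<xi>. complex_of_real (band \<xi>)) \<in> borel_measurable borel"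
    using band_integrable by auto
  have "(\<integral>\<xi>. ?f \<xi> \<partial>lborel) = (\<integral>\<xi>. ?f (0 + (-1) *\<^sub>R \<xi>) \<partial>lborel)"
    by (subst lborel_integral_affine[where c = "-1" and t = 0]) auto
  also have "\<dots> = (\<integral>\<xi>. cnj (?f \<xi>) \<partial>lborel)"
    by (simp add: band_uminus cis_cnj)
  also have "\<dots> = cnj (\<integral>\<xi>. ?f \<xi> \<partial>lborel)" 
    by (rule integral_bounded_linear[OF bounded_linear_cnj integrable_cis_mult[OF band_integrable]])
  finally have "Im (ftrans (2 * pi) (\<lambda>\<xi>. of_real (band \<xi>)) x) = 0"
    by (simp add: ftrans_def complex_eq_iff)
  then show ?thesis by (simp add: profile_def complex_eq_iff)
qed

lemma profile_continuous: "continuous_on UNIV profile"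
  unfolding profile_def by (intro continuous_intros continuous_ftrans band_integrable)

lemma profile_decay:
  obtains B where "0 \<le> B" "\<And>x. \<bar>profile x\<bar> \<le> B * (1 + norm x) powr (- real n)"
proof (rule ftrans_decay[of band 2 n])
  fix B assume "0 \<le> B"
    "\<And>x. norm (ftrans (2 * pi) (\<lambda>x. of_real (band x)) x) \<le> B * (1 + norm x) powr (- real n)"
  then show thesis by (intro that[of B]) (simp_all add: ftrans_band)
qed (auto intro: band_continuous band_large band_fdiff_bounded)

lemma profile_bounded: obtains B where "0 \<le> B" "\<And>x. \<bar>profile x\<bar> \<le> B"
proof (rule profile_decay[of 0])
  fix B assume B: "0 \<le> B" "\<And>x. \<bar>profile x\<bar> \<le> B * (1 + norm x) powr (- real 0)"
  have "1 + norm x \<noteq> 0" for x :: 'a using norm_ge_zero[of x] by linarith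
  then show thesis using B by (intro that[of B]) simp_all
qed

lemma profile_integrable: "integrable lborel profile"
proof -
  obtain B where "\<And>x. \<bar>profile x\<bar> \<le> B * (1 + norm x) powr (- real (2 * DIM('a)))"
    by (rule profile_decay) blast
  then show ?thesis
    by (intro integrable_power_decay[where r = "real (2 * DIM('a))"])
      (auto intro!: borel_measurable_continuous_onI profile_continuous)
qed

text \<open>The value at 0 is the integral of \<open>band\<close>. If \<open>band\<close> vanished
  identically, the cutoff would be invariant under doubling, yet it is 1 at a unit vector and 0 at
  four times that vector.\<close>

lemma profile_0_pos: "0 < profile 0"
proof -
  have int: "integrable lborel band"
    by (rule integrable_continuous_bounded_support[where R = 2])
      (auto intro!: band_continuous simp: band_large)
  have eq: "of_real (profile 0) = complex_of_real (\<integral>\<xi>. band \<xi> \<partial>lborel)"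
    unfolding ftrans_band[symmetric] ftrans_def by simp
  then have eq: "profile 0 = (\<integral>\<xi>. band \<xi> \<partial>lborel)" by (simp only: of_real_eq_iff)
  have "\<exists>a. band a \<noteq> 0"
  proof (rule ccontr)
    assume "\<not> ?thesis"
    then have z: "\<phi>0 \<xi> = \<phi>0 (2 *\<^sub>R \<xi>)" for \<xi> by (simp add: band_def)
    obtain b :: 'a where b: "b \<in> Basis" using nonempty_Basis by blast
    have "\<phi>0 b = \<phi>0 (4 *\<^sub>R b)" using z[of b] z[of "2 *\<^sub>R b"] by simp
    moreover have "\<phi>0 (4 *\<^sub>R b) = 0" using b by (intro phi_zero) simp
    ultimately show False using phi_one[of b] b by simp
  qed
  then obtain a where "0 < band a" using band_nonneg by (metis order_less_le)
  then show ?thesis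
    unfolding eq by (intro integral_continuous_nonneg_pos band_continuous int band_nonneg)
qed

definition wave :: "'a \<Rightarrow> nat \<Rightarrow> 'a \<Rightarrow> real" where
  "wave x0 j x = (2 ^ j) ^ DIM('a) * profile (2 ^ j *\<^sub>R (x - x0))"

definition wave_ft :: "'a \<Rightarrow> nat \<Rightarrow> 'a \<Rightarrow> complex" where
  "wave_ft x0 j \<xi> = cis (2 * pi * - (x0 \<bullet> \<xi>)) * of_real (band ((1 / 2 ^ j) *\<^sub>R \<xi>))"

lemma ftrans_wave_ft: "ftrans (2 * pi) (wave_ft x0 j) x = of_real (wave x0 j x)"
proof -
  have "ftrans (2 * pi) (wave_ft x0 j) x
      = of_real (1 / \<bar>1 / 2 ^ j\<bar> ^ DIM('a)) * ftrans (2 * pi) (\<lambda>\<xi>. of_real (band \<xi>)) ((1 / (1 / 2 ^ j)) *\<^sub>R (x - x0))"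
    unfolding wave_ft_def by (rule ftrans_affine) (use band_integrable in auto)
  then show ?thesis unfolding ftrans_band wave_def by (simp add: power_divide)
qed

lemma wave_integrable: "integrable lborel (wave x0 j)"
proof -
  have "integrable lborel (\<lambda>x. profile (- (2 ^ j *\<^sub>R x0) + 2 ^ j *\<^sub>R x))"
    by (rule lborel_integrable_affine[OF profile_integrable]) simp
  then have "integrable lborel (\<lambda>x. (2 ^ j) ^ DIM('a) * profile (- (2 ^ j *\<^sub>R x0) + 2 ^ j *\<^sub>R x))"
    by (rule integrable_mult_right)
  then show ?thesis by (simp add: wave_def[abs_def] algebra_simps)
qed

lemma wave_bounded: obtains K where "\<And>x. \<bar>wave x0 j x\<bar> \<le> K"
proof -
  obtain B where "\<And>x. \<bar>profile x\<bar> \<le> B" by (rule profile_bounded) blast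
  then have "\<bar>wave x0 j x\<bar> \<le> (2 ^ j) ^ DIM('a) * B" for x
    by (auto simp: wave_def abs_mult intro!: mult_left_mono)
  then show thesis by (rule that)
qed

lemma wave_ft_continuous: "continuous_on UNIV (wave_ft x0 j)"
  unfolding wave_ft_def by (intro continuous_intros band_scaled_continuous)

lemma wave_ft_integrable: "integrable lborel (wave_ft x0 j)"
proof (rule integrable_continuous_bounded_support[OF wave_ft_continuous, where R = "2 * 2 ^ j"])
  show "2 * 2 ^ j < norm x \<Longrightarrow> wave_ft x0 j x = 0" for x
    using band_large[of "(1 / 2 ^ j) *\<^sub>R x"] by (simp add: wave_ft_def field_simps)
qed

text \<open>The wave is an inverse transform by \<open>ftrans_wave_ft\<close>; inversion applies
  because the decay of the profile makes the wave integrable.\<close>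

lemma fourier_wave: "ftrans (- (2 * pi)) (\<lambda>x. of_real (wave x0 j x)) \<xi> = wave_ft x0 j \<xi>"
proof -
  have eq: "(\<lambda>x. complex_of_real (wave x0 j x)) = ftrans (2 * pi) (wave_ft x0 j)"
    by (simp add: ftrans_wave_ft fun_eq_iff)
  show ?thesis unfolding eq
  proof (rule ftrans_inversion[OF wave_ft_integrable wave_ft_continuous])
    show "norm (wave_ft x0 j x) \<le> 1" for x
      using band_nonneg band_le_1 by (simp add: wave_ft_def norm_mult)
    show "integrable lborel (ftrans (2 * pi) (wave_ft x0 j))"
      unfolding eq[symmetric] by (simp add: wave_integrable)
  qed
qed

definition wave_piece :: "'a \<Rightarrow> nat \<Rightarrow> nat \<Rightarrow> 'a \<Rightarrow> complex" where
  "wave_piece x0 j i = ftrans (2 * pi) (\<lambda>\<xi>. of_real (dyadic \<phi>0 i \<xi>) * wave_ft x0 j \<xi>)"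

lemma wave_piece_integrable: "integrable lborel (\<lambda>\<xi>. of_real (dyadic \<phi>0 i \<xi>) * wave_ft x0 j \<xi>)"
  by (rule integrable_continuous_bounded_support[where R = "2 * 2 ^ i"])
    (auto intro!: continuous_intros dyadic_continuous wave_ft_continuous simp: dyadic_large)

text \<open>Tested against \<theta>, the piece pairs the wave with the transform of a truncated
  inverse transform of \<theta>. \<open>ftrans_mult\<close> is applied twice: it first moves the
  forward transform onto the wave, giving \<open>wave_ft\<close>, then moves the inverse transform
  off \<theta>.\<close>

lemma LP_piece_wave:
  "represented_by schwartz_functions lebesgue (LP_piece \<phi>0 i (fun_dist (wave x0 j))) (wave_piece x0 j i)"
proof -
  have cont: "continuous_on UNIV (wave_piece x0 j i)"
    unfolding wave_piece_def by (rule continuous_ftrans[OF wave_piece_integrable])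
  then have [measurable]: "wave_piece x0 j i \<in> borel_measurable borel"
    by (rule borel_measurable_continuous_onI)
  define K where "K = (\<integral>\<xi>. norm (of_real (dyadic \<phi>0 i \<xi>) * wave_ft x0 j \<xi>) \<partial>lborel)"
  have K: "norm (wave_piece x0 j i x) \<le> K" for x
    unfolding wave_piece_def K_def by (rule norm_ftrans_le[OF wave_piece_integrable])
  have [measurable]: "wave x0 j \<in> borel_measurable borel" using wave_integrable by auto
  have "integrable lebesgue (\<lambda>x. wave_piece x0 j i x * \<theta> x) \<and>
      LP_piece \<phi>0 i (fun_dist (wave x0 j)) \<theta> = (\<integral>x. wave_piece x0 j i x * \<theta> x \<partial>lebesgue)"
    if "\<theta> \<in> schwartz_functions" for \<theta>
  proof -
    have \<theta>: "integrable lborel \<theta>" by (rule schwartz_integrable[OF that])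
    then have [measurable]: "\<theta> \<in> borel_measurable borel" by auto
    have int: "integrable lborel (\<lambda>x. wave_piece x0 j i x * \<theta> x)"
    proof (rule Bochner_Integration.integrable_bound)
      show "integrable lborel (\<lambda>x. of_real K * \<theta> x)" using \<theta> by simp
      have "norm (wave_piece x0 j i x) \<le> \<bar>K\<bar>" for x using K[of x] by simp
      then show "AE x in lborel. norm (wave_piece x0 j i x * \<theta> x) \<le> norm (of_real K * \<theta> x)"
        by (auto simp: norm_mult intro!: always_eventually mult_right_mono)
    qed measurable
    define G where "G \<xi> = of_real (dyadic \<phi>0 i \<xi>) * ftrans (2 * pi) \<theta> \<xi>" for \<xi>
    have G: "integrable lborel G"
      by (rule integrable_continuous_bounded_support[where R = "2 * 2 ^ i"])
        (auto simp: G_def dyadic_large intro!: continuous_intros dyadic_continuous continuous_ftrans \<theta>)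
    then have Gm [measurable]: "G \<in> borel_measurable borel" by auto
    have [measurable]: "ftrans (- (2 * pi)) G \<in> borel_measurable borel"
      by (intro borel_measurable_continuous_onI continuous_ftrans G)
    have "LP_piece \<phi>0 i (fun_dist (wave x0 j)) \<theta> = fun_dist (wave x0 j) (fourier (\<lambda>x. of_real (dyadic \<phi>0 i x) * inv_fourier \<theta> x))"
      by (simp add: LP_piece_def dist_inv_fourier_def dist_mult_def dist_fourier_def)
    also have "(\<lambda>x. of_real (dyadic \<phi>0 i x) * inv_fourier \<theta> x) = G"
      by (simp add: G_def[abs_def] inv_fourier_eq_ftrans)
    also have "fun_dist (wave x0 j) (fourier G) = (\<integral>x. of_real (wave x0 j x) * ftrans (- (2 * pi)) G x \<partial>lborel)"
      by (simp add: fourier_eq_ftrans fun_dist_lborel)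
    also have "\<dots> = (\<integral>\<xi>. wave_ft x0 j \<xi> * G \<xi> \<partial>lborel)"
      by (subst ftrans_mult) (auto simp: G wave_integrable fourier_wave)
    also have "\<dots> = (\<integral>\<xi>. (of_real (dyadic \<phi>0 i \<xi>) * wave_ft x0 j \<xi>) * ftrans (2 * pi) \<theta> \<xi> \<partial>lborel)"
      by (simp add: G_def mult_ac)
    also have "\<dots> = (\<integral>x. wave_piece x0 j i x * \<theta> x \<partial>lborel)"
      unfolding wave_piece_def by (rule ftrans_mult[OF wave_piece_integrable \<theta>])
    also have "\<dots> = (\<integral>x. wave_piece x0 j i x * \<theta> x \<partial>lebesgue)"
      by (rule integral_completion[symmetric]) simp
    finally show ?thesis using int by (simp add: integrable_completion)
  qed
  then show ?thesis unfolding represented_by_def by (simp add: measurable_completion)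
qed

lemma wave_piece_eq_0:
  assumes "2 \<le> j" and "i + 2 \<le> j \<or> j + 2 \<le> i"
  shows "wave_piece x0 j i x = 0"
proof -
  have "of_real (dyadic \<phi>0 i \<xi>) * wave_ft x0 j \<xi> = 0" for \<xi>
  proof -
    have "of_real (dyadic \<phi>0 i \<xi>) * wave_ft x0 j \<xi>
        = cis (2 * pi * - (x0 \<bullet> \<xi>)) * complex_of_real (dyadic \<phi>0 i \<xi> * band ((1 / 2 ^ j) *\<^sub>R \<xi>))"
      by (simp add: wave_ft_def)
    then show ?thesis by (simp only: dyadic_band_disjoint[OF assms]) simp
  qed
  then have "(\<lambda>\<xi>. of_real (dyadic \<phi>0 i \<xi>) * wave_ft x0 j \<xi>) = (\<lambda>\<xi>. 0)" by (rule ext)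
  then show ?thesis by (simp only: wave_piece_def ftrans_def) simp
qed

text \<open>For neighbouring indices the product of the two bumps is a modulated dilate of
  \<open>f r\<close> with r = 2^j / 2^i in {1/2, 1, 2}. Three decay constants therefore suffice,
  uniformly in j and x0. The condition j >= 2 forces i >= 1, where the cutoff is a dilate of
  \<open>band\<close>.\<close>

lemma wave_piece_decay:
  obtains B where "0 \<le> B"
    "\<And>x0 j i x. 2 \<le> j \<Longrightarrow> i \<le> j + 1 \<Longrightarrow> j \<le> i + 1 \<Longrightarrow>
      norm (wave_piece x0 j i x) \<le> B * (2 ^ j) ^ DIM('a) * (1 + 2 ^ j * norm (x - x0)) powr (- real n)"
proof -
  define f where "f r \<xi> = band \<xi> * band (r *\<^sub>R \<xi>)" for r \<xi>
  have fc: "continuous_on UNIV (f r)" for r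
    unfolding f_def by (intro continuous_intros band_continuous band_scaled_continuous)
  have "\<exists>B\<ge>0. \<forall>x. norm (ftrans (2 * pi) (\<lambda>\<xi>. of_real (f r \<xi>)) x) \<le> B * (1 + norm x) powr (- real n)" for r
  proof -
    have "2 < norm \<xi> \<Longrightarrow> f r \<xi> = 0" for \<xi> by (simp add: f_def band_large)
    moreover have "fdiff_bounded n (f r)"
      unfolding f_def by (intro fdiff_bounded_mult fdiff_bounded_scale band_fdiff_bounded)
    ultimately show ?thesis using ftrans_decay[OF fc, of 2 r n] by metis
  qed
  then obtain B where B0: "\<And>r. 0 \<le> B r"
    and B: "\<And>r x. norm (ftrans (2 * pi) (\<lambda>\<xi>. of_real (f r \<xi>)) x) \<le> B r * (1 + norm x) powr (- real n)"
    by metis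
  define C where "C = B 1 + B 2 + B (1 / 2)"
  have "norm (wave_piece x0 j i x) \<le> C * (2 ^ j) ^ DIM('a) * (1 + 2 ^ j * norm (x - x0)) powr (- real n)"
    if j: "2 \<le> j" and ij: "i \<le> j + 1" "j \<le> i + 1" for x0 j i x
  proof -
    define r where "r = (2::real) ^ j / 2 ^ i"
    have "i = j \<or> i = j + 1 \<or> j = i + 1" using ij by linarith
    then have "r = 1 \<or> r = 2 \<or> r = 1 / 2" by (auto simp: r_def)
    then have "B r \<in> {B 1, B 2, B (1 / 2)}" by blast
    then have BC: "B r \<le> C" using B0[of 1] B0[of 2] B0[of "1/2"] by (auto simp: C_def)
    have "of_real (dyadic \<phi>0 i \<xi>) * wave_ft x0 j \<xi>
        = cis (2 * pi * - (x0 \<bullet> \<xi>)) * of_real (f r ((1 / 2 ^ j) *\<^sub>R \<xi>))" for \<xi>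
      using j ij by (simp add: dyadic_eq_band wave_ft_def f_def r_def)
    then have "wave_piece x0 j i x = ftrans (2 * pi) (\<lambda>\<xi>. cis (2 * pi * - (x0 \<bullet> \<xi>)) * of_real (f r ((1 / 2 ^ j) *\<^sub>R \<xi>))) x"
      by (simp only: wave_piece_def)
    also have "\<dots> = of_real (1 / \<bar>1 / 2 ^ j\<bar> ^ DIM('a)) * ftrans (2 * pi) (\<lambda>\<xi>. of_real (f r \<xi>)) ((1 / (1 / 2 ^ j)) *\<^sub>R (x - x0))"
      by (rule ftrans_affine)
        (auto intro!: borel_measurable_continuous_onI continuous_intros fc)
    also have "\<dots> = of_real ((2 ^ j) ^ DIM('a)) * ftrans (2 * pi) (\<lambda>\<xi>. of_real (f r \<xi>)) (2 ^ j *\<^sub>R (x - x0))"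
      by (simp add: power_divide)
    finally have "norm (wave_piece x0 j i x) = (2 ^ j) ^ DIM('a) * norm (ftrans (2 * pi) (\<lambda>\<xi>. of_real (f r \<xi>)) (2 ^ j *\<^sub>R (x - x0)))"
      by (simp add: norm_mult norm_power)
    also have "\<dots> \<le> (2 ^ j) ^ DIM('a) * (B r * (1 + norm (2 ^ j *\<^sub>R (x - x0))) powr (- real n))"
      by (intro mult_left_mono B) auto
    also have "\<dots> \<le> (2 ^ j) ^ DIM('a) * (C * (1 + norm (2 ^ j *\<^sub>R (x - x0))) powr (- real n))"
      by (intro mult_left_mono mult_right_mono BC) auto
    finally show ?thesis by (simp add: mult_ac)
  qed
  then show thesis using B0 by (intro that[of C]) (auto simp: C_def)
qed

end

section \<open>Upper bound for the Besov quasi-norm\<close>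

lemma ennpowr_ennreal: "0 \<le> a \<Longrightarrow> ennpowr (ennreal a) r = ennreal (a powr r)"
  by (simp add: ennpowr_def)

lemma ennpowr_mono:
  assumes "x \<le> y" "0 \<le> r"
  shows "ennpowr x r \<le> ennpowr y r"
proof (cases "y = \<infinity>")
  case False
  then have "x \<noteq> \<infinity>" "enn2real x \<le> enn2real y"
    using assms(1) by (auto simp: top_unique less_top intro: enn2real_mono)
  then show ?thesis
    using False assms(2) by (auto simp: ennpowr_def intro!: ennreal_leI powr_mono2)
qed (simp add: ennpowr_def)

lemma enn2real_pos: "0 < p \<Longrightarrow> p \<noteq> \<infinity> \<Longrightarrow> 0 < enn2real p"
  by (simp add: enn2real_positive_iff less_top)

text \<open>For \<open>p = \<infinity>\<close> the exponent is \<open>- (d / 0) = 0\<close>, as it should be.\<close>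

lemma Lp_norm_decay_bound:
  assumes "0 < p" and "0 \<le> N" and N: "p \<noteq> \<infinity> \<Longrightarrow> 2 * real DIM('a) \<le> N * enn2real p"
  obtains D where "0 \<le> D"
    "\<And>(g :: 'a::euclidean_space \<Rightarrow> complex) A L x0. g \<in> borel_measurable borel \<Longrightarrow> 0 \<le> A \<Longrightarrow> 0 < L \<Longrightarrow>
      (\<And>x. norm (g x) \<le> A * (1 + L * norm (x - x0)) powr (- N)) \<Longrightarrow>
      Lp_norm lebesgue p g \<le> ennreal (A * D * L powr (- (real DIM('a) / enn2real p)))"
proof (cases "p = \<infinity>")
  case True
  have "Lp_norm lebesgue p g \<le> ennreal (A * 1 * L powr (- (real DIM('a) / enn2real p)))"
    if g: "g \<in> borel_measurable borel" "0 \<le> A" "0 < L"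
      "\<And>x. norm (g x) \<le> A * (1 + L * norm (x - x0)) powr (- N)"
    for g :: "'a \<Rightarrow> complex" and A L x0
  proof -
    have [measurable]: "g \<in> borel_measurable lebesgue" using g(1) by (simp add: measurable_completion)
    have "norm (g x) \<le> A" for x
    proof -
      have "(1 + L * norm (x - x0)) powr (- N) \<le> (1 + L * norm (x - x0)) powr 0"
        using g(3) assms(2) by (intro powr_mono) auto
      also have "\<dots> = 1"
      proof -
        have "0 \<le> L * norm (x - x0)" using g(3) by simp
        then have "1 + L * norm (x - x0) \<noteq> 0" by linarith
        then show ?thesis by simp
      qed
      finally have "A * (1 + L * norm (x - x0)) powr (- N) \<le> A * 1"
        using g(2) by (rule mult_left_mono)
      then show ?thesis using g(4)[of x] by simp
    qed
    then have "esssup lebesgue (\<lambda>x. ennreal (norm (g x))) \<le> ennreal A"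
      by (intro esssup_I) (auto intro!: ennreal_leI)
    then show ?thesis using True g(3) by (simp add: Lp_norm_def)
  qed
  then show thesis by (intro that[of 1]) auto
next
  case False
  define P where "P = enn2real p"
  have P: "0 < P" unfolding P_def by (rule enn2real_pos[OF assms(1) False])
  \<comment> \<open>The reference integral at unit scale. Substituting x0 + x / L below produces
    L^(-d), whose P-th root gives the power of L in the claim.\<close>
  define J where "J = (\<integral>x. (1 + norm (x::'a)) powr (- (N * P)) \<partial>lborel)"
  have J0: "0 \<le> J" by (simp add: J_def)
  have int: "integrable lborel (\<lambda>x::'a. (1 + norm x) powr (- (N * P)))"
    using N[OF False] by (intro integrable_norm_powr) (simp add: P_def)
  have "Lp_norm lebesgue p g \<le> ennreal (A * J powr (1 / P) * L powr (- (real DIM('a) / enn2real p)))"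
    if g: "g \<in> borel_measurable borel" "0 \<le> A" "0 < L"
      "\<And>x. norm (g x) \<le> A * (1 + L * norm (x - x0)) powr (- N)"
    for g :: "'a \<Rightarrow> complex" and A L x0
  proof -
    let ?h = "\<lambda>x. (1 + L * norm (x - x0)) powr (- (N * P))"
    have "(\<integral>\<^sup>+x. ennreal (norm (g x) powr P) \<partial>lebesgue) = (\<integral>\<^sup>+x. ennreal (norm (g x) powr P) \<partial>lborel)"
      by (rule nn_integral_completion)
    also have "\<dots> \<le> (\<integral>\<^sup>+x. ennreal (A powr P) * ennreal (?h x) \<partial>lborel)"
    proof (intro nn_integral_mono)
      fix x
      have "norm (g x) powr P \<le> (A * (1 + L * norm (x - x0)) powr (- N)) powr P"
        using P g(4) by (intro powr_mono2) auto
      also have "\<dots> = A powr P * ?h x"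
        using g by (simp add: powr_mult powr_powr)
      finally show "ennreal (norm (g x) powr P) \<le> ennreal (A powr P) * ennreal (?h x)"
        by (simp add: ennreal_mult[symmetric] ennreal_leI)
    qed
    also have "\<dots> = ennreal (A powr P) * (\<integral>\<^sup>+x. ennreal (?h x) \<partial>lborel)"
      by (intro nn_integral_cmult) simp
    also have "(\<integral>\<^sup>+x. ennreal (?h x) \<partial>lborel) = ennreal (\<bar>1 / L\<bar> ^ DIM('a)) * (\<integral>\<^sup>+x. ennreal (?h (x0 + (1 / L) *\<^sub>R x)) \<partial>lborel)"
      using g(3) by (intro nn_integral_lborel_affine) auto
    also have "(\<integral>\<^sup>+x. ennreal (?h (x0 + (1 / L) *\<^sub>R x)) \<partial>lborel) = ennreal J"
      using g(3) int by (simp add: J_def nn_integral_eq_integral)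
    finally have le: "(\<integral>\<^sup>+x. ennreal (norm (g x) powr P) \<partial>lebesgue) \<le> ennreal (A powr P * ((1 / L) ^ DIM('a) * J))"
      using g J0 by (simp add: ennreal_mult)
    have "Lp_norm lebesgue p g = ennpowr (\<integral>\<^sup>+x. ennreal (norm (g x) powr P) \<partial>lebesgue) (1 / P)"
      using False by (simp add: Lp_norm_def P_def)
    also have "\<dots> \<le> ennpowr (ennreal (A powr P * ((1 / L) ^ DIM('a) * J))) (1 / P)"
      using P by (intro ennpowr_mono le) auto
    also have "\<dots> = ennreal ((A powr P * ((1 / L) ^ DIM('a) * J)) powr (1 / P))"
      using g J0 by (intro ennpowr_ennreal) auto
    also have "(A powr P * ((1 / L) ^ DIM('a) * J)) powr (1 / P) = A * J powr (1 / P) * L powr (- (real DIM('a) / P))"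
    proof -
      have "(1 / L) ^ DIM('a) = L powr (- real DIM('a))"
        using g(3) by (simp add: powr_minus powr_realpow power_divide inverse_eq_divide)
      then show ?thesis using P g J0 by (simp add: powr_mult powr_powr)
    qed
    finally show ?thesis by (simp add: P_def)
  qed
  then show thesis by (intro that[of "J powr (1 / P)"]) auto
qed

context littlewood_paley
begin

lemma wave_besov_bound:
  assumes "0 < p" and "0 < q" and "0 < s"
  obtains C where "0 \<le> C"
    "\<And>x0 j. 2 \<le> j \<Longrightarrow> besov_norm_Rd \<phi>0 s p q (fun_dist (wave x0 j))
      \<le> ennreal (C * 2 powr (real j * (s + real DIM('a) - real DIM('a) / enn2real p)))"
proof -
  define d where "d = real DIM('a)"
  \<comment> \<open>Smaller p demands faster decay: N p >= 2d is the threshold of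
    \<open>integrable_norm_powr\<close>. For p infinite, \<open>enn2real p\<close> is 0 and the
    quotient is 0, so N = 0.\<close>
  define N where "N = nat \<lceil>2 * d / enn2real p\<rceil>"
  have N: "2 * d \<le> real N * enn2real p" if "p \<noteq> \<infinity>"
  proof -
    have "2 * d / enn2real p \<le> real N" unfolding N_def by linarith
    then show ?thesis using enn2real_pos[OF assms(1) that] by (simp add: field_simps)
  qed
  obtain B where B0: "0 \<le> B" and B: "\<And>x0 j i x. 2 \<le> j \<Longrightarrow> i \<le> j + 1 \<Longrightarrow> j \<le> i + 1 \<Longrightarrow>
      norm (wave_piece x0 j i x) \<le> B * (2 ^ j) ^ DIM('a) * (1 + 2 ^ j * norm (x - x0)) powr (- real N)"
    by (rule wave_piece_decay[of N]) blast
  obtain D where D0: "0 \<le> D" and D: "\<And>(g :: 'a \<Rightarrow> complex) A L x0. g \<in> borel_measurable borel \<Longrightarrow> 0 \<le> A \<Longrightarrow> 0 < L \<Longrightarrow>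
      (\<And>x. norm (g x) \<le> A * (1 + L * norm (x - x0)) powr (- real N)) \<Longrightarrow>
      Lp_norm lebesgue p g \<le> ennreal (A * D * L powr (- (real DIM('a) / enn2real p)))"
    by (rule Lp_norm_decay_bound[OF assms(1), of "real N"]) (use N in \<open>auto simp: d_def\<close>)
  \<comment> \<open>At most three pieces are nonzero, which costs 3^(1/q) for finite q and nothing
    for a supremum.\<close>
  define E where "E = (if q = \<infinity> then 1 else 3 powr (1 / enn2real q))"
  have E0: "0 \<le> E" by (simp add: E_def)
  have main: "besov_norm_Rd \<phi>0 s p q (fun_dist (wave x0 j))
      \<le> ennreal (E * (2 powr s * (B * D)) * 2 powr (real j * (s + d - d / enn2real p)))" if j: "2 \<le> j" for x0 j
  proof -
    define a where "a i = dist_Lp_norm p (LP_piece \<phi>0 i (fun_dist (wave x0 j)))" for i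
    define K where "K = B * (2 ^ j) ^ DIM('a) * D * (2 ^ j) powr (- (d / enn2real p))"
    \<comment> \<open>Among the surviving indices the weight is largest at i = j + 1, as s >
      0.\<close>
    define X where "X = 2 powr ((real j + 1) * s) * K"
    have K0: "0 \<le> K" using B0 D0 by (simp add: K_def)
    have X0: "0 \<le> X" using K0 by (simp add: X_def)
    have m: "wave_piece x0 j i \<in> borel_measurable borel" for i
      unfolding wave_piece_def
      by (intro borel_measurable_continuous_onI continuous_ftrans wave_piece_integrable)
    have a_le: "a i \<le> Lp_norm lebesgue p (wave_piece x0 j i)" for i
      unfolding a_def dist_Lp_norm_def by (rule Inf_lower) (use LP_piece_wave in blast)
    have near: "a i \<le> ennreal K" if "i \<le> j + 1" "j \<le> i + 1" for i
    proof -
      have "Lp_norm lebesgue p (wave_piece x0 j i) \<le> ennreal K"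
        unfolding K_def d_def using B0 by (intro D[OF m]) (auto intro!: B j that)
      then show ?thesis using a_le order_trans by blast
    qed
    have far: "a i = 0" if "\<not> (i \<le> j + 1 \<and> j \<le> i + 1)" for i
    proof -
      have "i + 2 \<le> j \<or> j + 2 \<le> i" using that by linarith
      \<comment> \<open>A vanishing piece satisfies the decay hypothesis with amplitude A = 0 and
        scale L = 1, so the general bound already gives 0.\<close>
      then have "Lp_norm lebesgue p (wave_piece x0 j i) \<le> ennreal (0 * D * 1 powr (- (real DIM('a) / enn2real p)))"
        by (intro D[OF m]) (auto simp: wave_piece_eq_0[OF j])
      then have "a i \<le> ennreal (0 * D * 1 powr (- (real DIM('a) / enn2real p)))"
        by (rule order_trans[OF a_le])
      then show ?thesis by simp
    qed
    have pw: "2 powr (real i * s) * K \<le> X" if "i \<le> j + 1" for i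
      unfolding X_def using that assms(3) K0 by (intro mult_right_mono powr_mono) auto
    have "besov_norm_Rd \<phi>0 s p q (fun_dist (wave x0 j)) \<le> ennreal (E * X)"
    proof (cases "q = \<infinity>")
      case True
      have "ennreal (2 powr (real i * s)) * a i \<le> ennreal X" for i
      proof (cases "i \<le> j + 1 \<and> j \<le> i + 1")
        case True
        have "ennreal (2 powr (real i * s)) * a i \<le> ennreal (2 powr (real i * s)) * ennreal K"
          using near True by (intro mult_left_mono) auto
        also have "\<dots> \<le> ennreal X"
          using pw True K0 by (simp add: ennreal_mult[symmetric] ennreal_leI)
        finally show ?thesis .
      qed (simp add: far)
      then show ?thesis using True by (simp add: besov_norm_Rd_def a_def E_def SUP_le_iff)
    next
      case False
      define Q where "Q = enn2real q"
      have Q: "0 < Q" unfolding Q_def by (rule enn2real_pos[OF assms(2) False])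
      define f where "f i = ennreal (2 powr (real i * s * Q)) * ennpowr (a i) Q" for i
      have f_near: "f i \<le> ennreal (X powr Q)" if "i \<le> j + 1 \<and> j \<le> i + 1" for i
      proof -
        have "f i \<le> ennreal (2 powr (real i * s * Q)) * ennpowr (ennreal K) Q"
          unfolding f_def using near that Q by (intro mult_left_mono ennpowr_mono) auto
        also have "\<dots> = ennreal ((2 powr (real i * s) * K) powr Q)"
          using K0 by (simp add: ennpowr_ennreal ennreal_mult[symmetric] powr_mult powr_powr)
        also have "\<dots> \<le> ennreal (X powr Q)"
          using pw that Q K0 by (intro ennreal_leI powr_mono2) auto
        finally show ?thesis .
      qed
      have "(\<Sum>i. f i) = (\<Sum>i\<in>{j - 1..j + 1}. f i)"
      proof (rule suminf_finite)
        fix i assume "i \<notin> {j - 1..j + 1}"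
        then have "a i = 0" by (intro far) auto
        then show "f i = 0" by (simp add: f_def ennpowr_def)
      qed simp
      also have "\<dots> \<le> (\<Sum>i\<in>{j - 1..j + 1}. ennreal (X powr Q))"
        by (intro sum_mono f_near) auto
      also have "\<dots> = ennreal (3 * X powr Q)"
      proof -
        have "card {j - 1..j + 1} = 3" using j by simp
        then show ?thesis by (simp add: ennreal_mult)
      qed
      finally have "ennpowr (\<Sum>i. f i) (1 / Q) \<le> ennpowr (ennreal (3 * X powr Q)) (1 / Q)"
        using Q by (intro ennpowr_mono) auto
      also have "\<dots> = ennreal (E * X)"
        using Q X0 False by (simp add: ennpowr_ennreal powr_mult powr_powr E_def Q_def)
      finally show ?thesis using False by (simp add: besov_norm_Rd_def a_def f_def Q_def)
    qed
    also have "E * X = E * (2 powr s * (B * D)) * 2 powr (real j * (s + d - d / enn2real p))"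
    proof -
      \<comment> \<open>Three sources of powers of 2^j: amplitude gives d, the scaling of the L^p
        quasi-norm gives - d/p, the Besov weight gives s.\<close>
      have "(2 ^ j) ^ DIM('a) = 2 powr (real j * d)"
        by (simp add: d_def powr_realpow[symmetric] powr_powr)
      moreover have "(2 ^ j) powr (- (d / enn2real p)) = 2 powr (real j * (- (d / enn2real p)))"
        by (simp only: powr_realpow[symmetric, of 2] zero_less_numeral powr_powr)
      moreover have "2 powr (real j * (s + d - d / enn2real p))
          = 2 powr (real j * s) * 2 powr (real j * d) * 2 powr (real j * (- (d / enn2real p)))"
        unfolding powr_add[symmetric] by (simp add: algebra_simps)
      moreover have "2 powr ((real j + 1) * s) = 2 powr s * 2 powr (real j * s)"
        unfolding powr_add[symmetric] by (simp add: algebra_simps)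
      ultimately show ?thesis by (simp only: X_def K_def mult_ac)
    qed
    finally show ?thesis .
  qed
  show thesis
    by (rule that[of "E * (2 powr s * (B * D))"]) (use main B0 D0 E0 in \<open>auto simp: d_def\<close>)
qed

end

section \<open>Lower bound for the variation norm\<close>

text \<open>Summation by parts, that is, translation invariance of the integral. Only \<zeta> needs
  bounded support, so v may be a growing ridge function.\<close>

lemma fdiff_pow_adjoint:
  fixes v \<zeta> :: "'a::euclidean_space \<Rightarrow> real"
  assumes "continuous_on UNIV v" and \<zeta>: "continuous_on UNIV \<zeta>" "\<And>x. R < norm x \<Longrightarrow> \<zeta> x = 0"
  shows "(\<integral>x. v x * (fdiff a ^^ n) \<zeta> x \<partial>lborel) = (\<integral>x. (fdiff (- a) ^^ n) v x * \<zeta> x \<partial>lborel)"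
  using assms(1)
proof (induction n arbitrary: v)
  case (Suc n)
  define F where "F = (fdiff a ^^ n) \<zeta>"
  have Fc: "continuous_on UNIV F" unfolding F_def by (rule fdiff_pow_continuous[OF \<zeta>(1)])
  have Fs: "F x = 0" if "R + real n * norm a < norm x" for x
    unfolding F_def using that by (intro fdiff_pow_support[OF \<zeta>(2)])
  have vc: "continuous_on UNIV (\<lambda>x. v (x + a))"
    by (rule continuous_on_compose2[OF Suc.prems]) (auto intro!: continuous_intros)
  have int: "integrable lborel (\<lambda>x. v x * F x)" "integrable lborel (\<lambda>x. v (x + a) * F x)"
    by (rule integrable_continuous_bounded_support[where R = "R + real n * norm a"];
        auto intro!: continuous_intros Fc Suc.prems vc simp: Fs)+
  have "integrable lborel (\<lambda>x. v (- a + 1 *\<^sub>R x + a) * F (- a + 1 *\<^sub>R x))"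
    using lborel_integrable_affine[OF int(2), of 1 "- a"] by simp
  then have int3: "integrable lborel (\<lambda>x. v x * F (x - a))" by simp
  then have "(\<integral>x. v x * F (x - a) \<partial>lborel) = (\<integral>x. v (x + a) * F x \<partial>lborel)"
    by (subst lborel_integral_affine[where c = 1 and t = a]) (auto simp: add.commute)
  then have "(\<integral>x. v x * (fdiff a ^^ Suc n) \<zeta> x \<partial>lborel) = (\<integral>x. fdiff (- a) v x * F x \<partial>lborel)"
    unfolding fdiff_pow_Suc_eq F_def[symmetric] using int int3
    by (simp add: fdiff_def left_diff_distrib right_diff_distrib)
  also have "\<dots> = (\<integral>x. (fdiff (- a) ^^ n) (fdiff (- a) v) x * \<zeta> x \<partial>lborel)"
    unfolding F_def using fdiff_pow_continuous[OF Suc.prems, of 1 "- a"] by (intro Suc.IH) simp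
  finally show ?case by (simp add: funpow_swap1)
qed simp

text \<open>A function with zero first difference is periodic with period a, and a periodic function
  tending to 0 along its period vanishes. Higher orders follow because differences inherit the limit
  0.\<close>

lemma fdiff_pow_eq_0_imp:
  fixes f :: "'a::real_normed_vector \<Rightarrow> real"
  assumes "\<And>x. (\<lambda>m. f (x - real m *\<^sub>R a)) \<longlonglongrightarrow> 0" and "\<And>x. (fdiff a ^^ n) f x = 0"
  shows "f x = 0"
  using assms
proof (induction n arbitrary: f x)
  case (Suc n)
  have "fdiff a f x = 0" for x
  proof (rule Suc.IH)
    fix x
    have "(\<lambda>m. f (x - real m *\<^sub>R a) - f (x - a - real m *\<^sub>R a)) \<longlonglongrightarrow> 0 - 0"
      by (intro tendsto_diff Suc.prems(1))
    then show "(\<lambda>m. fdiff a f (x - real m *\<^sub>R a)) \<longlonglongrightarrow> 0"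
      by (simp add: fdiff_def algebra_simps)
    show "(fdiff a ^^ n) (fdiff a f) x = 0" using Suc.prems(2)[of x] by (simp add: funpow_swap1)
  qed
  then have step: "f (y - a) = f y" for y by (simp add: fdiff_def)
  have "f (x - real m *\<^sub>R a) = f x" for m
  proof (induction m)
    case (Suc m)
    have eq: "x - real (Suc m) *\<^sub>R a = (x - real m *\<^sub>R a) - a" by (simp add: algebra_simps)
    show ?case unfolding eq step by (rule Suc)
  qed simp
  then show ?case using Suc.prems(1)[of x] by (simp add: LIMSEQ_const_iff)
qed simp

context littlewood_paley
begin

lemma profile_fdiff_nonzero:
  assumes "b \<in> Basis"
  obtains y where "(fdiff (- b) ^^ k) profile y \<noteq> 0"
proof (rule ccontr)
  assume "\<not> thesis"
  then have "(fdiff (- b) ^^ k) profile y = 0" for y using that by blast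
  moreover have "(\<lambda>m. profile (x - real m *\<^sub>R - b)) \<longlonglongrightarrow> 0" for x
  proof -
    obtain B where B: "0 \<le> B" "\<And>x. \<bar>profile x\<bar> \<le> B * (1 + norm x) powr (- real 1)"
      by (rule profile_decay[of 1]) blast
    have "norm (profile (x - real m *\<^sub>R - b)) \<le> B * (1 + norm x) / real m" if "0 < m" for m
    proof -
      let ?y = "x - real m *\<^sub>R - b"
      have "real m = norm (?y - x)" using assms by simp
      also have "\<dots> \<le> norm ?y + norm x" by (rule norm_triangle_ineq4)
      also have "\<dots> \<le> (1 + norm x) * (1 + norm ?y)" by (simp add: algebra_simps)
      finally have "1 / (1 + norm ?y) \<le> (1 + norm x) / real m"
        using that by (simp add: field_simps add_pos_nonneg)
      then have le: "B * (1 / (1 + norm ?y)) \<le> B * ((1 + norm x) / real m)"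
        using B(1) by (rule mult_left_mono)
      have "1 + norm ?y \<noteq> 0" using norm_ge_zero[of ?y] by linarith
      then have "(1 + norm ?y) powr (- real 1) = 1 / (1 + norm ?y)"
        by (simp add: powr_minus inverse_eq_divide)
      then have "norm (profile ?y) \<le> B * (1 / (1 + norm ?y))"
        using B(2)[of ?y] by (simp only: real_norm_def)
      also note le
      finally show ?thesis by (simp only: times_divide_eq_right)
    qed
    then have "\<forall>\<^sub>F m in sequentially. norm (profile (x - real m *\<^sub>R - b)) \<le> B * (1 + norm x) / real m"
      by (auto simp: eventually_sequentially intro!: exI[of _ 1])
    then show ?thesis by (rule Lim_null_comparison[OF _ lim_const_over_n])
  qed
  ultimately have "profile 0 = 0" by (intro fdiff_pow_eq_0_imp[of profile "- b" k])
  then show False using profile_0_pos by simp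
qed

text \<open>The k-th difference G of the profile is nonzero at some y0, hence of constant sign near
  y0. A bump \<zeta> placed there makes the integral of G \<zeta> nonzero, and its k-th difference
  is \<eta>; W is the integral of \<zeta>. The ridge bound allows the argument t + c x so that it
  can be used after rescaling, where |c|^k is the gain.\<close>

lemma profile_test_function:
  obtains \<eta> R W \<kappa> where "smooth \<eta>" "\<And>x. R < norm x \<Longrightarrow> \<eta> x = 0" "0 < R" "0 \<le> W" "\<kappa> \<noteq> 0"
    "(\<integral>x. profile x * \<eta> x \<partial>lborel) = \<kappa>"
    "\<And>\<omega> b c t. norm \<omega> = 1 \<Longrightarrow> 1 \<le> k \<Longrightarrow>
       \<bar>\<integral>x. ridge_power k (\<omega> \<bullet> (t + c *\<^sub>R x) - b) * \<eta> x \<partial>lborel\<bar> \<le> fact k * \<bar>c\<bar> ^ k * W"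
proof -
  obtain b :: 'a where b: "b \<in> Basis" using nonempty_Basis by blast
  define G where "G = (fdiff (- b) ^^ k) profile"
  obtain y0 where y0: "G y0 \<noteq> 0" unfolding G_def by (rule profile_fdiff_nonzero[OF b])
  have Gc: "continuous_on UNIV G" unfolding G_def by (rule fdiff_pow_continuous[OF profile_continuous])
  have "open {y. 0 < G y * G y0}"
    using Gc by (intro open_Collect_less continuous_intros)
  moreover have "y0 \<in> {y. 0 < G y * G y0}" using y0 by (simp add: zero_less_mult_iff) linarith
  ultimately obtain \<delta> where \<delta>: "0 < \<delta>" "ball y0 \<delta> \<subseteq> {y. 0 < G y * G y0}"
    by (meson openE)
  \<comment> \<open>At distance \<delta> from y0 the rescaled argument has norm at least 3, beyond
    the radius 2 of the cutoff.\<close>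
  define r where "r = 3 / \<delta>"
  have r: "0 < r" using \<delta> by (simp add: r_def)
  define \<zeta> where "\<zeta> y = \<phi>0 (r *\<^sub>R y + - (r *\<^sub>R y0))" for y
  have \<zeta>r: "\<zeta> y = \<phi>0 (r *\<^sub>R (y - y0))" for y by (simp add: \<zeta>_def algebra_simps)
  have \<zeta>smooth: "smooth \<zeta>" unfolding \<zeta>_def by (rule smooth_affine[OF phi_smooth])
  have \<zeta>c: "continuous_on UNIV \<zeta>" by (rule smooth_imp_continuous[OF \<zeta>smooth])
  have \<zeta>out: "\<zeta> y = 0" if "y \<notin> ball y0 \<delta>" for y
  proof -
    have "\<delta> \<le> norm (y - y0)" using that by (simp add: dist_norm norm_minus_commute)
    then have "r * \<delta> \<le> norm (r *\<^sub>R (y - y0))" using r by simp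
    moreover have "r * \<delta> = 3" using \<delta>(1) by (simp add: r_def)
    ultimately have "2 < norm (r *\<^sub>R (y - y0))" by linarith
    then show ?thesis unfolding \<zeta>r by (rule phi_zero)
  qed
  define R0 where "R0 = norm y0 + \<delta>"
  have \<zeta>s: "\<zeta> y = 0" if "R0 < norm y" for y
  proof (rule \<zeta>out)
    have "norm y \<le> norm y0 + norm (y - y0)" using norm_triangle_sub by blast
    then show "y \<notin> ball y0 \<delta>" using that by (simp add: R0_def dist_norm norm_minus_commute)
  qed
  have \<zeta>nn: "0 \<le> \<zeta> y" for y unfolding \<zeta>_def by (rule phi_bounds)
  have \<zeta>int: "integrable lborel \<zeta>" by (rule integrable_continuous_bounded_support[OF \<zeta>c \<zeta>s])
  define \<eta> where "\<eta> = (fdiff b ^^ k) \<zeta>"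
  define \<kappa> where "\<kappa> = (\<integral>x. profile x * \<eta> x \<partial>lborel)"
  show thesis
  proof (rule that[of \<eta> "R0 + real k * norm b" "\<integral>x. \<zeta> x \<partial>lborel" \<kappa>])
    show "smooth \<eta>" unfolding \<eta>_def by (rule smooth_fdiff_pow[OF \<zeta>smooth])
    show "\<eta> x = 0" if "R0 + real k * norm b < norm x" for x
      unfolding \<eta>_def using \<zeta>s that fdiff_pow_support[of R0 \<zeta> k b x] by blast
    have "0 < R0" using \<delta>(1) by (simp add: R0_def add_nonneg_pos)
    then show "0 < R0 + real k * norm b" by (simp add: add_pos_nonneg)
    show "0 \<le> (\<integral>x. \<zeta> x \<partial>lborel)" by (simp add: \<zeta>nn)
    \<comment> \<open>The constant factor G y0 makes the integrand nonnegative whichever sign G has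
      near y0.\<close>
    have "0 < (\<integral>x. G x * \<zeta> x * G y0 \<partial>lborel)"
    proof (rule integral_continuous_nonneg_pos)
      show "continuous_on UNIV (\<lambda>x. G x * \<zeta> x * G y0)" by (intro continuous_intros Gc \<zeta>c)
      then show "integrable lborel (\<lambda>x. G x * \<zeta> x * G y0)"
        by (rule integrable_continuous_bounded_support[where R = R0]) (simp add: \<zeta>s)
      show "0 \<le> G x * \<zeta> x * G y0" for x
      proof (cases "x \<in> ball y0 \<delta>")
        case True
        then have "0 < G x * G y0" using \<delta>(2) by blast
        then have "0 \<le> (G x * G y0) * \<zeta> x" by (intro mult_nonneg_nonneg \<zeta>nn less_imp_le)
        then show ?thesis by (simp add: mult_ac)
      qed (simp add: \<zeta>out)
      have "\<zeta> y0 = 1" unfolding \<zeta>r by (simp add: phi_one)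
      then show "0 < G y0 * \<zeta> y0 * G y0" using y0 by (simp add: zero_less_mult_iff) linarith
    qed
    then have "(\<integral>x. G x * \<zeta> x \<partial>lborel) \<noteq> 0" by auto
    moreover have "\<kappa> = (\<integral>x. G x * \<zeta> x \<partial>lborel)"
      unfolding \<kappa>_def \<eta>_def G_def by (rule fdiff_pow_adjoint[OF profile_continuous \<zeta>c \<zeta>s])
    ultimately show "\<kappa> \<noteq> 0" by simp
    show "(\<integral>x. profile x * \<eta> x \<partial>lborel) = \<kappa>" by (simp add: \<kappa>_def)
    fix \<omega> :: 'a and \<beta> c :: real and t :: 'a assume \<omega>: "norm \<omega> = 1" and k: "1 \<le> k"
    let ?T = "\<lambda>x. \<omega> \<bullet> (t + c *\<^sub>R x) - \<beta>"
    let ?v = "\<lambda>x. ridge_power k (?T x)"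
    \<comment> \<open>Adding b to x moves the ridge argument by c (\<omega> . b), at most |c| in
      size as both vectors have norm 1.\<close>
    define \<tau> where "\<tau> = - (c * (\<omega> \<bullet> b))"
    have vc: "continuous_on UNIV ?v" unfolding ridge_power_def by (intro continuous_intros)
    have \<tau>: "\<bar>\<tau>\<bar> \<le> \<bar>c\<bar>"
    proof -
      have "\<bar>\<omega> \<bullet> b\<bar> \<le> 1" using Basis_le_norm[OF b, of \<omega>] \<omega> by simp
      then show ?thesis by (simp add: \<tau>_def abs_mult mult_left_le)
    qed
    have dv: "(fdiff (- b) ^^ k) ?v = (\<lambda>x. (fdiff \<tau> ^^ k) (ridge_power k) (?T x))"
      by (rule fdiff_pow_compose) (simp add: \<tau>_def algebra_simps inner_add_right)
    have dv_le: "\<bar>(fdiff (- b) ^^ k) ?v x\<bar> \<le> fact k * \<bar>c\<bar> ^ k" for x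
    proof -
      have "\<bar>(fdiff (- b) ^^ k) ?v x\<bar> \<le> fact k * \<bar>\<tau>\<bar> ^ k"
        unfolding dv by (rule ridge_power_fdiff_bound[OF k])
      also have "\<dots> \<le> fact k * \<bar>c\<bar> ^ k" using \<tau> by (intro mult_left_mono power_mono) auto
      finally show ?thesis .
    qed
    have eq: "(\<integral>x. ?v x * \<eta> x \<partial>lborel) = (\<integral>x. (fdiff (- b) ^^ k) ?v x * \<zeta> x \<partial>lborel)"
      unfolding \<eta>_def by (rule fdiff_pow_adjoint[OF vc \<zeta>c \<zeta>s])
    have "\<bar>\<integral>x. ?v x * \<eta> x \<partial>lborel\<bar> \<le> (\<integral>x. \<bar>(fdiff (- b) ^^ k) ?v x * \<zeta> x\<bar> \<partial>lborel)"
      unfolding eq by (rule integral_abs_bound)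
    also have "\<dots> \<le> (\<integral>x. fact k * \<bar>c\<bar> ^ k * \<zeta> x \<partial>lborel)"
    proof (rule integral_mono)
      have "continuous_on UNIV (\<lambda>x. (fdiff (- b) ^^ k) ?v x * \<zeta> x)"
        by (intro continuous_on_mult fdiff_pow_continuous vc \<zeta>c)
      then have "integrable lborel (\<lambda>x. (fdiff (- b) ^^ k) ?v x * \<zeta> x)"
        by (rule integrable_continuous_bounded_support[where R = R0]) (simp only: \<zeta>s mult_zero_right)
      then show "integrable lborel (\<lambda>x. \<bar>(fdiff (- b) ^^ k) ?v x * \<zeta> x\<bar>)" by (rule integrable_abs)
      show "integrable lborel (\<lambda>x. fact k * \<bar>c\<bar> ^ k * \<zeta> x)" using \<zeta>int by simp
      show "\<bar>(fdiff (- b) ^^ k) ?v x * \<zeta> x\<bar> \<le> fact k * \<bar>c\<bar> ^ k * \<zeta> x" for x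
        using dv_le[of x] \<zeta>nn[of x] by (simp add: abs_mult mult_right_mono)
    qed
    finally show "\<bar>\<integral>x. ?v x * \<eta> x \<partial>lborel\<bar> \<le> fact k * \<bar>c\<bar> ^ k * (\<integral>x. \<zeta> x \<partial>lborel)" by simp
  qed
qed

end

text \<open>Young's inequality |f \<psi>| <= f^2 / (2 \<epsilon>) + \<epsilon> \<psi>^2 / 2 replaces
  Cauchy-Schwarz. As the integral of f^2 is at most \<epsilon>^2, both terms are of order
  \<epsilon>, and the same majorant gives integrability.\<close>

lemma L2_pairing:
  fixes f \<psi> :: "'a \<Rightarrow> real"
  assumes fin: "finite_measure M" and [measurable]: "f \<in> borel_measurable M" "\<psi> \<in> borel_measurable M"
    and K: "\<And>x. \<bar>\<psi> x\<bar> \<le> K" and "0 < \<epsilon>" and norm: "Lp_norm M 2 f < ennreal \<epsilon>"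
  shows "integrable M (\<lambda>x. f x * \<psi> x)"
    and "\<bar>\<integral>x. f x * \<psi> x \<partial>M\<bar> \<le> \<epsilon> * (1 + K\<^sup>2 * measure M (space M))"
proof -
  interpret finite_measure M by (rule fin)
  define I where "I = (\<integral>\<^sup>+x. ennreal ((f x)\<^sup>2) \<partial>M)"
  have "Lp_norm M 2 f = ennpowr I (1 / 2)"
    by (simp add: Lp_norm_def I_def powr_numeral)
  then have I: "ennpowr I (1 / 2) < ennreal \<epsilon>" using norm by simp
  then have "I \<noteq> \<infinity>" by (auto simp: ennpowr_def)
  then obtain i where i: "I = ennreal i" "0 \<le> i" by (metis ennreal_cases infinity_ennreal_def)
  have "i powr (1 / 2) < \<epsilon>" using I i by (simp add: ennpowr_ennreal ennreal_less_iff)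
  then have "(sqrt i)\<^sup>2 < \<epsilon>\<^sup>2" using i(2) by (intro power_strict_mono) (auto simp: powr_half_sqrt)
  then have i_less: "i \<le> \<epsilon>\<^sup>2" using i(2) by simp
  have f2: "integrable M (\<lambda>x. (f x)\<^sup>2)"
    using i by (intro integrableI_bounded) (auto simp: I_def)
  have f2i: "(\<integral>x. (f x)\<^sup>2 \<partial>M) = i"
    using i f2 by (intro integral_eq_nn_integral[THEN trans]) (auto simp: I_def)
  let ?g = "\<lambda>x. (f x)\<^sup>2 / (2 * \<epsilon>) + \<epsilon> / 2 * K\<^sup>2"
  have g: "integrable M ?g" using f2 by simp
  have le: "\<bar>f x * \<psi> x\<bar> \<le> ?g x" for x
  proof -
    have "0 \<le> (\<bar>f x\<bar> - \<epsilon> * \<bar>\<psi> x\<bar>)\<^sup>2" by simp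
    then have "2 * \<epsilon> * \<bar>f x * \<psi> x\<bar> \<le> (f x)\<^sup>2 + \<epsilon>\<^sup>2 * (\<psi> x)\<^sup>2"
      by (simp add: power2_diff power_mult_distrib abs_mult algebra_simps)
    also have "(\<psi> x)\<^sup>2 \<le> K\<^sup>2" using K[of x] by (simp add: abs_le_square_iff[symmetric])
    finally have "2 * \<epsilon> * \<bar>f x * \<psi> x\<bar> \<le> (f x)\<^sup>2 + \<epsilon>\<^sup>2 * K\<^sup>2"
      by (simp add: mult_left_mono)
    then show ?thesis using \<open>0 < \<epsilon>\<close> by (simp add: field_simps power2_eq_square)
  qed
  show int: "integrable M (\<lambda>x. f x * \<psi> x)"
    by (rule Bochner_Integration.integrable_bound[OF g])
      (use le in \<open>auto intro!: always_eventually order_trans[OF le] abs_ge_self\<close>)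
  have "\<bar>\<integral>x. f x * \<psi> x \<partial>M\<bar> \<le> (\<integral>x. \<bar>f x * \<psi> x\<bar> \<partial>M)" by (rule integral_abs_bound)
  also have "\<dots> \<le> (\<integral>x. ?g x \<partial>M)" using int g le by (intro integral_mono) auto
  also have "\<dots> = i / (2 * \<epsilon>) + \<epsilon> / 2 * K\<^sup>2 * measure M (space M)"
    using f2 f2i by simp
  also have "i / (2 * \<epsilon>) \<le> \<epsilon>"
  proof -
    have "i \<le> 2 * \<epsilon>\<^sup>2" using i_less zero_le_power2[of \<epsilon>] by linarith
    then show ?thesis using \<open>0 < \<epsilon>\<close> by (simp add: field_simps power2_eq_square)
  qed
  also have "\<epsilon> / 2 * K\<^sup>2 * measure M (space M) \<le> \<epsilon> * K\<^sup>2 * measure M (space M)"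
    using \<open>0 < \<epsilon>\<close> by (intro mult_right_mono) auto
  finally show "\<bar>\<integral>x. f x * \<psi> x \<partial>M\<bar> \<le> \<epsilon> * (1 + K\<^sup>2 * measure M (space M))"
    by (simp add: algebra_simps)
qed

text \<open>A bound on a linear functional passes from the atoms to their absolutely convex hull,
  because the coefficients have total size at most 1, and then to the L^2 closure by
  continuity.\<close>

lemma dict_closure_pairing:
  fixes \<psi> :: "'a::euclidean_space \<Rightarrow> real"
  assumes \<Omega>: "\<Omega> \<in> lmeasurable" and \<psi>: "\<psi> \<in> borel_measurable borel" "\<And>x. \<bar>\<psi> x\<bar> \<le> K"
    and int: "\<And>\<omega> b. norm \<omega> = 1 \<Longrightarrow> integrable (lebesgue_on \<Omega>) (\<lambda>x. ridge_power k (\<omega> \<bullet> x - b) * \<psi> x)"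
    and Y: "0 \<le> Y" "\<And>\<omega> b. norm \<omega> = 1 \<Longrightarrow> \<bar>\<integral>x. ridge_power k (\<omega> \<bullet> x - b) * \<psi> x \<partial>lebesgue_on \<Omega>\<bar> \<le> Y"
    and g: "g \<in> dict_closure k c \<Omega>"
  shows "\<bar>\<integral>x. g x * \<psi> x \<partial>lebesgue_on \<Omega>\<bar> \<le> Y"
proof (rule field_le_epsilon)
  fix \<epsilon> :: real assume "0 < \<epsilon>"
  let ?M = "lebesgue_on \<Omega>"
  have fin: "finite_measure ?M" using \<Omega> by (rule finite_measure_lebesgue_on)
  \<comment> \<open>The constant of \<open>L2_pairing\<close>: approximating g to within \<epsilon>
    / m makes the error of the pairing at most \<epsilon>.\<close>
  define m where "m = 1 + K\<^sup>2 * measure ?M (space ?M)"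
  have m: "1 \<le> m" by (simp add: m_def)
  have "0 < \<epsilon> / m" using \<open>0 < \<epsilon>\<close> m by simp
  then obtain g' where g': "g' \<in> abs_convex_hull (dictionary k c)"
      and close: "Lp_norm ?M 2 (\<lambda>x. g x - g' x) < ennreal (\<epsilon> / m)"
    using g unfolding dict_closure_def by blast
  from g' obtain N :: nat and a v where gv: "g' = (\<lambda>x. \<Sum>i<N. a i * v i x)"
      and v: "\<And>i. i < N \<Longrightarrow> v i \<in> dictionary k c" and a: "(\<Sum>i<N. \<bar>a i\<bar>) \<le> 1"
    unfolding abs_convex_hull_def by blast
  have vi: "integrable ?M (\<lambda>x. v i x * \<psi> x)" "\<bar>\<integral>x. v i x * \<psi> x \<partial>?M\<bar> \<le> Y"
      "continuous_on UNIV (v i)" if i: "i < N" for i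
  proof -
    obtain \<omega> b where \<omega>: "v i = (\<lambda>x. ridge_power k (\<omega> \<bullet> x - b))" "norm \<omega> = 1"
      using v[OF i] by (auto simp: dictionary_def)
    show "integrable ?M (\<lambda>x. v i x * \<psi> x)" "\<bar>\<integral>x. v i x * \<psi> x \<partial>?M\<bar> \<le> Y"
      unfolding \<omega>(1) by (rule int Y \<omega>(2))+
    show "continuous_on UNIV (v i)" unfolding \<omega>(1) ridge_power_def by (intro continuous_intros)
  qed
  have g'\<psi>: "(\<lambda>x. g' x * \<psi> x) = (\<lambda>x. \<Sum>i<N. a i * (v i x * \<psi> x))"
    unfolding gv by (auto simp: sum_distrib_right mult.assoc)
  have int': "integrable ?M (\<lambda>x. g' x * \<psi> x)"
    unfolding g'\<psi> using vi by (intro Bochner_Integration.integrable_sum integrable_mult_right) auto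
  have "(\<integral>x. g' x * \<psi> x \<partial>?M) = (\<Sum>i<N. a i * (\<integral>x. v i x * \<psi> x \<partial>?M))"
    unfolding g'\<psi> using vi by (subst Bochner_Integration.integral_sum) auto
  also have "\<bar>\<dots>\<bar> \<le> (\<Sum>i<N. \<bar>a i\<bar> * Y)"
    using vi by (intro order_trans[OF sum_abs] sum_mono) (auto simp: abs_mult intro!: mult_left_mono)
  also have "\<dots> \<le> 1 * Y" unfolding sum_distrib_right[symmetric] using a Y(1) by (rule mult_right_mono)
  finally have 1: "\<bar>\<integral>x. g' x * \<psi> x \<partial>?M\<bar> \<le> Y" by simp
  have gm: "g \<in> borel_measurable ?M" using g by (auto simp: dict_closure_def Lp_space_def)
  have "continuous_on UNIV g'" unfolding gv using vi by (intro continuous_intros) auto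
  then have "g' \<in> borel_measurable borel" by (rule borel_measurable_continuous_onI)
  then have g'm: "g' \<in> borel_measurable ?M"
    by (intro measurable_restrict_space1 measurable_completion) simp
  have \<psi>m: "\<psi> \<in> borel_measurable ?M"
    using \<psi>(1) by (intro measurable_restrict_space1 measurable_completion) simp
  note L2 = L2_pairing[OF fin borel_measurable_diff[OF gm g'm] \<psi>m \<psi>(2) \<open>0 < \<epsilon> / m\<close> close]
  have "(\<integral>x. g x * \<psi> x \<partial>?M) = (\<integral>x. (g x - g' x) * \<psi> x + g' x * \<psi> x \<partial>?M)"
    by (simp add: algebra_simps)
  also have "\<dots> = (\<integral>x. (g x - g' x) * \<psi> x \<partial>?M) + (\<integral>x. g' x * \<psi> x \<partial>?M)"
    by (rule Bochner_Integration.integral_add[OF L2(1) int'])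
  finally have "\<bar>\<integral>x. g x * \<psi> x \<partial>?M\<bar> \<le> \<bar>\<integral>x. (g x - g' x) * \<psi> x \<partial>?M\<bar> + \<bar>\<integral>x. g' x * \<psi> x \<partial>?M\<bar>"
    by linarith
  moreover have "\<epsilon> / m * (1 + K\<^sup>2 * measure ?M (space ?M)) = \<epsilon>"
    unfolding m_def[symmetric] using m by simp
  ultimately show "\<bar>\<integral>x. g x * \<psi> x \<partial>?M\<bar> \<le> Y + \<epsilon>" using L2(2) 1 by linarith
qed

text \<open>Duality. If t g represents T with g in the closure, then T at \<psi> is t times a
  pairing bounded by Y, so t is at least the quotient on the left. This bounds both infima in the
  norm at once.\<close>

lemma L1_norm_ge:
  fixes \<psi> :: "'a::euclidean_space \<Rightarrow> real"
  assumes \<Omega>: "\<Omega> \<in> lmeasurable" and \<psi>: "continuous_on UNIV \<psi>" "\<And>x. R < norm x \<Longrightarrow> \<psi> x = 0" "\<And>x. \<bar>\<psi> x\<bar> \<le> K"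
    and supp: "\<And>x. x \<notin> \<Omega> \<Longrightarrow> \<psi> x = 0"
    and test: "(\<lambda>x. complex_of_real (\<psi> x)) \<in> test_functions \<Omega>"
    and Y: "0 < Y" "\<And>\<omega> b. norm \<omega> = 1 \<Longrightarrow> \<bar>\<integral>x. ridge_power k (\<omega> \<bullet> x - b) * \<psi> x \<partial>lborel\<bar> \<le> Y"
  shows "ennreal (norm (T (\<lambda>x. complex_of_real (\<psi> x))) / Y) \<le> L1_norm k c \<Omega> T"
  unfolding L1_norm_def L1_norm_fun_def
proof (safe intro!: Inf_greatest)
  fix t g
  assume rep: "represented_by (test_functions \<Omega>) (lebesgue_on \<Omega>) T (\<lambda>x. complex_of_real (t * g x))"
    and t: "0 < t" and g: "g \<in> dict_closure k c \<Omega>"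
  let ?M = "lebesgue_on \<Omega>"
  have \<Omega>': "\<Omega> \<inter> space lebesgue \<in> sets lebesgue" using \<Omega> by (simp add: fmeasurableD)
  have int: "integrable ?M (\<lambda>x. ridge_power k (\<omega> \<bullet> x - b) * \<psi> x)"
    and eq: "(\<integral>x. ridge_power k (\<omega> \<bullet> x - b) * \<psi> x \<partial>?M) = (\<integral>x. ridge_power k (\<omega> \<bullet> x - b) * \<psi> x \<partial>lborel)" for \<omega> b
  proof -
    let ?f = "\<lambda>x. ridge_power k (\<omega> \<bullet> x - b) * \<psi> x"
    have "continuous_on UNIV ?f" unfolding ridge_power_def by (intro continuous_intros \<psi>)
    then have f: "integrable lborel ?f"
      by (rule integrable_continuous_bounded_support[where R = R]) (simp add: \<psi>)
    have ind: "(\<lambda>x. indicat_real \<Omega> x * ?f x) = ?f" using supp by (auto simp: fun_eq_iff indicator_def)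
    have "?f \<in> borel_measurable lborel" using f by auto
    then show "integrable ?M ?f" "integral\<^sup>L ?M ?f = integral\<^sup>L lborel ?f"
      using f by (simp_all add: integrable_restrict_space[OF \<Omega>'] integral_restrict_space[OF \<Omega>'] ind
          integrable_completion integral_completion)
  qed
  have \<psi>m: "\<psi> \<in> borel_measurable borel" by (rule borel_measurable_continuous_onI[OF \<psi>(1)])
  have "\<bar>\<integral>x. g x * \<psi> x \<partial>?M\<bar> \<le> Y"
    by (rule dict_closure_pairing[OF \<Omega> \<psi>m \<psi>(3) int _ _ g]) (use Y in \<open>auto simp: eq\<close>)
  have "T (\<lambda>x. complex_of_real (\<psi> x)) = (\<integral>x. complex_of_real (t * g x) * complex_of_real (\<psi> x) \<partial>?M)"
    using rep test unfolding represented_by_def by blast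
  also have "\<dots> = complex_of_real (\<integral>x. t * g x * \<psi> x \<partial>?M)"
    unfolding of_real_mult[symmetric] by (rule integral_complex_of_real)
  also have "(\<integral>x. t * g x * \<psi> x \<partial>?M) = t * (\<integral>x. g x * \<psi> x \<partial>?M)"
    unfolding mult.assoc by simp
  finally have "norm (T (\<lambda>x. complex_of_real (\<psi> x))) = t * \<bar>\<integral>x. g x * \<psi> x \<partial>?M\<bar>"
    using t by (simp only: norm_of_real abs_mult abs_of_pos)
  also have "\<dots> \<le> t * Y" using t \<open>\<bar>\<integral>x. g x * \<psi> x \<partial>?M\<bar> \<le> Y\<close> by simp
  finally show "ennreal (norm (T (\<lambda>x. complex_of_real (\<psi> x))) / Y) \<le> ennreal t"
    using Y(1) t by (intro ennreal_leI) (simp add: field_simps)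
qed

section \<open>Variation norm of the waves and comparison with the Besov quasi-norm\<close>

context littlewood_paley
begin

lemma wave_L1_bound:
  fixes \<Omega> :: "'a set"
  assumes "open \<Omega>" "bounded \<Omega>" "x0 \<in> \<Omega>" "1 \<le> k"
  obtains c0 J where "0 < c0"
    "\<And>j. J \<le> j \<Longrightarrow> ennreal (c0 * (2 ^ j) ^ (DIM('a) + k)) \<le> L1_norm k c \<Omega> (fun_dist (wave x0 j))"
proof -
  obtain \<eta> R W \<kappa> where \<eta>: "smooth \<eta>" "\<And>x. R < norm x \<Longrightarrow> \<eta> x = 0" and R: "0 < R" and W: "0 \<le> W" and \<kappa>: "\<kappa> \<noteq> 0"
    and prof: "(\<integral>x. profile x * \<eta> x \<partial>lborel) = \<kappa>"
    and ridge: "\<And>\<omega> b c t. norm \<omega> = 1 \<Longrightarrow> 1 \<le> k \<Longrightarrow>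
       \<bar>\<integral>x. ridge_power k (\<omega> \<bullet> (t + c *\<^sub>R x) - b) * \<eta> x \<partial>lborel\<bar> \<le> fact k * \<bar>c\<bar> ^ k * W"
    by (rule profile_test_function[of k]) blast
  have \<eta>c: "continuous_on UNIV \<eta>" by (rule smooth_imp_continuous[OF \<eta>(1)])
  then have [measurable]: "\<eta> \<in> borel_measurable borel" by (rule borel_measurable_continuous_onI)
  have "compact (\<eta> ` cball 0 R)" using \<eta>c by (intro compact_continuous_image) (auto intro: continuous_on_subset)
  then have "bounded (\<eta> ` cball 0 R)" by (rule compact_imp_bounded)
  then obtain K where K: "0 < K" "\<And>x. x \<in> cball 0 R \<Longrightarrow> \<bar>\<eta> x\<bar> \<le> K" by (auto simp: bounded_pos)
  have \<eta>K: "\<bar>\<eta> x\<bar> \<le> K" for x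
    using K \<eta>(2)[of x] by (cases "norm x \<le> R") auto
  obtain \<delta> where \<delta>: "0 < \<delta>" "ball x0 \<delta> \<subseteq> \<Omega>" using assms by (meson openE)
  \<comment> \<open>From this scale on, the rescaled test function is supported in a ball of radius
    R / 2^j < \<delta>, inside \<Omega>.\<close>
  obtain J where J: "R / \<delta> < 2 ^ J" using real_arch_pow[of 2 "R / \<delta>"] by auto
  \<comment> \<open>W + 1 instead of W keeps the denominator, and \<open>Y\<close> below, positive
    when only W >= 0 is known.\<close>
  define c0 where "c0 = \<bar>\<kappa>\<bar> / (fact k * (W + 1))"
  have c0: "0 < c0" using \<kappa> W by (simp add: c0_def)
  have "ennreal (c0 * (2 ^ j) ^ (DIM('a) + k)) \<le> L1_norm k c \<Omega> (fun_dist (wave x0 j))" if "J \<le> j" for j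
  proof -
    define L where "L = (2::real) ^ j"
    have L: "0 < L" by (simp add: L_def)
    have "(2::real) ^ J \<le> L" unfolding L_def using that by (intro power_increasing) auto
    then have "R / \<delta> < L" using J by linarith
    then have RL: "R / L < \<delta>" using \<delta>(1) L by (simp add: field_simps)
    define \<psi> where "\<psi> x = \<eta> (L *\<^sub>R x + - (L *\<^sub>R x0))" for x
    have \<psi>s: "smooth \<psi>" unfolding \<psi>_def by (rule smooth_affine[OF \<eta>(1)])
    have \<psi>c: "continuous_on UNIV \<psi>" by (rule smooth_imp_continuous[OF \<psi>s])
    have \<psi>m [measurable]: "\<psi> \<in> borel_measurable borel" using \<psi>c by (rule borel_measurable_continuous_onI)
    have \<psi>z: "\<psi> x = 0" if "x \<notin> cball x0 (R / L)" for x
    proof -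
      have "R < L * norm (x - x0)" using that L by (simp add: dist_norm norm_minus_commute field_simps)
      also have "\<dots> = norm (L *\<^sub>R x + - (L *\<^sub>R x0))" using L by (simp flip: scaleR_diff_right)
      finally show ?thesis unfolding \<psi>_def by (rule \<eta>(2))
    qed
    have sub: "cball x0 (R / L) \<subseteq> \<Omega>" using \<delta>(2) RL by (auto simp: subset_iff)
    have \<psi>a: "\<psi> (x0 + (1 / L) *\<^sub>R x) = \<eta> x" for x using L by (simp add: \<psi>_def algebra_simps)
    \<comment> \<open>The substitution x0 + x / L gives L^(-d), and the k-th difference of the ridge
      function with step of order 1 / L gives L^(-k).\<close>
    define Y where "Y = (1 / L) ^ DIM('a) * (fact k * (1 / L) ^ k * (W + 1))"
    have Y: "0 < Y" using L W by (simp add: Y_def add_nonneg_pos)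
    have bound: "ennreal (norm (fun_dist (wave x0 j) (\<lambda>x. complex_of_real (\<psi> x))) / Y) \<le> L1_norm k c \<Omega> (fun_dist (wave x0 j))"
    proof (rule L1_norm_ge[OF _ \<psi>c])
      show "\<Omega> \<in> lmeasurable" using assms by (simp add: lmeasurable_open)
      show "\<psi> x = 0" if "norm x0 + R / L < norm x" for x
      proof (rule \<psi>z)
        have "norm x \<le> norm x0 + norm (x - x0)" using norm_triangle_sub by blast
        then show "x \<notin> cball x0 (R / L)" using that by (simp add: dist_norm norm_minus_commute)
      qed
      show "\<bar>\<psi> x\<bar> \<le> K" for x unfolding \<psi>_def by (rule \<eta>K)
      show "\<psi> x = 0" if "x \<notin> \<Omega>" for x using that sub by (intro \<psi>z) auto
      have "{x. complex_of_real (\<psi> x) \<noteq> 0} \<subseteq> cball x0 (R / L)"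
        by (rule subsetI, rule ccontr) (use \<psi>z in auto)
      then have ts: "tsupport (\<lambda>x. complex_of_real (\<psi> x)) \<subseteq> cball x0 (R / L)"
        unfolding tsupport_def by (rule closure_minimal) auto
      then have "compact (tsupport (\<lambda>x. complex_of_real (\<psi> x)))"
        unfolding compact_eq_bounded_closed
        using bounded_subset[OF bounded_cball ts] by (simp add: tsupport_def)
      moreover have "smooth (\<lambda>x. complex_of_real (\<psi> x))"
        by (rule smooth_linear_image[OF \<psi>s bounded_linear_of_real])
      ultimately show "(\<lambda>x. complex_of_real (\<psi> x)) \<in> test_functions \<Omega>"
        using ts sub by (auto simp: test_functions_def)
      show "0 < Y" by (rule Y)
      fix \<omega> :: 'a and b :: real assume \<omega>: "norm \<omega> = 1"
      have [measurable]: "(\<lambda>x. ridge_power k (\<omega> \<bullet> x - b)) \<in> borel_measurable borel"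
        unfolding ridge_power_def by (intro borel_measurable_continuous_onI continuous_intros)
      have "(\<integral>x. ridge_power k (\<omega> \<bullet> x - b) * \<psi> x \<partial>lborel)
          = \<bar>1 / L\<bar> ^ DIM('a) *\<^sub>R (\<integral>x. ridge_power k (\<omega> \<bullet> (x0 + (1 / L) *\<^sub>R x) - b) * \<psi> (x0 + (1 / L) *\<^sub>R x) \<partial>lborel)"
        using L by (intro lborel_integral_affine) auto
      then have "\<bar>\<integral>x. ridge_power k (\<omega> \<bullet> x - b) * \<psi> x \<partial>lborel\<bar>
          = (1 / L) ^ DIM('a) * \<bar>\<integral>x. ridge_power k (\<omega> \<bullet> (x0 + (1 / L) *\<^sub>R x) - b) * \<eta> x \<partial>lborel\<bar>"
        unfolding \<psi>a using L by (simp add: abs_mult)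
      also have "\<dots> \<le> (1 / L) ^ DIM('a) * (fact k * \<bar>1 / L\<bar> ^ k * W)"
        using L by (intro mult_left_mono ridge \<omega> assms(4)) auto
      also have "\<dots> \<le> Y" unfolding Y_def using L by (intro mult_left_mono) auto
      finally show "\<bar>\<integral>x. ridge_power k (\<omega> \<bullet> x - b) * \<psi> x \<partial>lborel\<bar> \<le> Y" .
    qed
    have [measurable]: "wave x0 j \<in> borel_measurable borel" using wave_integrable by auto
    have "fun_dist (wave x0 j) (\<lambda>x. complex_of_real (\<psi> x)) = (\<integral>x. complex_of_real (wave x0 j x * \<psi> x) \<partial>lborel)"
      by (subst fun_dist_lborel) auto
    also have "\<dots> = complex_of_real (\<integral>x. wave x0 j x * \<psi> x \<partial>lborel)" by (rule integral_complex_of_real)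
    also have "(\<integral>x. wave x0 j x * \<psi> x \<partial>lborel)
        = \<bar>1 / L\<bar> ^ DIM('a) *\<^sub>R (\<integral>x. wave x0 j (x0 + (1 / L) *\<^sub>R x) * \<psi> (x0 + (1 / L) *\<^sub>R x) \<partial>lborel)"
      using L by (intro lborel_integral_affine) auto
    \<comment> \<open>The amplitude L^d of the wave cancels the Jacobian, so the pairing is the same
      number \<kappa> at every scale.\<close>
    also have "\<dots> = \<bar>1 / L\<bar> ^ DIM('a) *\<^sub>R (\<integral>x. L ^ DIM('a) * (profile x * \<eta> x) \<partial>lborel)"
      unfolding \<psi>a using L by (simp add: wave_def L_def[symmetric] mult.assoc)
    also have "\<dots> = \<kappa>" using L prof by (simp add: power_divide)
    finally have "norm (fun_dist (wave x0 j) (\<lambda>x. complex_of_real (\<psi> x))) = \<bar>\<kappa>\<bar>" by simp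
    moreover have "\<bar>\<kappa>\<bar> / Y = c0 * L ^ (DIM('a) + k)"
      by (simp add: Y_def c0_def power_divide power_add)
    ultimately show ?thesis using bound by (simp add: L_def)
  qed
  then show thesis using c0 by (rule that[rotated])
qed

theorem besov_not_embeds_L1:
  fixes \<Omega> :: "'a set"
  assumes "1 \<le> k" "open \<Omega>" "bounded \<Omega>" "\<Omega> \<noteq> {}" "0 < p" "0 < q" "0 < s"
    and s: "s < real k + real DIM('a) / enn2real p"
  shows "\<not> embeds (besov_space \<phi>0 s p q \<Omega>) (besov_norm \<phi>0 s p q \<Omega>) (L1_space k c \<Omega>) (L1_norm k c \<Omega>)"
proof
  assume "embeds (besov_space \<phi>0 s p q \<Omega>) (besov_norm \<phi>0 s p q \<Omega>) (L1_space k c \<Omega>) (L1_norm k c \<Omega>)"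
  then obtain C0 :: real where C0: "\<And>f. f \<in> besov_space \<phi>0 s p q \<Omega> \<Longrightarrow> L1_norm k c \<Omega> f \<le> ennreal C0 * besov_norm \<phi>0 s p q \<Omega> f"
    unfolding embeds_def by blast
  obtain x0 where "x0 \<in> \<Omega>" using assms(4) by blast
  define d where "d = real DIM('a)"
  define \<delta> where "\<delta> = real k + d / enn2real p - s"
  have \<delta>: "0 < \<delta>" using s by (simp add: \<delta>_def d_def)
  obtain C where C: "0 \<le> C" "\<And>x0 j. 2 \<le> j \<Longrightarrow> besov_norm_Rd \<phi>0 s p q (fun_dist (wave x0 j))
      \<le> ennreal (C * 2 powr (real j * (s + d - d / enn2real p)))"
    unfolding d_def by (rule wave_besov_bound[OF assms(5-7)]) blast
  obtain c0 J where c0: "0 < c0" "\<And>j. J \<le> j \<Longrightarrow>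
      ennreal (c0 * (2 ^ j) ^ (DIM('a) + k)) \<le> L1_norm k c \<Omega> (fun_dist (wave x0 j))"
    by (rule wave_L1_bound[OF assms(2,3) \<open>x0 \<in> \<Omega>\<close> assms(1)]) blast
  \<comment> \<open>The constant in \<open>embeds\<close> may be any real, and
    \<open>ennreal\<close> sends negative reals to 0, hence the maximum.\<close>
  define C1 where "C1 = max 0 C0 * C"
  have main: "c0 * 2 powr (real j * \<delta>) \<le> C1" if j: "max 2 J \<le> j" for j
  proof -
    let ?T = "fun_dist (wave x0 j)"
    let ?e = "2 powr (real j * (s + d - d / enn2real p))"
    obtain K where K: "\<And>x. \<bar>wave x0 j x\<bar> \<le> K" by (rule wave_bounded) blast
    have B: "besov_norm_Rd \<phi>0 s p q ?T \<le> ennreal (C * ?e)" using C(2) j by simp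
    then have Rd: "?T \<in> besov_space_Rd \<phi>0 s p q"
      unfolding besov_space_Rd_def
      using fun_dist_tempered[OF wave_integrable K] by (simp add: le_less_trans[OF B])
    have res: "restricts_to ?T \<Omega> ?T" by (simp add: restricts_to_def)
    have "?T \<in> besov_space \<phi>0 s p q \<Omega>"
      unfolding besov_space_def using fun_dist_distribution[OF wave_integrable K] Rd res by blast
    moreover have "besov_norm \<phi>0 s p q \<Omega> ?T \<le> ennreal (C * ?e)"
      unfolding besov_norm_def using Rd res by (intro order_trans[OF Inf_lower B]) blast
    ultimately have "L1_norm k c \<Omega> ?T \<le> ennreal C0 * ennreal (C * ?e)"
      using C0 by (meson mult_left_mono order_trans zero_le)
    also have "\<dots> = ennreal (C1 * ?e)"
      using C(1) by (simp add: C1_def ennreal_mult max_def ennreal_neg mult.assoc)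
    finally have "ennreal (c0 * (2 ^ j) ^ (DIM('a) + k)) \<le> ennreal (C1 * ?e)"
      using c0(2)[of j] j by simp
    then have "c0 * (2 ^ j) ^ (DIM('a) + k) \<le> C1 * ?e"
      using C(1) by (subst (asm) ennreal_le_iff) (auto simp: C1_def)
    \<comment> \<open>The exponents balance because d + k = \<delta> + (s + d - d/p). After division
      by the common factor the unbounded quantity 2^(j \<delta>) would stay bounded.\<close>
    moreover have "(2 ^ j) ^ (DIM('a) + k) = 2 powr (real j * \<delta>) * ?e"
      unfolding powr_add[symmetric] by (simp add: \<delta>_def d_def powr_realpow[symmetric] powr_powr algebra_simps)
    ultimately have "(c0 * 2 powr (real j * \<delta>)) * ?e \<le> C1 * ?e" by simp
    then show ?thesis by (rule mult_right_le_imp_le) simp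
  qed
  have "1 < 2 powr \<delta>" using \<delta> by simp
  then obtain n where n: "C1 / c0 < (2 powr \<delta>) ^ n" using real_arch_pow by blast
  define j where "j = max n (max 2 J)"
  have "C1 / c0 < (2 powr \<delta>) ^ n" by (rule n)
  also have "\<dots> \<le> (2 powr \<delta>) ^ j" using \<open>1 < 2 powr \<delta>\<close> by (intro power_increasing) (auto simp: j_def)
  also have "\<dots> = 2 powr (real j * \<delta>)" by (simp add: powr_realpow[symmetric] powr_powr mult.commute)
  finally have "C1 < c0 * 2 powr (real j * \<delta>)" using c0(1) by (simp add: field_simps)
  then show False using main[of j] by (simp add: j_def)
qed

end

theorem mainTheorem3:
  fixes \<Omega> :: "'a::euclidean_space set"
    and \<phi>0 :: "'a \<Rightarrow> real"
    and k :: nat and c s :: real and p q :: ennreal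
  assumes "1 \<le> k"
    and "bounded_lipschitz_domain \<Omega>"
    and "offset_bound \<Omega> c"
    and "besov_cutoff \<phi>0"
    and "0 < p" and "0 < q"
    and "0 < s" and "ennreal s < of_nat k + of_nat DIM('a) / p"
  shows "\<not> embeds (besov_space \<phi>0 s p q \<Omega>) (besov_norm \<phi>0 s p q \<Omega>)
                (L1_space k c \<Omega>) (L1_norm k c \<Omega>)"
proof -
  interpret littlewood_paley \<phi>0 by unfold_locales (rule assms(4))
  have "s < real k + real DIM('a) / enn2real p"
  \<comment> \<open>For infinite p the term d/p is 0 in \<open>ennreal\<close>, and in the reals it
    is d / 0 = 0; the two forms of the threshold agree.\<close>
  proof (cases "p = \<infinity>")
    case True
    then have "ennreal s < ennreal (real k)" using assms(8) by (simp add: ennreal_of_nat_eq_real_of_nat)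
    then show ?thesis using True assms(7) by (simp add: ennreal_less_iff)
  next
    case False
    then obtain P where P: "p = ennreal P" "0 < P" using assms(5)
      by (metis enn2real_pos ennreal_enn2real infinity_ennreal_def less_top)
    then have "ennreal s < ennreal (real k + real DIM('a) / P)"
      using assms(8) by (simp add: ennreal_of_nat_eq_real_of_nat divide_ennreal ennreal_plus)
    then show ?thesis using P assms(7) by (simp add: ennreal_less_iff del: ennreal_plus)
  qed
  moreover have "open \<Omega>" "bounded \<Omega>" "\<Omega> \<noteq> {}"
    using assms(2) by (auto simp: bounded_lipschitz_domain_def)
  ultimately show ?thesis using assms by (intro besov_not_embeds_L1)
qed

end
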